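(* For every $p$ with $0<p<\infty$, there exists a non-constant analytic map $\phi\colon\mathbb D\to\mathbb D$ for which the composition operator $C_\phi f=f\circ\phi$ is in the Schatten class $S_p(H^2)$ on the Hardy space, but is not in any Schatten class $S_q(\mathfrak B^2)$ of the Bergman space with $0<q<p/2$.
   Context: $\mathbb D$ is the open unit disk of $\mathbb C$. $H^2$ is the space of analytic $f(z)=\sum_{k\ge0} c_kz^k$ on $\mathbb D$ with $\|f\|_{H^2}^2=\sum_k|c_k|^2<\infty$; $\mathfrak B^2$ is the space of analytic $f$ on $\mathbb D$ with $\|f\|_{\mathfrak B^2}^2=\int_{\mathbb D}|f|^2\,dA<\infty$, where $dA=dx\,dy/\pi$. For a Hilbert space $H$ and $p>0$, $S_p(H)$ is the set of compact operators $T$ on $H$ with $\sum_{n\ge1}a_n(T)^p<\infty$, where $a_n(T)=\inf\{\|T-R\|:\operatorname{rank}R<n\}$ are the approximation (equivalently singular) numbers. *)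

theory Defs
  imports "HOL-Complex_Analysis.Complex_Analysis" "HOL-Library.Function_Algebras"
begin

section \<open>Operators on normed spaces of functions\<close>

text \<open>
  A space of functions on the unit disc is given by a carrier \<open>H\<close> and a norm \<open>N\<close>. Its elements
  are total functions that vanish off the disc, so that equality in the space is HOL equality.
  An operator is a HOL function of which only the values on \<open>H\<close> matter. Sums and differences of
  functions are the pointwise ones of \<open>Function_Algebras\<close>.
\<close>

definition cscale :: "complex \<Rightarrow> (complex \<Rightarrow> complex) \<Rightarrow> complex \<Rightarrow> complex" where
  "cscale c f = (\<lambda>z. c * f z)"

interpretation cfun: vector_space cscale
  by unfold_locales (auto simp: cscale_def fun_eq_iff algebra_simps)

definition bounded_operator ::
  "(complex \<Rightarrow> complex) set \<Rightarrow> ((complex \<Rightarrow> complex) \<Rightarrow> real) \<Rightarrow>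
   ((complex \<Rightarrow> complex) \<Rightarrow> (complex \<Rightarrow> complex)) \<Rightarrow> bool" where
  "bounded_operator H N T \<longleftrightarrow>
     (\<forall>f\<in>H. T f \<in> H) \<and>
     (\<forall>f\<in>H. \<forall>g\<in>H. T (f + g) = T f + T g) \<and>
     (\<forall>c. \<forall>f\<in>H. T (cscale c f) = cscale c (T f)) \<and>
     (\<exists>K. \<forall>f\<in>H. N (T f) \<le> K * N f)"

definition operator_norm ::
  "(complex \<Rightarrow> complex) set \<Rightarrow> ((complex \<Rightarrow> complex) \<Rightarrow> real) \<Rightarrow>
   ((complex \<Rightarrow> complex) \<Rightarrow> (complex \<Rightarrow> complex)) \<Rightarrow> real" where
  "operator_norm H N T = (SUP f\<in>{f\<in>H. N f \<le> 1}. N (T f))"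

definition compact_operator ::
  "(complex \<Rightarrow> complex) set \<Rightarrow> ((complex \<Rightarrow> complex) \<Rightarrow> real) \<Rightarrow>
   ((complex \<Rightarrow> complex) \<Rightarrow> (complex \<Rightarrow> complex)) \<Rightarrow> bool" where
  "compact_operator H N T \<longleftrightarrow>
     bounded_operator H N T \<and>
     (\<forall>u :: nat \<Rightarrow> complex \<Rightarrow> complex. (\<forall>n. u n \<in> H \<and> N (u n) \<le> 1) \<longrightarrow>
        (\<exists>g\<in>H. \<exists>r :: nat \<Rightarrow> nat. strict_mono r \<and>
           (\<lambda>n. N (T (u (r n)) - g)) \<longlonglongrightarrow> 0))"

text \<open>
  The range has a finite basis with fewer than \<open>n\<close> elements; \<^term>\<open>cfun.dim\<close> is not used here
  because it is \<open>0\<close> on infinite-dimensional spaces.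
\<close>

definition rank_less ::
  "(complex \<Rightarrow> complex) set \<Rightarrow> ((complex \<Rightarrow> complex) \<Rightarrow> (complex \<Rightarrow> complex)) \<Rightarrow> nat \<Rightarrow> bool" where
  "rank_less H R n \<longleftrightarrow>
     (\<exists>B. finite B \<and> cfun.independent B \<and> cfun.span B = R ` H \<and> card B < n)"

definition approximation_number ::
  "(complex \<Rightarrow> complex) set \<Rightarrow> ((complex \<Rightarrow> complex) \<Rightarrow> real) \<Rightarrow>
   ((complex \<Rightarrow> complex) \<Rightarrow> (complex \<Rightarrow> complex)) \<Rightarrow> nat \<Rightarrow> real" where
  "approximation_number H N T n =
     (INF R\<in>{R. bounded_operator H N R \<and> rank_less H R n}. operator_norm H N (T - R))"

text \<open>The series starts at index 1, as there is no operator of rank less than 0.\<close>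

definition schatten_class ::
  "real \<Rightarrow> (complex \<Rightarrow> complex) set \<Rightarrow> ((complex \<Rightarrow> complex) \<Rightarrow> real) \<Rightarrow>
   ((complex \<Rightarrow> complex) \<Rightarrow> (complex \<Rightarrow> complex)) set" where
  "schatten_class p H N =
     {T. compact_operator H N T \<and>
         summable (\<lambda>n. approximation_number H N T (Suc n) powr p)}"

section \<open>Hardy and Bergman spaces of the unit disc\<close>

abbreviation unit_disc :: "complex set" where
  "unit_disc \<equiv> ball 0 1"

definition disc_functions :: "(complex \<Rightarrow> complex) set" where
  "disc_functions = {f. f holomorphic_on unit_disc \<and> (\<forall>z. z \<notin> unit_disc \<longrightarrow> f z = 0)}"

definition hardy_space :: "(complex \<Rightarrow> complex) set" where
  "hardy_space =
     {f \<in> disc_functions. summable (\<lambda>k. (norm (fps_nth (fps_expansion f 0) k))\<^sup>2)}"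

definition hardy_norm :: "(complex \<Rightarrow> complex) \<Rightarrow> real" where
  "hardy_norm f = sqrt (\<Sum>k. (norm (fps_nth (fps_expansion f 0) k))\<^sup>2)"

definition bergman_space :: "(complex \<Rightarrow> complex) set" where
  "bergman_space =
     {f \<in> disc_functions. set_integrable lborel unit_disc (\<lambda>z. (norm (f z))\<^sup>2)}"

definition bergman_norm :: "(complex \<Rightarrow> complex) \<Rightarrow> real" where
  "bergman_norm f = sqrt ((LINT z:unit_disc|lborel. (norm (f z))\<^sup>2) / pi)"

definition composition_operator ::
  "(complex \<Rightarrow> complex) \<Rightarrow> (complex \<Rightarrow> complex) \<Rightarrow> complex \<Rightarrow> complex" where
  "composition_operator \<phi> f = (\<lambda>z. if z \<in> unit_disc then f (\<phi> z) else 0)"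

end

theory Submission
  imports Defs
begin

text \<open>
  Near the point 1 the boundary values of the symbol run along a spiral. In the coordinate \<open>w\<close> of a strip,
  \<open>phi = exp (\<i> * w - H w)\<close>, so that on the real axis the argument of \<open>phi\<close> is \<open>w\<close> while \<open>1 - |phi|\<close> is
  of order \<open>w\<^sup>2 * exp (- p * w)\<close>; the arc beyond \<open>w\<close> has length of order \<open>\<delta> = exp (- 2 * w)\<close>.
  For analytic functions a full turn of the spiral behaves like a circle, so the composition operator is
  almost diagonal for the monomials. Let \<open>\<delta>\<^sub>n\<close> be the value of \<open>\<delta>\<close> where \<open>1 - |phi|\<close> is
  \<open>1 / n\<close>; it is of order \<open>(n * (ln n)\<^sup>2) powr (- 2 / p)\<close>. On the Hardy space the
  approximation numbers are at most of order \<open>sqrt \<delta>\<^sub>n\<close>, whose \<open>p\<close>-th powers are summable thanks to the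
  logarithm. On the Bergman space they are at least of order \<open>\<delta>\<^sub>n\<close>, up to arbitrarily small powers of \<open>n\<close>: polynomials spanned by
  \<open>z ^ j\<close>, \<open>n \<le> j < 2 * n\<close>, are sampled at \<open>n\<close> points which \<open>phi\<close> sends to equidistributed
  points of a circle of radius about \<open>1 - 1 / n\<close> and which are centres of disjoint discs of radius of order
  \<open>\<delta>\<^sub>n / n\<close>.
\<close>

section \<open>Poisson kernel and traces on spirals\<close>

text \<open>The halving of the exponent comes from dimension. Near the right end of the strip the
  map to the disc contracts lengths by a factor of order \<open>\<delta>\<close>. Boundary measure,
  which governs the squared approximation numbers on the Hardy space, feels this factor once; area,
  which governs them on the Bergman space, feels it twice. Hence the Bergman numbers behave like
  squares of the Hardy numbers. The obstacle is that the symbol lives on the whole disc, while the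
  spiral only describes it near 1. The other edge of the strip and the end at -1 are made harmless
  by a holomorphic \<open>H\<close> that is positive on the real axis, exponentially small to the
  right and has Lipschitz constant 1/4, so that the growth of Im w dominates every change of
  \<open>H\<close>. The lower bound cannot sample on the spiral itself, since area integrals see
  only the interior. The sample points lie at height about 1/n in the strip and are found by the
  contraction principle, for which the same constant 1/4 serves.\<close>

lemma has_integral_circle_mean_value:
  assumes "f holomorphic_on S" "cball 0 r \<subseteq> S" "0 < r"
  shows "((\<lambda>t. f (of_real r * cis t)) has_integral (2 * of_real pi * f 0)) {0..2*pi}"
proof -
  have "((\<lambda>u. f u / (u - 0)) has_contour_integral (2 * of_real pi * \<i> * f 0)) (circlepath 0 r)"
    using assms by (intro Cauchy_integral_circlepath_simple holomorphic_on_subset[OF assms(1)]) auto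
  hence "((\<lambda>t. f (0 + of_real r * cis t) / (0 + of_real r * cis t - 0) * of_real r * \<i> * cis t)
      has_integral (2 * of_real pi * \<i> * f 0)) {0..2*pi}"
    unfolding circlepath_def by (subst (asm) has_contour_integral_part_circlepath_iff) auto
  also have "(\<lambda>t. f (0 + of_real r * cis t) / (0 + of_real r * cis t - 0) * of_real r * \<i> * cis t)
      = (\<lambda>t. \<i> * f (of_real r * cis t))"
    using assms(3) by (intro ext) (simp add: field_simps)
  finally have "((\<lambda>t. \<i> * f (of_real r * cis t)) has_integral (2 * of_real pi * \<i> * f 0)) {0..2*pi}" .
  from has_integral_mult_right[OF this, of "-\<i>"] show ?thesis
    by (simp add: algebra_simps)
qed

lemma has_integral_cis_power_orthogonal:
  "((\<lambda>t. cis t ^ j * cnj (cis t) ^ k) has_integral (if j = k then 2 * of_real pi else 0)) {0..2*pi}"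
proof -
  have mv: "((\<lambda>t. cis t ^ m) has_integral (if m = 0 then 2 * of_real pi else 0)) {0..2*pi}" for m :: nat
    using has_integral_circle_mean_value[of "\<lambda>z. z ^ m" UNIV 1, OF holomorphic_on_power[OF holomorphic_on_ident]]
    by (cases "m = 0") (auto simp: power_0_left)
  have cc: "cis t ^ n * cnj (cis t) ^ n = 1" for t n
    by (simp add: power_mult_distrib[symmetric] cis_cnj cis_mult)
  show ?thesis
  proof (cases "k \<le> j")
    case True
    have "cis t ^ j * cnj (cis t) ^ k = cis t ^ (j - k)" for t
    proof -
      have "cis t ^ j = cis t ^ (j - k) * cis t ^ k"
        using True by (simp add: power_add[symmetric])
      thus ?thesis using cc[of t k] by (simp add: mult.assoc)
    qed
    thus ?thesis using mv[of "j - k"] True by (auto split: if_splits)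
  next
    case False
    have "cis t ^ j * cnj (cis t) ^ k = cnj (cis t ^ (k - j))" for t
    proof -
      have "cnj (cis t) ^ k = cnj (cis t) ^ j * cnj (cis t) ^ (k - j)"
        using False by (simp add: power_add[symmetric])
      thus ?thesis using cc[of t j] by (simp add: mult.assoc[symmetric])
    qed
    moreover have "((\<lambda>t. cnj (cis t ^ (k - j))) has_integral cnj 0) {0..2*pi}"
      using has_integral_linear[OF mv[of "k - j"] bounded_linear_cnj] False by (simp add: o_def)
    ultimately show ?thesis using False by auto
  qed
qed

lemma of_real_norm_sq_sum:
  "complex_of_real ((cmod (\<Sum>j<N. a j * w ^ j))\<^sup>2) = (\<Sum>j<N. \<Sum>k<N. a j * cnj (a k) * (w ^ j * cnj w ^ k))"
  unfolding complex_norm_square by (simp add: sum_product algebra_simps)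

lemma has_integral_circle_parseval:
  fixes a :: "nat \<Rightarrow> complex"
  shows "((\<lambda>t. (cmod (\<Sum>j<N. a j * cis t ^ j))\<^sup>2) has_integral 2 * pi * (\<Sum>j<N. (cmod (a j))\<^sup>2)) {0..2*pi}"
proof -
  have "((\<lambda>t. \<Sum>j<N. \<Sum>k<N. a j * cnj (a k) * (cis t ^ j * cnj (cis t) ^ k)) has_integral
      (\<Sum>j<N. \<Sum>k<N. a j * cnj (a k) * (if j = k then 2 * of_real pi else 0))) {0..2*pi}"
    by (intro has_integral_sum has_integral_mult_right has_integral_cis_power_orthogonal) auto
  also have "(\<Sum>j<N. \<Sum>k<N. a j * cnj (a k) * (if j = k then 2 * of_real pi else 0))
      = (\<Sum>j<N. a j * cnj (a j) * (2 * of_real pi))"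
    by (intro sum.cong refl, subst sum.mono_neutral_cong_right[of _ "{_}"]) auto
  also have "\<dots> = of_real (2 * pi * (\<Sum>j<N. (cmod (a j))\<^sup>2))"
    by (simp add: complex_norm_square[symmetric] sum_distrib_left mult_ac)
  finally have *: "((\<lambda>t. complex_of_real ((cmod (\<Sum>j<N. a j * cis t ^ j))\<^sup>2)) has_integral
      of_real (2 * pi * (\<Sum>j<N. (cmod (a j))\<^sup>2))) {0..2*pi}"
    unfolding of_real_norm_sq_sum .
  show ?thesis
    using has_integral_Re[OF *] by simp
qed

lemma has_integral_circle_coefficient:
  assumes "f holomorphic_on ball 0 R" "0 < r" "r < R"
  shows "((\<lambda>t. f (of_real r * cis t) * cnj (cis t) ^ k) has_integral
     2 * of_real pi * ((deriv ^^ k) f 0 / fact k * of_real r ^ k)) {0..2*pi}"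
proof -
  have sub: "cball 0 r \<subseteq> ball (0::complex) R" using assms by auto
  have "((\<lambda>u. f u / (u - 0) ^ Suc k) has_contour_integral
      of_real (2 * pi) * \<i> / fact k * (deriv ^^ k) f 0) (circlepath 0 r)"
    using assms sub
    by (intro Cauchy_has_contour_integral_higher_derivative_circlepath
         holomorphic_on_imp_continuous_on holomorphic_on_subset[OF assms(1)]) auto
  hence *: "((\<lambda>t. f (0 + of_real r * cis t) / (0 + of_real r * cis t - 0) ^ Suc k * of_real r * \<i> * cis t)
      has_integral (of_real (2 * pi) * \<i> / fact k * (deriv ^^ k) f 0)) {0..2*pi}"
    unfolding circlepath_def by (subst (asm) has_contour_integral_part_circlepath_iff) auto
  have c: "inverse (cis t) = cnj (cis t)" for t by (simp add: cis_cnj)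
  have "f (0 + of_real r * cis t) / (0 + of_real r * cis t - 0) ^ Suc k * of_real r * \<i> * cis t
      = \<i> * f (of_real r * cis t) * cnj (cis t) ^ k / of_real r ^ k" for t
    using assms(2) unfolding c[symmetric] by (simp add: field_simps power_mult_distrib)
  from *[unfolded this] have "((\<lambda>t. \<i> * f (of_real r * cis t) * cnj (cis t) ^ k / of_real r ^ k)
      has_integral (of_real (2 * pi) * \<i> / fact k * (deriv ^^ k) f 0)) {0..2*pi}" .
  from has_integral_mult_right[OF this, of "-\<i> * of_real r ^ k"] show ?thesis
    using assms(2) by (simp add: algebra_simps)
qed

lemma continuous_on_circle:
  assumes "f holomorphic_on ball 0 R" "0 \<le> r" "r < R"
  shows "continuous_on A (\<lambda>t. f (of_real r * cis t))"
proof -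
  have "continuous_on A (f \<circ> (\<lambda>t. of_real r * cis t))"
    using assms
    by (intro continuous_on_compose continuous_intros
        continuous_on_subset[OF holomorphic_on_imp_continuous_on[OF assms(1)]]) (auto simp: norm_mult)
  thus ?thesis by (simp add: o_def)
qed

text \<open>Expand |F - S|^2 for the partial Taylor sum S: the cross term and the norm of S both
  equal the left side, so nonnegativity of the integral is the claim. Only finitely many
  coefficients enter, and no infinite sum is exchanged with an integral.\<close>

lemma circle_bessel:
  assumes "f holomorphic_on ball 0 R" "0 < r" "r < R"
  shows "2 * pi * (\<Sum>k<m. (cmod ((deriv ^^ k) f 0 / fact k * of_real r ^ k))\<^sup>2)
     \<le> integral {0..2*pi} (\<lambda>t. (cmod (f (of_real r * cis t)))\<^sup>2)"
proof -
  define c where "c k = (deriv ^^ k) f 0 / fact k * of_real r ^ k" for k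
  define S where "S t = (\<Sum>k<m. c k * cis t ^ k)" for t
  define F where "F t = f (of_real r * cis t)" for t
  have contF: "continuous_on {0..2*pi} F" unfolding F_def
    using assms by (intro continuous_on_circle[OF assms(1)]) auto
  have "((\<lambda>t. \<Sum>k<m. cnj (c k) * (F t * cnj (cis t) ^ k)) has_integral
      (\<Sum>k<m. cnj (c k) * (2 * of_real pi * c k))) {0..2*pi}"
    unfolding F_def c_def
    by (intro has_integral_sum has_integral_mult_right has_integral_circle_coefficient[OF assms]) auto
  moreover have "(\<lambda>t. \<Sum>k<m. cnj (c k) * (F t * cnj (cis t) ^ k)) = (\<lambda>t. F t * cnj (S t))"
    by (simp add: S_def sum_distrib_left algebra_simps)
  moreover have "(\<Sum>k<m. cnj (c k) * (2 * of_real pi * c k)) = of_real (2 * pi * (\<Sum>k<m. (cmod (c k))\<^sup>2))"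
    by (simp add: complex_norm_square sum_distrib_left algebra_simps del: of_real_power)
  ultimately have 1: "((\<lambda>t. F t * cnj (S t)) has_integral of_real (2 * pi * (\<Sum>k<m. (cmod (c k))\<^sup>2))) {0..2*pi}"
    by simp
  have 1: "((\<lambda>t. Re (F t * cnj (S t))) has_integral (2 * pi * (\<Sum>k<m. (cmod (c k))\<^sup>2))) {0..2*pi}"
    using has_integral_Re[OF 1] by simp
  have 2: "((\<lambda>t. (cmod (S t))\<^sup>2) has_integral (2 * pi * (\<Sum>k<m. (cmod (c k))\<^sup>2))) {0..2*pi}"
    unfolding S_def by (rule has_integral_circle_parseval)
  have 3: "((\<lambda>t. (cmod (F t))\<^sup>2) has_integral integral {0..2*pi} (\<lambda>t. (cmod (F t))\<^sup>2)) {0..2*pi}"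
    by (intro integrable_integral integrable_continuous_interval continuous_intros contF)
  have 4: "((\<lambda>t. (cmod (F t))\<^sup>2 - 2 * Re (F t * cnj (S t)) + (cmod (S t))\<^sup>2) has_integral
     (integral {0..2*pi} (\<lambda>t. (cmod (F t))\<^sup>2) - 2 * (2 * pi * (\<Sum>k<m. (cmod (c k))\<^sup>2)) + 2 * pi * (\<Sum>k<m. (cmod (c k))\<^sup>2))) {0..2*pi}"
    by (intro has_integral_add has_integral_diff has_integral_mult_right 1 2 3)
  have 5: "(cmod (F t))\<^sup>2 - 2 * Re (F t * cnj (S t)) + (cmod (S t))\<^sup>2 = (cmod (F t - S t))\<^sup>2" for t
    unfolding cmod_power2 by (simp add: power2_eq_square algebra_simps)
  have "0 \<le> integral {0..2*pi} (\<lambda>t. (cmod (F t))\<^sup>2) - 2 * (2 * pi * (\<Sum>k<m. (cmod (c k))\<^sup>2)) + 2 * pi * (\<Sum>k<m. (cmod (c k))\<^sup>2)"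
    by (rule has_integral_nonneg[OF 4], subst 5) simp
  thus ?thesis unfolding F_def c_def by simp
qed

text \<open>Taken without the customary factor 1 / (2 * pi), so that its mass over a period is 2 *
  pi.\<close>

definition poisson_kernel :: "complex \<Rightarrow> real \<Rightarrow> real" where
  "poisson_kernel w s = (1 - (cmod w)\<^sup>2) / (cmod (cis s - w))\<^sup>2"

lemma poisson_kernel_nonneg: "cmod w \<le> 1 \<Longrightarrow> 0 \<le> poisson_kernel w s"
  unfolding poisson_kernel_def by (auto intro!: divide_nonneg_nonneg simp: power_le_one)

text \<open>Cauchy's formula for \<open>\<xi> \<mapsto> g \<xi> / (1 - cnj w * \<xi>)\<close> is Poisson's formula for holomorphic functions.\<close>

lemma has_integral_poisson:
  assumes "g holomorphic_on UNIV" "cmod w < 1"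
  shows "((\<lambda>s. g (cis s) * of_real (poisson_kernel w s)) has_integral 2 * of_real pi * g w) {0..2*pi}"
proof -
  have nz: "1 - cnj w * u \<noteq> 0" if "cmod u \<le> 1" for u
  proof
    assume "1 - cnj w * u = 0"
    hence "cmod (cnj w * u) = 1" by (metis eq_iff_diff_eq_0 norm_one)
    moreover have "cmod (cnj w * u) < 1"
      using assms(2) that by (simp add: norm_mult) (metis mult_left_le norm_ge_zero order_le_less_trans)
    ultimately show False by simp
  qed
  have "((\<lambda>u. (g u / (1 - cnj w * u)) / (u - w)) has_contour_integral
       (2 * of_real pi * \<i> * (g w / (1 - cnj w * w)))) (circlepath 0 1)"
    using assms nz
    by (intro Cauchy_integral_circlepath_simple holomorphic_intros holomorphic_on_subset[OF assms(1)]) auto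
  hence "((\<lambda>t. (g (0 + of_real 1 * cis t) / (1 - cnj w * (0 + of_real 1 * cis t))) / (0 + of_real 1 * cis t - w) * of_real 1 * \<i> * cis t)
      has_integral (2 * of_real pi * \<i> * (g w / (1 - cnj w * w)))) {0..2*pi}"
    unfolding circlepath_def by (subst (asm) has_contour_integral_part_circlepath_iff) auto
  from has_integral_mult_right[OF this, of "-\<i> * (1 - cnj w * w)"]
  have I: "((\<lambda>t. -\<i> * (1 - cnj w * w) * ((g (0 + of_real 1 * cis t) / (1 - cnj w * (0 + of_real 1 * cis t))) / (0 + of_real 1 * cis t - w) * of_real 1 * \<i> * cis t))
      has_integral (-\<i> * (1 - cnj w * w) * (2 * of_real pi * \<i> * (g w / (1 - cnj w * w))))) {0..2*pi}" .
  have "(\<lambda>t. -\<i> * (1 - cnj w * w) * ((g (0 + of_real 1 * cis t) / (1 - cnj w * (0 + of_real 1 * cis t))) / (0 + of_real 1 * cis t - w) * of_real 1 * \<i> * cis t))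
     = (\<lambda>t. g (cis t) * of_real (poisson_kernel w t))"
  proof
    fix t
    have ne: "cis t - w \<noteq> 0" "cnj (cis t - w) \<noteq> 0" using assms(2) by (auto simp del: complex_cnj_diff)
    have 1: "(1 - cnj w * (0 + of_real 1 * cis t)) = cis t * cnj (cis t - w)"
      by (simp add: algebra_simps cis_cnj cis_mult)
    have 2: "complex_of_real (poisson_kernel w t) = (1 - w * cnj w) / ((cis t - w) * cnj (cis t - w))"
      unfolding poisson_kernel_def of_real_divide of_real_diff complex_norm_square by simp
    show "-\<i> * (1 - cnj w * w) * ((g (0 + of_real 1 * cis t) / (1 - cnj w * (0 + of_real 1 * cis t))) / (0 + of_real 1 * cis t - w) * of_real 1 * \<i> * cis t)
       = g (cis t) * of_real (poisson_kernel w t)"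
      unfolding 1 2 using ne by (simp add: mult_ac del: complex_cnj_diff)
  qed
  moreover have "-\<i> * (1 - cnj w * w) * (2 * of_real pi * \<i> * (g w / (1 - cnj w * w))) = 2 * of_real pi * g w"
  proof -
    have "1 - cnj w * w \<noteq> 0" using nz[of w] assms(2) by simp
    hence "(1 - cnj w * w) * (g w / (1 - cnj w * w)) = g w" by simp
    hence "(-\<i> * \<i> * (2 * of_real pi)) * ((1 - cnj w * w) * (g w / (1 - cnj w * w))) = 2 * of_real pi * g w" by simp
    thus ?thesis by (simp only: mult_ac)
  qed
  ultimately show ?thesis using I by simp
qed

lemma has_integral_poisson_one:
  assumes "cmod w < 1"
  shows "(poisson_kernel w has_integral 2 * pi) {0..2*pi}"
  using has_integral_Re[OF has_integral_poisson[of "\<lambda>_. 1", OF _ assms]] by simp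

lemma continuous_on_poisson_kernel:
  assumes "cmod w < 1"
  shows "continuous_on A (poisson_kernel w)"
  unfolding poisson_kernel_def using assms by (intro continuous_intros) auto

text \<open>Poisson's formula is applied to the holomorphic function g^2, then the modulus is moved
  inside the integral: subharmonicity of |g|^2 with an explicit kernel.\<close>

lemma poisson_norm_sq_le:
  assumes "g holomorphic_on UNIV" "cmod w < 1"
  shows "2 * pi * (cmod (g w))\<^sup>2 \<le> integral {0..2*pi} (\<lambda>s. (cmod (g (cis s)))\<^sup>2 * poisson_kernel w s)"
proof -
  have contg: "continuous_on A g" for A
    using assms(1) holomorphic_on_imp_continuous_on continuous_on_subset by blast
  have contgc: "continuous_on {0..2*pi} (\<lambda>s. g (cis s))"
    by (intro continuous_on_compose2[OF contg[of UNIV]] continuous_intros) auto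
  have I: "((\<lambda>s. (g (cis s))\<^sup>2 * of_real (poisson_kernel w s)) has_integral 2 * of_real pi * (g w)\<^sup>2) {0..2*pi}"
    by (rule has_integral_poisson[of "\<lambda>z. (g z)\<^sup>2"]) (auto intro!: holomorphic_intros assms)
  have "2 * pi * (cmod (g w))\<^sup>2 = cmod (integral {0..2*pi} (\<lambda>s. (g (cis s))\<^sup>2 * of_real (poisson_kernel w s)))"
    unfolding integral_unique[OF I] by (simp add: norm_mult norm_power)
  also have "\<dots> \<le> integral {0..2*pi} (\<lambda>s. (cmod (g (cis s)))\<^sup>2 * poisson_kernel w s)"
    using I assms(2)
    by (intro integral_norm_bound_integral integrable_continuous_interval continuous_intros
         continuous_on_poisson_kernel contgc)
       (auto simp: norm_mult norm_power poisson_kernel_nonneg)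
  finally show ?thesis .
qed

text \<open>For a fixed radius the kernel depends only on the cosine of the difference of the
  angles. Hence its mass in the angle of the interior point is 2 * pi as well, which is what the
  exchange of integrals over a turn calls for.\<close>

lemma poisson_kernel_swap:
  "poisson_kernel (of_real r * cis x) s = poisson_kernel (of_real r * cis s) x"
proof -
  have sq: "(cmod (cis s - of_real r * cis x))\<^sup>2 = 1 + r\<^sup>2 - 2 * r * cos (s - x)" for s x
  proof -
    have "(cmod (cis s - of_real r * cis x))\<^sup>2 = ((cos s)\<^sup>2 + (sin s)\<^sup>2) + r\<^sup>2 * ((cos x)\<^sup>2 + (sin x)\<^sup>2) - 2 * r * cos (s - x)"
      unfolding cmod_power2 cos_diff by (simp add: power2_eq_square algebra_simps del: sin_cos_squared_add sin_cos_squared_add2 sin_cos_squared_add3)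
    thus ?thesis by simp
  qed
  have "cos (s - x) = cos (x - s)" by (metis cos_minus minus_diff_eq)
  thus ?thesis unfolding poisson_kernel_def sq by (simp add: norm_mult)
qed

text \<open>A Harnack-type comparison along one ray. The numerators differ by the ratio of the
  distances to the circle; in the denominators, |r - r0| is at most 1 + C times 1 - r, and 1 - r
  bounds the distance to any point of the circle from below.\<close>

lemma poisson_kernel_compare:
  assumes r: "0 \<le> r" "r < 1" "0 \<le> r0" "r0 < 1" and C: "1 - r \<le> C * (1 - r0)" "1 - r0 \<le> C * (1 - r)"
  shows "poisson_kernel (of_real r * cis x) s \<le> 2 * C * (2 + C)\<^sup>2 * poisson_kernel (of_real r0 * cis x) s"
proof -
  let ?w = "of_real r * cis x" and ?v = "of_real r0 * cis x"
  have n: "cmod ?w = r" "cmod ?v = r0" using r by (auto simp: norm_mult)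
  have C0: "0 < C" using C r by (smt (verit) mult_nonneg_nonneg mult_nonpos_nonneg)
  have d: "1 - r \<le> cmod (cis s - ?w)"
    using norm_triangle_ineq2[of "cis s" ?w] n by simp
  have pos: "0 < cmod (cis s - ?w)" using d r by linarith
  have "1 - r0 \<le> cmod (cis s - ?v)"
    using norm_triangle_ineq2[of "cis s" ?v] n by simp
  hence pos0: "0 < cmod (cis s - ?v)" using r by linarith
  have "cmod (cis s - ?v) \<le> cmod (cis s - ?w) + cmod (?w - ?v)"
    using norm_triangle_ineq[of "cis s - ?w" "?w - ?v"] by simp
  also have "?w - ?v = of_real (r - r0) * cis x" by (simp only: of_real_diff left_diff_distrib)
  also have "cmod \<dots> = \<bar>r - r0\<bar>" by (simp only: norm_mult norm_of_real norm_cis mult_1_right)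
  also have "\<bar>r - r0\<bar> \<le> (1 - r) + (1 - r0)" using r by auto
  also have "\<dots> \<le> (1 + C) * (1 - r)" using C by (simp add: algebra_simps)
  also have "\<dots> \<le> (1 + C) * cmod (cis s - ?w)" using d C0 by (intro mult_left_mono) auto
  finally have "cmod (cis s - ?v) \<le> (2 + C) * cmod (cis s - ?w)" by (simp add: algebra_simps)
  hence A: "(cmod (cis s - ?v))\<^sup>2 \<le> (2 + C)\<^sup>2 * (cmod (cis s - ?w))\<^sup>2"
    by (metis norm_ge_zero power_mono power_mult_distrib)
  have "1 - r\<^sup>2 = (1 - r) * (1 + r)" by (simp add: algebra_simps power2_eq_square)
  also have "\<dots> \<le> (C * (1 - r0)) * 2" using r C C0 by (intro mult_mono) auto
  also have "\<dots> \<le> 2 * C * (1 - r0\<^sup>2)"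
  proof -
    have "1 - r0 \<le> 1 - r0\<^sup>2" using r by (simp add: power2_eq_square mult_left_le)
    thus ?thesis using C0 by simp
  qed
  finally have B: "1 - r\<^sup>2 \<le> 2 * C * (1 - r0\<^sup>2)" .
  have nn: "0 \<le> 1 - r0\<^sup>2" using r by (simp add: power_le_one)
  have "(1 - r\<^sup>2) / (cmod (cis s - ?w))\<^sup>2 \<le> (2 * C * (1 - r0\<^sup>2)) / (cmod (cis s - ?w))\<^sup>2"
    using B by (intro divide_right_mono) auto
  also have "\<dots> \<le> (2 * C * (1 - r0\<^sup>2)) / ((cmod (cis s - ?v))\<^sup>2 / (2 + C)\<^sup>2)"
    using A C0 nn pos pos0 by (intro divide_left_mono) (auto simp: divide_le_eq mult_ac)
  finally show ?thesis unfolding poisson_kernel_def n by (simp only: mult_ac divide_divide_eq_right times_divide_eq_right)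
qed

text \<open>Convexity of exp: - h lies at the fraction 1 / C of the segment from 0 to - C * h. This
  turns comparable heights into comparable distances from the circle.\<close>

lemma one_minus_exp_compare:
  fixes h h0 C :: real
  assumes "1 \<le> C" "0 \<le> h" "h0 \<le> C * h"
  shows "1 - exp (- h0) \<le> C * (1 - exp (- h))"
proof -
  have "exp ((1 - 1/C) *\<^sub>R 0 + (1/C) *\<^sub>R (- (C * h))) \<le> (1 - 1/C) * exp 0 + (1/C) * exp (- (C * h))"
    using assms by (intro convex_onD[OF exp_convex]) auto
  hence "C * exp (- h) \<le> C * ((1 - 1/C) + (1/C) * exp (- (C * h)))"
    using assms by simp
  also have "\<dots> = C - 1 + exp (- (C * h))" using assms by (simp add: field_simps)
  finally have "1 - exp (- (C * h)) \<le> C * (1 - exp (- h))"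
    by (simp add: algebra_simps)
  moreover have "exp (- (C * h)) \<le> exp (- h0)" using assms by simp
  ultimately show ?thesis by linarith
qed

text \<open>Inside the Poisson kernel the variable radius is replaced by a constant one, at the
  price of a factor depending on C alone. After exchanging integrals the kernel has mass 2 * pi in
  x, and Parseval on the unit circle remains. The bound does not depend on how close the turn is to
  the circle.\<close>

lemma spiral_block_bound:
  fixes a :: "nat \<Rightarrow> complex" and h :: "real \<Rightarrow> real"
  assumes h: "continuous_on {0..2*pi} h" "\<And>x. x \<in> {0..2*pi} \<Longrightarrow> 0 < h x"
    and C: "1 \<le> C" "\<And>x y. x \<in> {0..2*pi} \<Longrightarrow> y \<in> {0..2*pi} \<Longrightarrow> h x \<le> C * h y"
  shows "integral {0..2*pi} (\<lambda>x. (cmod (\<Sum>j<N. a j * (of_real (exp (- h x)) * cis x) ^ j))\<^sup>2)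
     \<le> 2 * C * (2 + C)\<^sup>2 * (2 * pi * (\<Sum>j<N. (cmod (a j))\<^sup>2))"
proof -
  define g where "g z = (\<Sum>j<N. a j * z ^ j)" for z
  define K where "K = 2 * C * (2 + C)\<^sup>2"
  have holg: "g holomorphic_on UNIV" unfolding g_def by (intro holomorphic_intros)
  have contgc: "continuous_on A (\<lambda>s. g (cis s))" for A unfolding g_def by (intro continuous_intros)
  define r0 where "r0 = exp (- h 0)"
  have r0: "0 \<le> r0" "r0 < 1" using h(2)[of 0] by (auto simp: r0_def)
  have ne: "cis s - of_real r0 * cis x \<noteq> 0" for s x
  proof
    assume "cis s - of_real r0 * cis x = 0"
    hence "cmod (of_real r0 * cis x) = 1" by (metis eq_iff_diff_eq_0 norm_cis)
    thus False using r0 by (simp add: norm_mult)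
  qed
  have pt: "2 * pi * (cmod (g (of_real (exp (- h x)) * cis x)))\<^sup>2
     \<le> integral {0..2*pi} (\<lambda>s. K * ((cmod (g (cis s)))\<^sup>2 * poisson_kernel (of_real r0 * cis x) s))"
    if x: "x \<in> {0..2*pi}" for x
  proof -
    let ?w = "of_real (exp (- h x)) * cis x"
    have w: "cmod ?w < 1" using h(2)[OF x] by (simp add: norm_mult)
    have w0: "cmod (of_real r0 * cis x) < 1" using r0 by (simp add: norm_mult)
    have "2 * pi * (cmod (g ?w))\<^sup>2 \<le> integral {0..2*pi} (\<lambda>s. (cmod (g (cis s)))\<^sup>2 * poisson_kernel ?w s)"
      by (rule poisson_norm_sq_le[OF holg w])
    also have "\<dots> \<le> integral {0..2*pi} (\<lambda>s. K * ((cmod (g (cis s)))\<^sup>2 * poisson_kernel (of_real r0 * cis x) s))"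
    proof (rule integral_le)
      show "(\<lambda>s. (cmod (g (cis s)))\<^sup>2 * poisson_kernel ?w s) integrable_on {0..2*pi}"
        by (intro integrable_continuous_interval continuous_intros contgc continuous_on_poisson_kernel w)
      show "(\<lambda>s. K * ((cmod (g (cis s)))\<^sup>2 * poisson_kernel (of_real r0 * cis x) s)) integrable_on {0..2*pi}"
        by (intro integrable_continuous_interval continuous_intros contgc continuous_on_poisson_kernel w0)
      fix s :: real
      have le: "poisson_kernel ?w s \<le> K * poisson_kernel (of_real r0 * cis x) s"
        unfolding K_def r0_def
        using h(2)[OF x] h(2)[of 0] C(1) C(2)[OF x, of 0] C(2)[of 0, OF _ x]
        by (intro poisson_kernel_compare one_minus_exp_compare) (auto intro: less_imp_le)
      show "(cmod (g (cis s)))\<^sup>2 * poisson_kernel ?w s \<le> K * ((cmod (g (cis s)))\<^sup>2 * poisson_kernel (of_real r0 * cis x) s)"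
        using mult_left_mono[OF le, of "(cmod (g (cis s)))\<^sup>2"] by (simp add: mult.left_commute)
    qed
    finally show ?thesis .
  qed
  have cont2: "continuous_on (cbox (0,0) (2*pi,2*pi)) (\<lambda>(x,s). K * ((cmod (g (cis s)))\<^sup>2 * poisson_kernel (of_real r0 * cis x) s))"
    unfolding case_prod_unfold poisson_kernel_def g_def using ne
    by (intro continuous_intros) auto
  have cont1: "continuous_on {0..2*pi} (\<lambda>x. g (of_real (exp (- h x)) * cis x))"
    unfolding g_def by (intro continuous_intros h)
  have swap: "integral {0..2*pi} (\<lambda>x. integral {0..2*pi} (\<lambda>s. K * ((cmod (g (cis s)))\<^sup>2 * poisson_kernel (of_real r0 * cis x) s)))
    = integral {0..2*pi} (\<lambda>s. integral {0..2*pi} (\<lambda>x. K * ((cmod (g (cis s)))\<^sup>2 * poisson_kernel (of_real r0 * cis x) s)))"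
    using integral_swap_continuous[OF cont2] by simp
  have int1: "(\<lambda>x. integral {0..2*pi} (\<lambda>s. K * ((cmod (g (cis s)))\<^sup>2 * poisson_kernel (of_real r0 * cis x) s))) integrable_on {0..2*pi}"
    using integral_integrable_2dim[OF cont2] by simp
  have inner: "integral {0..2*pi} (\<lambda>x. K * ((cmod (g (cis s)))\<^sup>2 * poisson_kernel (of_real r0 * cis x) s))
     = 2 * pi * K * (cmod (g (cis s)))\<^sup>2" for s
  proof -
    have w0: "cmod (of_real r0 * cis s) < 1" using r0 by (simp add: norm_mult)
    have "((\<lambda>x. (K * (cmod (g (cis s)))\<^sup>2) * poisson_kernel (of_real r0 * cis s) x) has_integral (K * (cmod (g (cis s)))\<^sup>2) * (2 * pi)) {0..2*pi}"
      by (intro has_integral_mult_right has_integral_poisson_one w0)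
    thus ?thesis unfolding poisson_kernel_swap[of r0 s] by (intro integral_unique) (simp add: mult_ac)
  qed
  have par: "((\<lambda>s. (cmod (g (cis s)))\<^sup>2) has_integral 2 * pi * (\<Sum>j<N. (cmod (a j))\<^sup>2)) {0..2*pi}"
    unfolding g_def by (rule has_integral_circle_parseval)
  have "2 * pi * integral {0..2*pi} (\<lambda>x. (cmod (g (of_real (exp (- h x)) * cis x)))\<^sup>2)
     = integral {0..2*pi} (\<lambda>x. 2 * pi * (cmod (g (of_real (exp (- h x)) * cis x)))\<^sup>2)"
    by simp
  also have "\<dots> \<le> integral {0..2*pi} (\<lambda>x. integral {0..2*pi} (\<lambda>s. K * ((cmod (g (cis s)))\<^sup>2 * poisson_kernel (of_real r0 * cis x) s)))"
    by (intro integral_le pt int1 integrable_continuous_interval continuous_intros cont1)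
  also have "\<dots> = integral {0..2*pi} (\<lambda>s. (2 * pi * K) * (cmod (g (cis s)))\<^sup>2)"
    unfolding swap inner ..
  also have "\<dots> = 2 * pi * K * (2 * pi * (\<Sum>j<N. (cmod (a j))\<^sup>2))"
    using par by (simp add: integral_unique)
  finally have "2 * pi * integral {0..2*pi} (\<lambda>x. (cmod (g (of_real (exp (- h x)) * cis x)))\<^sup>2)
      \<le> 2 * pi * (K * (2 * pi * (\<Sum>j<N. (cmod (a j))\<^sup>2)))" by (simp add: mult_ac)
  hence "integral {0..2*pi} (\<lambda>x. (cmod (g (of_real (exp (- h x)) * cis x)))\<^sup>2)
      \<le> K * (2 * pi * (\<Sum>j<N. (cmod (a j))\<^sup>2))"
    by (subst (asm) mult_le_cancel_left_pos) auto
  thus ?thesis unfolding g_def K_def .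
qed

section \<open>Area integrals of holomorphic functions\<close>

lemma measurable_Complex [measurable]:
  "(\<lambda>p. Complex (fst p) (snd p)) \<in> borel_measurable (borel \<Otimes>\<^sub>M borel)"
  unfolding borel_prod by (intro borel_measurable_continuous_onI continuous_intros)

lemma measurable_Complex_section [measurable]:
  "(\<lambda>x. Complex x c) \<in> borel_measurable borel" "Complex c \<in> borel_measurable borel"
  by (intro borel_measurable_continuous_onI continuous_intros)+

lemma lborel_complex: "(lborel :: complex measure) = distr (lborel \<Otimes>\<^sub>M lborel) borel (\<lambda>p. Complex (fst p) (snd p))"
proof (rule lborel_eqI)
  fix l u :: complex
  assume le: "\<And>b. b \<in> Basis \<Longrightarrow> l \<bullet> b \<le> u \<bullet> b"
  have le': "Re l \<le> Re u" "Im l \<le> Im u" using le[of 1] le[of \<i>] by (auto simp: Basis_complex_def)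
  have "emeasure (distr (lborel \<Otimes>\<^sub>M lborel) borel (\<lambda>p. Complex (fst p) (snd p))) (box l u)
     = emeasure (lborel \<Otimes>\<^sub>M lborel) ((\<lambda>p. Complex (fst p) (snd p)) -` box l u \<inter> space (lborel \<Otimes>\<^sub>M lborel))"
    by (rule emeasure_distr) simp_all
  also have "(\<lambda>p. Complex (fst p) (snd p)) -` box l u \<inter> space (lborel \<Otimes>\<^sub>M lborel)
      = {Re l<..<Re u} \<times> {Im l<..<Im u}"
    by (auto simp: space_pair_measure box_def Basis_complex_def)
  also have "emeasure (lborel \<Otimes>\<^sub>M lborel) \<dots> = ennreal (Re u - Re l) * ennreal (Im u - Im l)"
    using le' by (simp add: lborel.emeasure_pair_measure_Times)
  also have "\<dots> = ennreal (\<Prod>b\<in>Basis. (u - l) \<bullet> b)"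
    using le' by (simp add: Basis_complex_def ennreal_mult)
  finally show "emeasure (distr (lborel \<Otimes>\<^sub>M lborel) borel (\<lambda>p. Complex (fst p) (snd p))) (box l u)
      = ennreal (\<Prod>b\<in>Basis. (u - l) \<bullet> b)" by simp
qed simp

lemma nn_integral_complex:
  assumes [measurable]: "f \<in> borel_measurable borel"
  shows "(\<integral>\<^sup>+z. f z \<partial>lborel) = (\<integral>\<^sup>+y. \<integral>\<^sup>+x. f (Complex x y) \<partial>lborel \<partial>lborel)"
    and "(\<integral>\<^sup>+z. f z \<partial>lborel) = (\<integral>\<^sup>+x. \<integral>\<^sup>+y. f (Complex x y) \<partial>lborel \<partial>lborel)"
proof -
  have *: "(\<integral>\<^sup>+z. f z \<partial>lborel) = (\<integral>\<^sup>+p. f (Complex (fst p) (snd p)) \<partial>(lborel \<Otimes>\<^sub>M lborel))"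
    by (subst lborel_complex, subst nn_integral_distr) auto
  show "(\<integral>\<^sup>+z. f z \<partial>lborel) = (\<integral>\<^sup>+y. \<integral>\<^sup>+x. f (Complex x y) \<partial>lborel \<partial>lborel)"
    unfolding * by (subst lborel_pair.nn_integral_snd[symmetric]) auto
  show "(\<integral>\<^sup>+z. f z \<partial>lborel) = (\<integral>\<^sup>+x. \<integral>\<^sup>+y. f (Complex x y) \<partial>lborel \<partial>lborel)"
    unfolding * by (subst lborel.nn_integral_fst[symmetric]) auto
qed

text \<open>With the other coordinate fixed, a shear is a translation in the inner integral.\<close>

lemma nn_integral_shear:
  assumes [measurable]: "f \<in> borel_measurable borel"
  shows "(\<integral>\<^sup>+z. f (z + of_real (a * Im z)) \<partial>lborel) = (\<integral>\<^sup>+z. f z \<partial>lborel)"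
    and "(\<integral>\<^sup>+z. f (z + \<i> * of_real (b * Re z)) \<partial>lborel) = (\<integral>\<^sup>+z. f z \<partial>lborel)"
proof -
  have tr: "(\<integral>\<^sup>+x. g (c + x) \<partial>lborel) = (\<integral>\<^sup>+x. g x \<partial>lborel)"
    if [measurable]: "g \<in> borel_measurable borel" for g :: "real \<Rightarrow> ennreal" and c
    by (subst (2) lborel_distr_plus[of c, symmetric], subst nn_integral_distr) auto
  have "(\<integral>\<^sup>+z. f (z + of_real (a * Im z)) \<partial>lborel)
     = (\<integral>\<^sup>+y. \<integral>\<^sup>+x. f (Complex (a * y + x) y) \<partial>lborel \<partial>lborel)"
    by (subst nn_integral_complex(1))
       (auto intro!: nn_integral_cong arg_cong[of _ _ f] simp: complex_eq_iff)
  also have "\<dots> = (\<integral>\<^sup>+y. \<integral>\<^sup>+x. f (Complex x y) \<partial>lborel \<partial>lborel)"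
    by (rule nn_integral_cong, rule tr) measurable
  finally show "(\<integral>\<^sup>+z. f (z + of_real (a * Im z)) \<partial>lborel) = (\<integral>\<^sup>+z. f z \<partial>lborel)"
    by (subst nn_integral_complex(1)[OF assms])
  have "(\<integral>\<^sup>+z. f (z + \<i> * of_real (b * Re z)) \<partial>lborel)
     = (\<integral>\<^sup>+x. \<integral>\<^sup>+y. f (Complex x (b * x + y)) \<partial>lborel \<partial>lborel)"
    by (subst nn_integral_complex(2))
       (auto intro!: nn_integral_cong arg_cong[of _ _ f] simp: complex_eq_iff)
  also have "\<dots> = (\<integral>\<^sup>+x. \<integral>\<^sup>+y. f (Complex x y) \<partial>lborel \<partial>lborel)"
    by (rule nn_integral_cong, rule tr) measurable
  finally show "(\<integral>\<^sup>+z. f (z + \<i> * of_real (b * Re z)) \<partial>lborel) = (\<integral>\<^sup>+z. f z \<partial>lborel)"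
    by (subst nn_integral_complex(2)[OF assms])
qed

text \<open>A rotation is a product of three shears.\<close>

lemma nn_integral_rotation:
  assumes [measurable]: "f \<in> borel_measurable borel"
  shows "(\<integral>\<^sup>+z. f (cis t * z) \<partial>lborel) = (\<integral>\<^sup>+z. f z \<partial>lborel)"
proof -
  have gen: "(\<integral>\<^sup>+z. f (cis t * z) \<partial>lborel) = (\<integral>\<^sup>+z. f z \<partial>lborel)"
    if t: "sin t \<noteq> 0" and [measurable]: "f \<in> borel_measurable borel" for t and f :: "complex \<Rightarrow> ennreal"
  proof -
    \<comment> \<open>Parameters of the factorisation into a horizontal, a vertical and again the
      horizontal shear; \<open>a\<close> is minus the tangent of t / 2.\<close>
    define a where "a = (cos t - 1) / sin t"
    define b where "b = sin t"
    define U where "U z = z + of_real (a * Im z)" for z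
    define V where "V z = z + \<i> * of_real (b * Re z)" for z
    have [measurable]: "U \<in> borel_measurable borel" "V \<in> borel_measurable borel"
      unfolding U_def V_def by measurable
    have ab: "a * b = cos t - 1" using t by (simp add: a_def b_def)
    have ac: "a * (cos t + 1) = - sin t"
    proof -
      have "(cos t - 1) * (cos t + 1) = - (sin t)\<^sup>2"
        using sin_cos_squared_add[of t] by (simp add: algebra_simps power2_eq_square)
      thus ?thesis using t by (simp add: a_def field_simps power2_eq_square)
    qed
    have UVU: "U (V (U z)) = cis t * z" for z
    proof (rule complex_eqI)
      have "Re (U (V (U z))) = Re z * (1 + a * b) + Im z * (a * (1 + a * b) + a)"
        by (simp add: U_def V_def algebra_simps)
      also have "\<dots> = Re z * cos t - Im z * sin t" unfolding ab using ac by (simp add: algebra_simps)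
      finally show "Re (U (V (U z))) = Re (cis t * z)" by (simp add: algebra_simps)
      have "Im (U (V (U z))) = Im z * (1 + a * b) + Re z * b"
        by (simp add: U_def V_def algebra_simps)
      thus "Im (U (V (U z))) = Im (cis t * z)" unfolding ab by (simp add: b_def algebra_simps)
    qed
    have "(\<integral>\<^sup>+z. f (cis t * z) \<partial>lborel) = (\<integral>\<^sup>+z. f (U (V (U z))) \<partial>lborel)" unfolding UVU ..
    also have "\<dots> = (\<integral>\<^sup>+z. f (U (V z)) \<partial>lborel)"
      unfolding U_def[of "_ z" for z] U_def[of z for z]
      by (rule nn_integral_shear(1)[of "\<lambda>z. f (V z + of_real (a * Im (V z)))"]) measurable
    also have "\<dots> = (\<integral>\<^sup>+z. f (U z) \<partial>lborel)"
      unfolding V_def by (rule nn_integral_shear(2)[of "\<lambda>z. f (U z)"]) measurable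
    also have "\<dots> = (\<integral>\<^sup>+z. f z \<partial>lborel)"
      unfolding U_def by (rule nn_integral_shear(1)[of f]) measurable
    finally show ?thesis .
  qed
  show ?thesis
  proof (cases "sin t = 0")
    case False thus ?thesis by (rule gen) measurable
  next
    case True
    \<comment> \<open>At multiples of pi the quotient \<open>a\<close> degenerates, so the rotation
      is split into two admissible ones.\<close>
    have "cis t = cis (t - pi / 2) * cis (pi / 2)" by (simp add: cis_mult del: cis_pi_half)
    moreover have "sin (t - pi / 2) \<noteq> 0" using True sin_cos_squared_add[of t] by (auto simp: sin_diff)
    ultimately show ?thesis
      using gen[of "pi / 2" "\<lambda>z. f (cis (t - pi / 2) * z)"] gen[of "t - pi / 2" f]
      by (simp add: mult.assoc)
  qed
qed

text \<open>The substitute for polar coordinates: rotation invariance is integrated over the angle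
  and Tonelli exchanges the integrals, so that an estimate on every circle yields one for
  areas.\<close>

lemma nn_integral_rotation_average:
  assumes [measurable]: "f \<in> borel_measurable borel"
  shows "ennreal (2 * pi) * (\<integral>\<^sup>+z. f z \<partial>lborel)
     = (\<integral>\<^sup>+z. (\<integral>\<^sup>+t. f (cis t * z) * indicator {0..2*pi} t \<partial>lborel) \<partial>lborel)"
proof -
  have [measurable]: "cis \<in> borel_measurable borel"
    by (intro borel_measurable_continuous_onI continuous_intros)
  have "ennreal (2 * pi) * (\<integral>\<^sup>+z. f z \<partial>lborel)
      = (\<integral>\<^sup>+t. (\<integral>\<^sup>+z. f z \<partial>lborel) * indicator {0..2*pi} t \<partial>lborel)"
    by (subst nn_integral_cmult_indicator) (auto simp: mult.commute)
  also have "\<dots> = (\<integral>\<^sup>+t. \<integral>\<^sup>+z. f (cis t * z) * indicator {0..2*pi} t \<partial>lborel \<partial>lborel)"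
    by (intro nn_integral_cong, subst nn_integral_multc, measurable, subst nn_integral_rotation, measurable)
  also have "\<dots> = (\<integral>\<^sup>+z. (\<integral>\<^sup>+t. f (cis t * z) * indicator {0..2*pi} t \<partial>lborel) \<partial>lborel)"
    by (rule lborel_pair.Fubini'[symmetric]) measurable
  finally show ?thesis .
qed

lemma nn_integral_circle:
  assumes "(f has_integral I) {0..2*pi}" "continuous_on {0..2*pi} f" "\<And>t. 0 \<le> f t"
  shows "(\<integral>\<^sup>+t. ennreal (f t) * indicator {0..2*pi} t \<partial>lborel) = ennreal I"
proof -
  have [measurable]: "(\<lambda>t. f t * indicator {0..2*pi} t) \<in> borel_measurable borel"
    using borel_measurable_continuous_on_indicator[OF _ assms(2)] by (simp add: mult.commute)
  have "((\<lambda>t. f t * indicator {0..2*pi} t) has_integral I) UNIV"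
    using assms(1) unfolding has_integral_restrict_UNIV[of "{0..2*pi}" f, symmetric]
    by (simp add: indicator_def of_bool_def if_distrib cong: if_cong)
  hence "(\<integral>\<^sup>+t. ennreal (f t * indicator {0..2*pi} t) \<partial>lborel) = ennreal I"
    using nn_integral_has_integral_lborel[of "\<lambda>t. f t * indicator {0..2*pi} t" I] assms(3) by simp
  thus ?thesis by (simp add: ennreal_mult' assms(3) ennreal_indicator)
qed

section \<open>Area bounds from circles: sub-mean values and monomials\<close>

lemma pred_ball [measurable]: "Measurable.pred borel (\<lambda>w::complex. w \<in> ball c r)"
  by (simp add: pred_def)

lemma emeasure_disc: "0 \<le> r \<Longrightarrow> emeasure lborel (ball (c::complex) r) = ennreal (pi * r\<^sup>2)"
  by (simp add: emeasure_ball unit_ball_vol_2)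

text \<open>After translation to the centre, the average over each circle dominates the central
  value, by Bessel's inequality with a single coefficient.\<close>

lemma area_submean:
  assumes hol: "g holomorphic_on ball z \<rho>" and \<rho>: "0 < \<rho>"
  shows "ennreal (pi * \<rho>\<^sup>2 * (cmod (g z))\<^sup>2) \<le> (\<integral>\<^sup>+w. ennreal ((cmod (g w))\<^sup>2) * indicator (ball z \<rho>) w \<partial>lborel)"
proof -
  define F where "F w = ennreal ((cmod (g (z + w)))\<^sup>2) * indicator (ball 0 \<rho>) w" for w
  have contg: "continuous_on (ball z \<rho>) g" using hol by (rule holomorphic_on_imp_continuous_on)
  have "continuous_on (ball 0 \<rho>) (\<lambda>w. (cmod (g (z + w)))\<^sup>2)"
    by (intro continuous_intros continuous_on_compose2[OF contg]) (auto simp: dist_norm)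
  from borel_measurable_continuous_on_indicator[OF _ this]
  have "(\<lambda>w. ennreal (indicator (ball 0 \<rho>) w * (cmod (g (z + w)))\<^sup>2)) \<in> borel_measurable borel"
    by simp
  also have "(\<lambda>w. ennreal (indicator (ball 0 \<rho>) w * (cmod (g (z + w)))\<^sup>2)) = F"
    by (auto simp: F_def indicator_def)
  finally have [measurable]: "F \<in> borel_measurable borel" .
  have inner: "ennreal (2 * pi * (cmod (g z))\<^sup>2) * indicator (ball 0 \<rho>) w
      \<le> (\<integral>\<^sup>+t. F (cis t * w) * indicator {0..2*pi} t \<partial>lborel)" for w
  proof (cases "w \<in> ball 0 \<rho>")
    case True
    have Feq: "F (cis t * w) = ennreal ((cmod (g (z + cis t * w)))\<^sup>2)" for t
      using True by (simp add: F_def norm_mult)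
    have cont: "continuous_on {0..2*pi} (\<lambda>t. (cmod (g (z + cis t * w)))\<^sup>2)"
      using True by (intro continuous_intros continuous_on_compose2[OF contg]) (auto simp: dist_norm norm_mult)
    have I: "((\<lambda>t. (cmod (g (z + cis t * w)))\<^sup>2) has_integral integral {0..2*pi} (\<lambda>t. (cmod (g (z + cis t * w)))\<^sup>2)) {0..2*pi}"
      by (intro integrable_integral integrable_continuous_interval cont)
    have "2 * pi * (cmod (g z))\<^sup>2 \<le> integral {0..2*pi} (\<lambda>t. (cmod (g (z + cis t * w)))\<^sup>2)"
    proof (cases "w = 0")
      case True thus ?thesis by simp
    next
      case False
      \<comment> \<open>Rotating the variable by \<open>u\<close> puts w on the positive real axis,
        the starting point of the parametrised circles.\<close>
      define u where "u = w / of_real (cmod w)"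
      have u: "cmod u = 1" using False by (simp add: u_def norm_divide)
      have hol': "(\<lambda>v. g (z + v * u)) holomorphic_on ball 0 \<rho>"
        using u by (intro holomorphic_on_compose_gen[OF _ hol, unfolded o_def] holomorphic_intros)
          (auto simp: dist_norm norm_mult)
      have "2 * pi * (\<Sum>k<Suc 0. (cmod ((deriv ^^ k) (\<lambda>v. g (z + v * u)) 0 / fact k * of_real (cmod w) ^ k))\<^sup>2)
         \<le> integral {0..2*pi} (\<lambda>t. (cmod (g (z + of_real (cmod w) * cis t * u)))\<^sup>2)"
        using True False by (intro circle_bessel[OF hol']) auto
      moreover have "of_real (cmod w) * cis t * u = cis t * w" for t
        using False by (simp add: u_def)
      ultimately show ?thesis by simp
    qed
    thus ?thesis using True unfolding Feq
      by (subst nn_integral_circle[OF I cont]) (auto intro!: ennreal_leI)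
  qed simp
  have "ennreal (2 * pi) * ennreal (pi * \<rho>\<^sup>2 * (cmod (g z))\<^sup>2)
      = ennreal (2 * pi * (cmod (g z))\<^sup>2) * ennreal (pi * \<rho>\<^sup>2)"
    by (simp add: ennreal_mult[symmetric] mult_ac)
  also have "\<dots> = (\<integral>\<^sup>+w. ennreal (2 * pi * (cmod (g z))\<^sup>2) * indicator (ball (0::complex) \<rho>) w \<partial>lborel)"
    using \<rho> by (subst nn_integral_cmult_indicator) (auto simp: emeasure_disc)
  also have "\<dots> \<le> (\<integral>\<^sup>+w. (\<integral>\<^sup>+t. F (cis t * w) * indicator {0..2*pi} t \<partial>lborel) \<partial>lborel)"
    by (intro nn_integral_mono inner)
  also have "\<dots> = ennreal (2 * pi) * (\<integral>\<^sup>+w. F w \<partial>lborel)"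
    by (rule nn_integral_rotation_average[symmetric]) measurable
  also have "(\<integral>\<^sup>+w. F w \<partial>lborel) = (\<integral>\<^sup>+w. ennreal ((cmod (g w))\<^sup>2) * indicator (ball z \<rho>) w \<partial>lborel)"
  proof -
    define G where "G w = F (w - z)" for w
    have [measurable]: "G \<in> borel_measurable borel" unfolding G_def by measurable
    have "(\<integral>\<^sup>+w. F w \<partial>lborel) = (\<integral>\<^sup>+w. G (z + w) \<partial>lborel)" by (simp add: G_def)
    also have "\<dots> = (\<integral>\<^sup>+w. G w \<partial>lborel)"
      by (subst (2) lborel_distr_plus[of z, symmetric], subst nn_integral_distr) auto
    also have "\<dots> = (\<integral>\<^sup>+w. ennreal ((cmod (g w))\<^sup>2) * indicator (ball z \<rho>) w \<partial>lborel)"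
      by (intro nn_integral_cong) (auto simp: G_def F_def indicator_def dist_norm norm_minus_commute)
    finally show ?thesis .
  qed
  finally show ?thesis by (simp add: ennreal_mult_le_mult_iff)
qed

text \<open>The exact value is pi / (m + 1); scaling gives twice that. Shrinking to radius r
  multiplies the integral by r^(2m+2), which is at most 1/2 for r^2 = 1 - 1/(m+1), and the ring that
  is left has area pi / (m + 1).\<close>

lemma nn_integral_disc_power_le:
  "(\<integral>\<^sup>+w. ennreal (cmod w ^ (2 * m)) * indicator (ball 0 1) w \<partial>lborel) \<le> ennreal (2 * pi / (m + 1))"
proof -
  define I where "I = (\<integral>\<^sup>+w. ennreal (cmod w ^ (2 * m)) * indicator (ball (0::complex) 1) w \<partial>lborel)"
  define r where "r = sqrt (1 - 1 / (m + 1))"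
  have r2: "r\<^sup>2 = 1 - 1 / (m + 1)" unfolding r_def by (subst real_sqrt_pow2) auto
  show ?thesis
  proof (cases "m = 0")
    case True
    thus ?thesis by (simp add: emeasure_disc ennreal_leI)
  next
    case False
    have r: "0 < r" "r < 1" using False by (auto simp: r_def)
    \<comment> \<open>Finiteness has to be known before half of \<open>I\<close> can be absorbed
      into the left side.\<close>
    have "I \<le> (\<integral>\<^sup>+w. indicator (ball (0::complex) 1) w \<partial>lborel)"
      unfolding I_def by (intro nn_integral_mono) (auto simp: indicator_def power_le_one)
    hence "I \<le> ennreal pi" by (simp add: emeasure_disc)
    then obtain i where i: "I = ennreal i" "0 \<le> i"
      by (metis ennreal_less_top enn2real_nonneg ennreal_enn2real order_le_less_trans)
    have "(\<integral>\<^sup>+w. ennreal (cmod w ^ (2 * m)) * indicator (ball (0::complex) r) w \<partial>lborel)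
       = (\<integral>\<^sup>+w. ennreal (r\<^sup>2) * (ennreal (cmod (r *\<^sub>R w) ^ (2 * m)) * indicator (ball (0::complex) r) (r *\<^sub>R w)) \<partial>lborel)"
      using r by (subst lborel_affine[of r 0]) (auto simp: nn_integral_density nn_integral_distr)
    also have "\<dots> = (\<integral>\<^sup>+w. ennreal (r ^ (2 * m + 2)) * (ennreal (cmod w ^ (2 * m)) * indicator (ball 0 1) w) \<partial>lborel)"
    proof (intro nn_integral_cong)
      fix w :: complex
      have "r ^ (2 * m + 2) = r\<^sup>2 * r ^ (2 * m)" by (simp only: power_add mult.commute)
      thus "ennreal (r\<^sup>2) * (ennreal (cmod (r *\<^sub>R w) ^ (2 * m)) * indicator (ball 0 r) (r *\<^sub>R w))
          = ennreal (r ^ (2 * m + 2)) * (ennreal (cmod w ^ (2 * m)) * indicator (ball 0 1) w)"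
        using r by (auto simp: indicator_def power_mult_distrib ennreal_mult[symmetric] mult.assoc)
    qed
    also have "\<dots> = ennreal (r ^ (2 * m + 2)) * I"
      unfolding I_def by (intro nn_integral_cmult) measurable
    finally have A: "(\<integral>\<^sup>+w. ennreal (cmod w ^ (2 * m)) * indicator (ball (0::complex) r) w \<partial>lborel) = ennreal (r ^ (2 * m + 2)) * I" .
    have "I \<le> (\<integral>\<^sup>+w. ennreal (cmod w ^ (2 * m)) * indicator (ball (0::complex) r) w + indicator (ball 0 1 - ball 0 r) w \<partial>lborel)"
      unfolding I_def by (intro nn_integral_mono) (auto simp: indicator_def power_le_one ennreal_leI)
    also have "\<dots> = ennreal (r ^ (2 * m + 2)) * I + emeasure lborel (ball (0::complex) 1 - ball 0 r)"
      by (subst nn_integral_add) (auto simp: A)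
    also have "emeasure lborel (ball (0::complex) 1 - ball 0 r) = ennreal (pi - pi * r\<^sup>2)"
      using r by (subst emeasure_Diff) (auto simp: emeasure_disc ennreal_minus power_le_one)
    finally have "ennreal i \<le> ennreal (r ^ (2 * m + 2)) * ennreal i + ennreal (pi - pi * r\<^sup>2)"
      unfolding i(1) .
    also have "\<dots> = ennreal (r ^ (2 * m + 2) * i + (pi - pi * r\<^sup>2))"
      using r i(2) by (simp add: ennreal_mult[symmetric] ennreal_plus[symmetric] power_le_one del: ennreal_plus)
    finally have le1: "i \<le> r ^ (2 * m + 2) * i + (pi - pi * r\<^sup>2)"
      using r i(2) by (subst (asm) ennreal_le_iff) (auto simp: power_le_one intro!: add_nonneg_nonneg)
    have "r ^ (2 * m + 2) \<le> 1 / 2"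
    proof -
      have "r ^ (2 * m + 2) = (r\<^sup>2) ^ (m + 1)" unfolding power_mult[symmetric] by (rule arg_cong[of _ _ "\<lambda>n. r ^ n"]) simp
      also have "\<dots> \<le> exp (- (1 / (m + 1))) ^ (m + 1)"
        unfolding r2 using exp_ge_add_one_self[of "- (1 / (real m + 1))"] False
        by (intro power_mono) (auto simp: field_simps)
      also have "\<dots> = exp (-1)" unfolding exp_of_nat_mult[symmetric] by (rule arg_cong[of _ _ exp]) (simp add: field_simps)
      also have "\<dots> \<le> 1 / 2" using exp_ge_add_one_self[of 1] by (simp add: exp_minus field_simps)
      finally show ?thesis .
    qed
    hence "r ^ (2 * m + 2) * i \<le> 1 / 2 * i" using i(2) by (rule mult_right_mono)
    from order_trans[OF le1 add_right_mono[OF this]] have "i \<le> 2 * (pi - pi * r\<^sup>2)" by simp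
    also have "\<dots> = 2 * pi / (m + 1)" unfolding r2 by (simp add: field_simps)
    finally show ?thesis using i(1) unfolding I_def by (simp add: ennreal_leI)
  qed
qed

text \<open>Parseval applies on each circle. As the low powers are missing, |w|^(2j) may be replaced
  by |w|^(2m), which takes the radial integral out of the sum.\<close>

lemma disc_area_polynomial_le:
  fixes a :: "nat \<Rightarrow> complex"
  assumes "\<And>j. j < m \<Longrightarrow> a j = 0"
  shows "(\<integral>\<^sup>+w. ennreal ((cmod (\<Sum>j<N. a j * w ^ j))\<^sup>2) * indicator (ball 0 1) w \<partial>lborel)
     \<le> ennreal (2 * pi / (m + 1) * (\<Sum>j<N. (cmod (a j))\<^sup>2))"
proof -
  define F where "F w = ennreal ((cmod (\<Sum>j<N. a j * w ^ j))\<^sup>2) * indicator (ball 0 1) w" for w :: complex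
  have [measurable]: "F \<in> borel_measurable borel" unfolding F_def by measurable
  let ?A = "\<Sum>j<N. (cmod (a j))\<^sup>2"
  have A0: "0 \<le> ?A" by (intro sum_nonneg) auto
  have inner: "(\<integral>\<^sup>+t. F (cis t * w) * indicator {0..2*pi} t \<partial>lborel)
     \<le> ennreal (2 * pi * ?A) * (ennreal (cmod w ^ (2 * m)) * indicator (ball 0 1) w)" for w
  proof (cases "w \<in> ball 0 1")
    case True
    have Feq: "F (cis t * w) = ennreal ((cmod (\<Sum>j<N. (a j * w ^ j) * cis t ^ j))\<^sup>2)" for t
      using True by (simp add: F_def norm_mult power_mult_distrib mult_ac)
    have "(\<integral>\<^sup>+t. F (cis t * w) * indicator {0..2*pi} t \<partial>lborel) = ennreal (2 * pi * (\<Sum>j<N. (cmod (a j * w ^ j))\<^sup>2))"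
      unfolding Feq by (intro nn_integral_circle has_integral_circle_parseval continuous_intros) auto
    also have "(\<Sum>j<N. (cmod (a j * w ^ j))\<^sup>2) \<le> (\<Sum>j<N. (cmod (a j))\<^sup>2 * cmod w ^ (2 * m))"
    proof (intro sum_mono)
      fix j
      show "(cmod (a j * w ^ j))\<^sup>2 \<le> (cmod (a j))\<^sup>2 * cmod w ^ (2 * m)"
      proof (cases "j < m")
        case False
        hence "cmod w ^ (2 * j) \<le> cmod w ^ (2 * m)" using True by (intro power_decreasing) auto
        thus ?thesis by (simp add: norm_mult norm_power power_mult_distrib power_mult[symmetric] mult.commute[of j] mult_left_mono)
      qed (simp add: assms)
    qed
    finally show ?thesis using True A0
      by (simp add: ennreal_mult[symmetric] sum_distrib_right mult.assoc ennreal_leI)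
  qed (simp add: F_def norm_mult)
  have "ennreal (2 * pi) * (\<integral>\<^sup>+w. F w \<partial>lborel)
      = (\<integral>\<^sup>+w. (\<integral>\<^sup>+t. F (cis t * w) * indicator {0..2*pi} t \<partial>lborel) \<partial>lborel)"
    by (rule nn_integral_rotation_average) measurable
  also have "\<dots> \<le> (\<integral>\<^sup>+w. ennreal (2 * pi * ?A) * (ennreal (cmod w ^ (2 * m)) * indicator (ball 0 1) w) \<partial>lborel)"
    by (intro nn_integral_mono inner)
  also have "\<dots> = ennreal (2 * pi * ?A) * (\<integral>\<^sup>+w. (ennreal (cmod w ^ (2 * m)) * indicator (ball 0 1) w) \<partial>lborel)"
    by (intro nn_integral_cmult) measurable
  also have "\<dots> \<le> ennreal (2 * pi * ?A) * ennreal (2 * pi / (m + 1))"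
    by (intro mult_left_mono nn_integral_disc_power_le) auto
  also have "\<dots> = ennreal (2 * pi) * ennreal (2 * pi / (m + 1) * ?A)"
    using A0 by (simp add: ennreal_mult[symmetric] mult_ac)
  finally show ?thesis unfolding F_def by (simp add: ennreal_mult_le_mult_iff)
qed

section \<open>The symbol\<close>

text \<open>The height pi / 2 makes exp map the strip into the closed right half plane, so that
  \<open>exp 1 + exp w\<close> stays away from the branch cut of the logarithm.\<close>

definition quarter_strip :: "complex set" where
  "quarter_strip = {w. 0 \<le> Im w \<and> Im w \<le> pi / 2}"

lemma convex_quarter_strip: "convex quarter_strip"
proof -
  have eq: "quarter_strip = {w. Im w \<ge> 0} \<inter> {w. Im w \<le> pi / 2}" by (auto simp: quarter_strip_def)
  show ?thesis unfolding eq by (intro convex_Int convex_halfspace_Im_ge convex_halfspace_Im_le)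
qed

lemma exp_quarter_strip: "w \<in> quarter_strip \<Longrightarrow> 0 \<le> Re (exp w)"
  by (auto simp: quarter_strip_def Re_exp intro!: mult_nonneg_nonneg cos_ge_zero)

text \<open>Trades a quadratic factor for an arbitrarily small exponential rate; half of the rate is
  spent on each factor y + 2.\<close>

lemma square_le_exp:
  fixes y \<eta> :: real
  assumes "0 < \<eta>" "0 \<le> y"
  shows "(y + 2)\<^sup>2 \<le> (2 + 2 / \<eta>)\<^sup>2 * exp (\<eta> * y)"
proof -
  have "y + 2 \<le> (2 + 2 / \<eta>) * (1 + \<eta> * y / 2)"
    using assms by (simp add: field_simps)
  also have "\<dots> \<le> (2 + 2 / \<eta>) * exp (\<eta> * y / 2)"
    using assms exp_ge_add_one_self[of "\<eta> * y / 2"] by (intro mult_left_mono) auto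
  finally have "(y + 2)\<^sup>2 \<le> ((2 + 2 / \<eta>) * exp (\<eta> * y / 2))\<^sup>2"
    using assms by (intro power_mono) auto
  also have "\<dots> = (2 + 2 / \<eta>)\<^sup>2 * exp (\<eta> * y)"
    by (simp add: power_mult_distrib exp_double[symmetric])
  finally show ?thesis .
qed

text \<open>A holomorphic smoothing of the maximum of 1 and w: close to w far to the right, close to
  1 far to the left.\<close>

definition shifted_log :: "complex \<Rightarrow> complex" where
  "shifted_log w = Ln (of_real (exp 1) + exp w)"

text \<open>Everything rests on Re (exp w) \<ge> 0: adding \<open>exp 1\<close> does not decrease
  the modulus, and the imaginary part of the logarithm stays below pi / 2 < 2.\<close>

lemma shifted_log_strip:
  assumes "w \<in> quarter_strip"
  shows "1 \<le> Re (shifted_log w)" "Re w \<le> Re (shifted_log w)"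
    "cmod (shifted_log w) \<le> Re (shifted_log w) + 2"
    "(shifted_log has_field_derivative exp w / (of_real (exp 1) + exp w)) (at w)"
    "cmod (exp w / (of_real (exp 1) + exp w)) \<le> 1"
proof -
  let ?u = "of_real (exp 1) + exp w"
  have re: "exp 1 \<le> Re ?u" using exp_quarter_strip[OF assms] by simp
  hence pos: "0 < Re ?u" by (meson exp_gt_zero order_less_le_trans)
  hence nz: "?u \<noteq> 0" by (metis less_irrefl zero_complex.sel(1))
  have c1: "exp 1 \<le> cmod ?u" using re complex_Re_le_cmod[of ?u] by linarith
  have "(Re (exp w))\<^sup>2 + (Im (exp w))\<^sup>2 \<le> (Re ?u)\<^sup>2 + (Im ?u)\<^sup>2"
    using exp_quarter_strip[OF assms] by (auto intro!: power_mono)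
  hence c2: "cmod (exp w) \<le> cmod ?u" unfolding cmod_def by (rule real_sqrt_le_mono)
  have reA: "Re (shifted_log w) = ln (cmod ?u)" unfolding shifted_log_def using nz by simp
  have "ln (exp 1) \<le> ln (cmod ?u)" using c1 nz by (subst ln_le_cancel_iff) auto
  thus 1: "1 \<le> Re (shifted_log w)" unfolding reA by simp
  have "ln (cmod (exp w)) \<le> ln (cmod ?u)" using c2 nz by (subst ln_le_cancel_iff) auto
  thus "Re w \<le> Re (shifted_log w)" unfolding reA by simp
  have "\<bar>Im (shifted_log w)\<bar> < pi / 2" unfolding shifted_log_def using Re_Ln_pos_lt[OF nz] pos by simp
  hence "\<bar>Im (shifted_log w)\<bar> < 2" using pi_less_4 by linarith
  moreover have "cmod (shifted_log w) \<le> \<bar>Re (shifted_log w)\<bar> + \<bar>Im (shifted_log w)\<bar>" by (rule cmod_le)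
  ultimately show "cmod (shifted_log w) \<le> Re (shifted_log w) + 2" using 1 by linarith
  have "?u \<notin> \<real>\<^sub>\<le>\<^sub>0" using pos unfolding complex_nonpos_Reals_iff by linarith
  thus "(shifted_log has_field_derivative exp w / ?u) (at w)"
    unfolding shifted_log_def by (auto intro!: derivative_eq_intros simp: divide_inverse mult.commute)
  show "cmod (exp w / ?u) \<le> 1" using c2 nz by (simp add: norm_divide divide_le_eq_1)
qed

section \<open>The conformal map between disc and strip\<close>

definition cayley :: "complex \<Rightarrow> complex" where
  "cayley z = (1 + z) / (1 - z)"

text \<open>The image of the disc is the open strip; the boundary arc in the lower half plane goes to the reals, with \<open>\<infinity>\<close> at 1.\<close>

definition to_strip :: "complex \<Rightarrow> complex" where
  "to_strip z = Ln (cayley z) / 2 + \<i> * of_real (pi / 4)"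

lemma Re_cayley: "Re (cayley z) = (1 - (cmod z)\<^sup>2) / (cmod (1 - z))\<^sup>2"
  unfolding cayley_def Re_divide cmod_power2 by (simp add: power2_eq_square algebra_simps)

lemma Im_cayley: "Im (cayley z) = 2 * Im z / (cmod (1 - z))\<^sup>2"
  unfolding cayley_def Im_divide cmod_power2 by (simp add: power2_eq_square algebra_simps)

lemma cayley_nonzero: "z \<noteq> 1 \<Longrightarrow> z \<noteq> -1 \<Longrightarrow> cayley z \<noteq> 0"
  by (auto simp: cayley_def add_eq_0_iff)

lemma to_strip_in_strip:
  assumes "cmod z \<le> 1" "z \<noteq> 1" "z \<noteq> -1"
  shows "to_strip z \<in> quarter_strip"
proof -
  have "0 \<le> Re (cayley z)" using assms by (simp add: Re_cayley power_le_one)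
  hence "\<bar>Im (Ln (cayley z))\<bar> \<le> pi / 2" using Re_Ln_pos_le cayley_nonzero assms by blast
  hence "- (pi / 2) \<le> Im (Ln (cayley z))" "Im (Ln (cayley z)) \<le> pi / 2" by linarith+
  moreover have "Im (to_strip z) = Im (Ln (cayley z)) / 2 + pi / 4" by (simp add: to_strip_def)
  ultimately show ?thesis unfolding quarter_strip_def mem_Collect_eq by linarith
qed

lemma continuous_on_to_strip: "continuous_on (cball 0 1 - {1, -1}) to_strip"
proof -
  have "cayley z \<notin> \<real>\<^sub>\<le>\<^sub>0" if "z \<in> cball 0 1 - {1, -1}" for z
  proof -
    have "0 \<le> Re (cayley z)" using that by (simp add: Re_cayley power_le_one)
    moreover have "cayley z \<noteq> 0" using that cayley_nonzero by auto
    ultimately show ?thesis by (auto elim!: nonpos_Reals_cases)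
  qed
  thus ?thesis unfolding to_strip_def
    by (intro continuous_intros) (auto simp: cayley_def intro!: continuous_intros)
qed

lemma holomorphic_on_to_strip: "to_strip holomorphic_on ball 0 1"
proof -
  have "cayley z \<notin> \<real>\<^sub>\<le>\<^sub>0" if "z \<in> ball 0 1" for z
  proof -
    have "z \<noteq> 1" using that by auto
    hence "0 < Re (cayley z)" using that
      by (simp add: Re_cayley) (intro divide_pos_pos, auto simp: abs_square_less_1 power_less_one_iff)
    thus ?thesis by (auto elim!: nonpos_Reals_cases)
  qed
  thus ?thesis unfolding to_strip_def
    by (intro holomorphic_intros) (auto simp: cayley_def intro!: holomorphic_intros)
qed

text \<open>Solves \<open>to_strip z = w\<close> for z: the Cayley image of z has to be - i * exp (2
  * w), and v |-> (v - 1) / (v + 1) inverts the Cayley map.\<close>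

definition from_strip :: "complex \<Rightarrow> complex" where
  "from_strip w = (- \<i> * exp (2 * w) - 1) / (- \<i> * exp (2 * w) + 1)"

lemma from_strip:
  assumes "0 < Im w" "Im w < pi / 2"
  shows "0 < Re (- \<i> * exp (2 * w))" "cmod (from_strip w) < 1" "to_strip (from_strip w) = w"
proof -
  let ?v = "- \<i> * exp (2 * w)"
  show pos: "0 < Re ?v" using assms by (simp add: Im_exp sin_gt_zero)
  have n: "?v + 1 \<noteq> 0"
  proof
    assume "?v + 1 = 0" hence "Re (?v + 1) = 0" by (simp only: zero_complex.sel)
    thus False using pos by simp
  qed
  have c: "cayley (from_strip w) = ?v"
    unfolding cayley_def from_strip_def using n by (simp add: field_simps)
  have "from_strip w \<noteq> 1" unfolding from_strip_def using n by (simp add: field_simps)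
  hence "0 < (cmod (1 - from_strip w))\<^sup>2" by simp
  with pos show "cmod (from_strip w) < 1" unfolding c[symmetric] Re_cayley
    by (simp add: zero_less_divide_iff power_less_one_iff abs_square_less_1)
  have "exp (\<i> * of_real (pi / 2)) = \<i>" by (metis cis_conv_exp cis_pi_half)
  hence "exp (2 * w - \<i> * of_real (pi / 2)) = ?v" unfolding exp_diff by simp
  moreover have "Ln (exp (2 * w - \<i> * of_real (pi / 2))) = 2 * w - \<i> * of_real (pi / 2)"
    using assms by (intro Ln_exp) simp_all
  ultimately have "Ln ?v = 2 * w - \<i> * of_real (pi / 2)" by (simp only:)
  thus "to_strip (from_strip w) = w" unfolding to_strip_def c by (simp add: complex_eq_iff field_simps)
qed

text \<open>The angle in (- pi, 0) of the boundary point over the real number x. It is about - 2 *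
  exp (- 2 * x) for large x, which is the exponential thinness of the arc.\<close>

definition lower_arc :: "real \<Rightarrow> real" where
  "lower_arc x = - 2 * arctan (exp (- 2 * x))"

text \<open>With u = exp (- 2 * x), up to sign the tangent of half the angle, the boundary point is
  (1 - i u) / (1 + i u) and its Cayley image 1 / (i u).\<close>

lemma to_strip_lower_arc: "to_strip (cis (lower_arc x)) = of_real x"
proof -
  define u where "u = exp (- 2 * x)"
  have u: "0 < u" by (simp add: u_def)
  have s: "sqrt (1 + u\<^sup>2) * sqrt (1 + u\<^sup>2) = 1 + u\<^sup>2" by simp
  have ca: "cis (- arctan u) = (1 - \<i> * of_real u) / of_real (sqrt (1 + u\<^sup>2))"
    by (simp add: complex_eq_iff cos_arctan sin_arctan)
  have nz: "1 + \<i> * of_real u \<noteq> 0" "1 - \<i> * of_real u \<noteq> 0" by (auto simp: complex_eq_iff)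
  have "cis (lower_arc x) = cis (- arctan u) * cis (- arctan u)"
    by (simp add: lower_arc_def u_def cis_mult)
  also have "\<dots> = (1 - \<i> * of_real u) * (1 - \<i> * of_real u) / of_real (1 + u\<^sup>2)"
    unfolding ca by (simp only: times_divide_times_eq of_real_mult[symmetric] s)
  also have "complex_of_real (1 + u\<^sup>2) = (1 - \<i> * of_real u) * (1 + \<i> * of_real u)"
    by (simp add: complex_eq_iff power2_eq_square)
  finally have c: "cis (lower_arc x) = (1 - \<i> * of_real u) / (1 + \<i> * of_real u)"
    using nz by simp
  have "cayley (cis (lower_arc x)) = - \<i> * of_real (1 / u)"
  proof -
    have "1 + cis (lower_arc x) = 2 / (1 + \<i> * of_real u)"
      "1 - cis (lower_arc x) = 2 * (\<i> * of_real u) / (1 + \<i> * of_real u)"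
      unfolding c using nz by (simp_all add: field_simps)
    moreover have "(2 / A) / (2 * B / A) = 1 / B" if "A \<noteq> 0" for A B :: complex
      using that by simp
    ultimately have "cayley (cis (lower_arc x)) = 1 / (\<i> * of_real u)"
      unfolding cayley_def using nz(1) by (simp only:)
    also have "\<dots> = - \<i> * of_real (1 / u)" using u by (simp add: divide_inverse)
    finally show ?thesis .
  qed
  also have "1 / u = exp (2 * x)" by (simp add: u_def exp_minus field_simps)
  also have "- \<i> * of_real (exp (2 * x)) = exp (of_real (2 * x) - \<i> * of_real (pi / 2))"
    by (auto simp: complex_eq_iff Re_exp Im_exp)
  finally have "Ln (cayley (cis (lower_arc x))) = of_real (2 * x) - \<i> * of_real (pi / 2)"
    by (simp only:, subst Ln_exp) (auto intro: order_trans[of _ 0])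
  thus ?thesis unfolding to_strip_def by (simp add: field_simps)
qed

section \<open>The exponent \<open>H\<close> and the modulus of the symbol\<close>

locale spiral_symbol =
  fixes p :: real
  assumes p: "0 < p"
begin

text \<open>Normalises the bound for the derivative of \<open>H\<close> to 1 / 4: the factor 1 + p
  stems from the product rule, the square from \<open>square_le_exp\<close> at rate p.\<close>

definition eps :: real where "eps = 1 / (4 * (1 + p) * (2 + 2 / p)\<^sup>2)"

text \<open>The function w^2 * exp (- p * w) with w replaced by \<open>shifted_log w\<close>, which
  keeps it bounded on the whole strip and positive on the whole real axis.\<close>

definition H :: "complex \<Rightarrow> complex" where
  "H w = of_real eps * (shifted_log w)\<^sup>2 * exp (- of_real p * shifted_log w)"

definition h :: "real \<Rightarrow> real" where
  "h x = eps * (ln (exp 1 + exp x))\<^sup>2 * exp (- p * ln (exp 1 + exp x))"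

text \<open>Used on the closed disc except at 1 and -1: on the circle the formula itself supplies
  the boundary values.\<close>

definition phi :: "complex \<Rightarrow> complex" where
  "phi z = exp (\<i> * to_strip z - H (to_strip z))"

lemma eps_pos: "0 < eps"
proof -
  have "0 < 2 + 2 / p" using p by (intro add_pos_pos) auto
  thus ?thesis using p by (simp add: eps_def)
qed

lemma eps_le_1: "eps \<le> 1"
proof -
  have "1 \<le> (2 + 2 / p)\<^sup>2" using p by (intro one_le_power) auto
  hence "1 * 1 \<le> (4 * (1 + p)) * (2 + 2 / p)\<^sup>2" using p by (intro mult_mono) auto
  thus ?thesis unfolding eps_def by (simp add: divide_le_eq_1)
qed

text \<open>With y = Re (shifted_log w), the polynomial from the product rule is at most a constant
  times exp (p * y), and the exponential factor of \<open>H\<close> cancels exactly that; the inner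
  derivative has modulus at most 1.\<close>

lemma H_deriv:
  assumes "w \<in> quarter_strip"
  obtains D where "(H has_field_derivative D) (at w)" "cmod D \<le> 1 / 4"
proof
  let ?a = "shifted_log w"
  let ?b = "exp w / (of_real (exp 1) + exp w)"
  let ?D = "of_real eps * ((2 * ?a - of_real p * ?a\<^sup>2) * exp (- of_real p * ?a)) * ?b"
  note sl = shifted_log_strip[OF assms]
  show "(H has_field_derivative ?D) (at w)"
    unfolding H_def by (auto intro!: derivative_eq_intros sl(4) simp: power2_eq_square algebra_simps)
  define y where "y = Re ?a"
  have y: "1 \<le> y" using sl by (simp add: y_def)
  have ay: "cmod ?a \<le> y + 2" using sl by (simp add: y_def)
  have "cmod (2 * ?a - of_real p * ?a\<^sup>2) \<le> 2 * cmod ?a + p * (cmod ?a)\<^sup>2"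
    using p norm_triangle_ineq4[of "2 * ?a" "of_real p * ?a\<^sup>2"] by (simp add: norm_mult norm_power)
  also have "\<dots> \<le> 2 * (y + 2) + p * (y + 2)\<^sup>2"
    using ay p by (intro add_mono mult_left_mono power_mono) auto
  also have "\<dots> \<le> (y + 2) * (y + 2) + p * (y + 2)\<^sup>2"
    using y by (intro add_right_mono mult_right_mono) auto
  also have "\<dots> = (1 + p) * (y + 2)\<^sup>2" by (simp add: power2_eq_square algebra_simps)
  also have "\<dots> \<le> (1 + p) * ((2 + 2 / p)\<^sup>2 * exp (p * y))"
    using p y by (intro mult_left_mono square_le_exp) auto
  finally have 1: "cmod (2 * ?a - of_real p * ?a\<^sup>2) \<le> (1 + p) * ((2 + 2 / p)\<^sup>2 * exp (p * y))" .
  have "cmod ?D = eps * (cmod (2 * ?a - of_real p * ?a\<^sup>2) * exp (- p * y)) * cmod ?b"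
    using eps_pos by (simp only: norm_mult) (simp add: y_def)
  also have "\<dots> \<le> eps * (((1 + p) * ((2 + 2 / p)\<^sup>2 * exp (p * y))) * exp (- p * y)) * 1"
    using eps_pos p by (intro mult_mono mult_left_mono mult_right_mono 1 sl(5)) auto
  also have "\<dots> = eps * (1 + p) * (2 + 2 / p)\<^sup>2"
    by (simp add: mult.assoc exp_add[symmetric])
  also have "\<dots> = 1 / 4"
  proof -
    have "2 + 2 / p \<noteq> 0" "1 + p \<noteq> 0" using p by (auto simp: add_pos_pos less_imp_neq[symmetric] pos_add_strict)
    thus ?thesis unfolding eps_def by (simp add: divide_simps del: add_divide_distrib)
  qed
  finally show "cmod ?D \<le> 1 / 4" .
qed

text \<open>The constant 1/4 serves three times: for |phi| < 1, for the contraction that produces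
  the sample points, and for keeping these points apart.\<close>

lemma H_lipschitz:
  assumes "w \<in> quarter_strip" "w' \<in> quarter_strip"
  shows "cmod (H w - H w') \<le> 1 / 4 * cmod (w - w')"
proof -
  obtain D where D: "\<And>w. w \<in> quarter_strip \<Longrightarrow> (H has_field_derivative D w) (at w) \<and> cmod (D w) \<le> 1/4"
  proof -
    have "\<forall>w\<in>quarter_strip. \<exists>D. (H has_field_derivative D) (at w) \<and> cmod D \<le> 1/4" by (meson H_deriv)
    from bchoice[OF this] show ?thesis using that by blast
  qed
  show ?thesis
    by (rule field_differentiable_bound[OF convex_quarter_strip, of H D])
       (use D assms in \<open>auto intro: has_field_derivative_at_within\<close>)
qed

text \<open>The logarithmic factor is given away for a rate \<open>\<eta>\<close>; the Bergman lower
  bound can afford the loss of a small power.\<close>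

lemma H_decay:
  assumes "0 < \<eta>" "\<eta> < p" "w \<in> quarter_strip" "0 \<le> Re w"
  shows "cmod (H w) \<le> (2 + 2 / \<eta>)\<^sup>2 * exp (- (p - \<eta>) * Re w)"
proof -
  let ?a = "shifted_log w"
  note sl = shifted_log_strip[OF assms(3)]
  define y where "y = Re ?a"
  have y: "1 \<le> y" "Re w \<le> y" "cmod ?a \<le> y + 2" using sl by (auto simp: y_def)
  have "cmod (H w) = eps * (cmod ?a)\<^sup>2 * exp (- p * y)"
    unfolding H_def using eps_pos by (simp add: norm_mult norm_power y_def)
  also have "\<dots> \<le> 1 * (y + 2)\<^sup>2 * exp (- p * y)"
    using y eps_le_1 eps_pos by (intro mult_right_mono mult_mono power_mono) auto
  also have "\<dots> \<le> ((2 + 2 / \<eta>)\<^sup>2 * exp (\<eta> * y)) * exp (- p * y)"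
    using square_le_exp[of \<eta> y] assms y by (intro mult_right_mono) auto
  also have "\<dots> = (2 + 2 / \<eta>)\<^sup>2 * exp (- (p - \<eta>) * y)"
    by (simp add: mult.assoc exp_add[symmetric] algebra_simps)
  also have "\<dots> \<le> (2 + 2 / \<eta>)\<^sup>2 * exp (- (p - \<eta>) * Re w)"
    using y assms by (intro mult_left_mono) (auto intro!: mult_left_mono)
  finally show ?thesis .
qed

lemma H_of_real: "H (of_real x) = of_real (h x)"
proof -
  have "0 < exp 1 + exp x" by (simp add: add_pos_pos)
  hence "shifted_log (of_real x) = of_real (ln (exp 1 + exp x))"
    unfolding shifted_log_def by (simp add: exp_of_real[symmetric] Ln_of_real[symmetric] del: Ln_of_real)
  thus ?thesis unfolding H_def h_def
    by (simp add: exp_of_real[symmetric])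
qed

lemma log_bounds:
  "1 \<le> ln (exp 1 + exp x)" "x \<le> ln (exp 1 + exp x)"
  "0 \<le> x \<Longrightarrow> ln (exp 1 + exp x) \<le> x + 2" "x \<le> 0 \<Longrightarrow> ln (exp 1 + exp x) \<le> 2" for x :: real
proof -
  have pos: "0 < exp 1 + exp x" by (simp add: add_pos_pos)
  have e: "exp 1 * exp (1::real) \<ge> exp 1 + 1"
  proof -
    have "2 \<le> exp (1::real)" using exp_ge_add_one_self[of 1] by simp
    hence "2 * exp 1 \<le> exp 1 * exp (1::real)" by (intro mult_right_mono) auto
    thus ?thesis using \<open>2 \<le> exp (1::real)\<close> by linarith
  qed
  show "1 \<le> ln (exp 1 + exp x)" using pos by (subst ln_ge_iff) auto
  show "x \<le> ln (exp 1 + exp x)" using pos by (subst ln_ge_iff) auto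
  show "ln (exp 1 + exp x) \<le> x + 2" if "0 \<le> x"
  proof -
    have "exp 1 + exp x \<le> exp 1 * exp x + exp x" using that by simp
    also have "\<dots> = (exp 1 + 1) * exp x" by (simp add: algebra_simps)
    also have "\<dots> \<le> (exp 1 * exp 1) * exp x" using e by (intro mult_right_mono) auto
    also have "\<dots> = exp (x + 2)" by (simp add: exp_add[symmetric])
    finally show ?thesis using pos by (metis exp_gt_zero ln_exp ln_le_cancel_iff)
  qed
  show "ln (exp 1 + exp x) \<le> 2" if "x \<le> 0"
  proof -
    have "exp 1 + exp x \<le> exp 1 * exp 1" using that e by (smt (verit) exp_le_one_iff)
    also have "\<dots> = exp 2" by (simp add: exp_add[symmetric])
    finally show ?thesis using pos by (metis exp_gt_zero ln_exp ln_le_cancel_iff)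
  qed
qed

lemma h_pos: "0 < h x"
  using eps_pos log_bounds(1)[of x] by (auto simp: h_def)

lemma continuous_on_h: "continuous_on A h"
proof -
  have "exp 1 + exp x \<noteq> (0::real)" for x by (smt (verit) exp_gt_zero)
  thus ?thesis unfolding h_def by (intro continuous_intros) auto
qed

lemma h_lower_left: "x \<le> 0 \<Longrightarrow> eps * exp (- 2 * p) \<le> h x"
proof -
  assume x: "x \<le> 0"
  have "eps * 1 * exp (- 2 * p) \<le> h x"
    unfolding h_def using log_bounds[of x] x p eps_pos
    by (intro mult_mono mult_left_mono one_le_power) (auto simp: mult.commute[of p])
  thus ?thesis by simp
qed

text \<open>On the k-th turn the logarithm lies between (k + 1) / 2 and 2 * pi * k + 2 * pi + 2; the
  lower end enters the square, the upper end the exponential. The form k + 1 keeps the bound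
  positive on the turn k = 0.\<close>

lemma h_lower_block:
  assumes "2 * pi * real k \<le> x" "x \<le> 2 * pi * real k + 2 * pi"
  shows "eps * exp (- p * (2 * pi + 2)) / 4 * ((real k + 1)\<^sup>2 * exp (- 2 * pi * p * real k)) \<le> h x"
proof -
  define a where "a = ln (exp 1 + exp x)"
  have x0: "0 \<le> x" using assms(1) by (smt (verit) mult_nonneg_nonneg of_nat_0_le_iff pi_ge_zero)
  have a: "1 \<le> a" "x \<le> a" "a \<le> x + 2" using log_bounds[of x] x0 by (auto simp: a_def)
  have "(real k + 1) / 2 \<le> a"
  proof (cases "k = 0")
    case False
    have "2 * real k \<le> 2 * pi * real k" using pi_gt3 by (intro mult_right_mono) auto
    also have "\<dots> \<le> a" using assms(1) a(2) by (rule order_trans)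
    finally have "2 * real k \<le> a" .
    moreover have "1 \<le> real k" using False by simp
    hence "(real k + 1) / 2 \<le> 2 * real k" by simp
    ultimately show ?thesis by (rule order_trans[rotated])
  qed (use a in auto)
  hence 1: "((real k + 1) / 2)\<^sup>2 \<le> a\<^sup>2" by (intro power_mono) auto
  have "p * a \<le> p * (2 * pi * real k + 2 * pi + 2)" using a assms p by (intro mult_left_mono) auto
  hence 2: "exp (- p * (2 * pi * real k + 2 * pi + 2)) \<le> exp (- p * a)" by simp
  have "eps * ((real k + 1) / 2)\<^sup>2 * exp (- p * (2 * pi * real k + 2 * pi + 2)) \<le> eps * a\<^sup>2 * exp (- p * a)"
    using 1 2 eps_pos by (intro mult_mono mult_left_mono) auto
  moreover have "exp (- p * (2 * pi * real k + 2 * pi + 2)) = exp (- p * (2 * pi + 2)) * exp (- 2 * pi * p * real k)"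
    by (simp add: exp_add[symmetric] algebra_simps)
  ultimately show ?thesis unfolding h_def a_def[symmetric]
    by (simp add: power_divide algebra_simps)
qed

text \<open>Bounds the ratio of two values of \<open>h\<close> within one turn: the square accounts
  for the logarithmic factor, the exponential for the decay.\<close>

definition block_const :: real where "block_const = (2 * pi + 3)\<^sup>2 * exp (p * (2 * pi + 2))"

lemma block_const_ge_1: "1 \<le> block_const"
proof -
  have "1 * 1 \<le> (2 * pi + 3)\<^sup>2 * exp (p * (2 * pi + 2))"
    using p pi_gt_zero by (intro mult_mono one_le_power) auto
  thus ?thesis by (simp add: block_const_def)
qed

lemma h_compare:
  assumes "0 \<le> x" "0 \<le> y" "\<bar>x - y\<bar> \<le> 2 * pi"
  shows "h x \<le> block_const * h y"
proof -
  define a where "a = ln (exp 1 + exp x)"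
  define b where "b = ln (exp 1 + exp y)"
  have a: "1 \<le> a" "x \<le> a" "a \<le> x + 2" using log_bounds[of x] assms by (auto simp: a_def)
  have b: "1 \<le> b" "y \<le> b" "b \<le> y + 2" using log_bounds[of y] assms by (auto simp: b_def)
  have "a \<le> b + (2 * pi + 2)" using a b assms by linarith
  also have "\<dots> \<le> b + (2 * pi + 2) * b" using b by (intro add_left_mono) (auto intro!: mult_right_mono[of 1 b "2*pi+2", simplified] mult_left_mono[of 1 b "2*pi+2", simplified])
  finally have "a \<le> (2 * pi + 3) * b" by (simp add: algebra_simps)
  hence 1: "a\<^sup>2 \<le> ((2 * pi + 3) * b)\<^sup>2" using a by (intro power_mono) auto
  have "p * (b - (2 * pi + 2)) \<le> p * a" using a b assms p by (intro mult_left_mono) auto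
  hence 2: "exp (- p * a) \<le> exp (p * (2 * pi + 2)) * exp (- p * b)"
    by (simp add: exp_add[symmetric] algebra_simps)
  have "eps * a\<^sup>2 * exp (- p * a) \<le> eps * ((2 * pi + 3) * b)\<^sup>2 * (exp (p * (2 * pi + 2)) * exp (- p * b))"
    using 1 2 eps_pos by (intro mult_mono mult_left_mono) auto
  thus ?thesis unfolding h_def a_def[symmetric] b_def[symmetric] block_const_def
    by (simp add: power_mult_distrib mult_ac)
qed

text \<open>Moving vertically from Re w to w changes Re (H w) by at most Im w / 4, while exp (i * w)
  contributes the full decay Im w; 3/4 is what remains.\<close>

lemma phi_bound_strip:
  assumes "w \<in> quarter_strip"
  shows "cmod (exp (\<i> * w - H w)) \<le> exp (- (3 / 4) * Im w - h (Re w))"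
proof -
  have r: "of_real (Re w) \<in> quarter_strip" using assms by (simp add: quarter_strip_def)
  have "w - of_real (Re w) = \<i> * of_real (Im w)" by (simp add: complex_eq_iff)
  hence "cmod (w - of_real (Re w)) = Im w" using assms by (simp add: quarter_strip_def norm_mult)
  hence "cmod (H w - H (of_real (Re w))) \<le> 1 / 4 * Im w" using H_lipschitz[OF assms r] by simp
  hence "\<bar>Re (H w - H (of_real (Re w)))\<bar> \<le> 1 / 4 * Im w" using abs_Re_le_cmod order_trans by blast
  hence "- Re (H w) \<le> - h (Re w) + 1 / 4 * Im w" unfolding H_of_real minus_complex.sel Re_complex_of_real by linarith
  thus ?thesis by simp
qed

lemma H_continuous: "continuous_on quarter_strip H"
  by (rule DERIV_continuous_on[of _ _ "\<lambda>w. deriv H w"])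
     (metis DERIV_imp_deriv H_deriv has_field_derivative_at_within)

lemma phi_norm_less_1:
  assumes "cmod z \<le> 1" "z \<noteq> 1" "z \<noteq> -1"
  shows "cmod (phi z) < 1"
proof -
  let ?w = "to_strip z"
  have w: "?w \<in> quarter_strip" by (rule to_strip_in_strip[OF assms])
  have "cmod (phi z) \<le> exp (- (3 / 4) * Im ?w - h (Re ?w))"
    unfolding phi_def by (rule phi_bound_strip[OF w])
  also have "\<dots> < 1" using w h_pos[of "Re ?w"] by (simp add: quarter_strip_def)
  finally show ?thesis .
qed

lemma phi_continuous: "continuous_on (cball 0 1 - {1, -1}) phi"
  unfolding phi_def
  by (intro continuous_intros continuous_on_to_strip continuous_on_compose2[OF H_continuous continuous_on_to_strip])
     (auto intro: to_strip_in_strip)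

lemma phi_holomorphic: "phi holomorphic_on ball 0 1"
proof -
  have "(\<lambda>z. H (to_strip z)) holomorphic_on ball 0 1"
    unfolding holomorphic_on_def
  proof
    fix z :: complex assume z: "z \<in> ball 0 1"
    hence w: "to_strip z \<in> quarter_strip" by (intro to_strip_in_strip) auto
    obtain D where D: "(H has_field_derivative D) (at (to_strip z))" using H_deriv[OF w] by blast
    have "to_strip field_differentiable at z within ball 0 1"
      using holomorphic_on_to_strip z by (auto simp: holomorphic_on_def)
    then obtain E where E: "(to_strip has_field_derivative E) (at z within ball 0 1)"
      by (auto simp: field_differentiable_def)
    show "(\<lambda>z. H (to_strip z)) field_differentiable at z within ball 0 1"
      using DERIV_chain2[OF D E] by (auto simp: field_differentiable_def)
  qed
  thus ?thesis unfolding phi_def by (intro holomorphic_intros holomorphic_on_to_strip)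
qed

lemma phi_lower_arc: "phi (cis (lower_arc x)) = of_real (exp (- h x)) * cis x"
  by (simp add: phi_def to_strip_lower_arc H_of_real exp_diff exp_minus exp_of_real[symmetric] divide_inverse)
     (simp add: cis_conv_exp)

text \<open>The first entry is the decay on the upper edge of the strip, where Im w = pi / 2; the
  second is the lower bound for \<open>h\<close> on the left half line.\<close>

definition gap :: real where "gap = min (3 * pi / 8) (eps * exp (- 2 * p))"

lemma gap_pos: "0 < gap" using eps_pos by (simp add: gap_def)

text \<open>The upper half circle goes to the upper edge of the strip, and the left half circle to
  the part with Re w \<le> 0, since there |cayley z| \<le> 1. Only the arc in the open fourth
  quadrant is left to the spiral.\<close>

lemma phi_far_arc:
  assumes "cmod z = 1" "z \<noteq> 1" "z \<noteq> -1" "Re z \<le> 0 \<or> 0 < Im z"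
  shows "cmod (phi z) \<le> exp (- gap)"
proof -
  let ?w = "to_strip z"
  have w: "?w \<in> quarter_strip" using assms by (intro to_strip_in_strip) auto
  have b: "cmod (phi z) \<le> exp (- (3 / 4) * Im ?w - h (Re ?w))"
    unfolding phi_def by (rule phi_bound_strip[OF w])
  have nz: "cayley z \<noteq> 0" using cayley_nonzero assms by blast
  have "gap \<le> (3 / 4) * Im ?w + h (Re ?w)"
    using assms(4)
  proof
    assume "Re z \<le> 0"
    hence "cmod (1 + z) \<le> cmod (1 - z)" unfolding cmod_def by (simp add: power2_eq_square algebra_simps)
    hence "cmod (cayley z) \<le> 1" using assms by (simp add: cayley_def norm_divide divide_le_eq_1)
    hence "Re ?w \<le> 0" using nz by (simp add: to_strip_def ln_le_zero_iff)
    from h_lower_left[OF this] show ?thesis using w by (simp add: gap_def quarter_strip_def min_le_iff_disj)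
  next
    assume i: "0 < Im z"
    have "Re (cayley z) = 0" using assms by (simp add: Re_cayley)
    moreover have "0 < Im (cayley z)" using i assms by (simp add: Im_cayley)
    ultimately have "Im (Ln (cayley z)) = pi / 2" using Im_Ln_eq_pi_half[OF nz] by simp
    hence "Im ?w = pi / 2" by (simp add: to_strip_def)
    thus ?thesis using h_pos[of "Re ?w"] by (simp add: gap_def)
  qed
  hence "exp (- (3 / 4) * Im ?w - h (Re ?w)) \<le> exp (- gap)" by simp
  with b show ?thesis by (rule order_trans)
qed

end

section \<open>Boundary integrals of the symbol\<close>

text \<open>Cauchy-Schwarz against a geometric series. It serves the far arc, where |w| stays away
  from 1; on the spiral an average over a turn takes its place.\<close>

lemma polynomial_norm_sq_le:
  fixes a :: "nat \<Rightarrow> complex"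
  assumes "cmod w < 1"
  shows "(cmod (\<Sum>j<N. a j * w ^ j))\<^sup>2 \<le> (\<Sum>j<N. (cmod (a j))\<^sup>2) / (1 - cmod w)"
proof -
  have "(cmod (\<Sum>j<N. a j * w ^ j))\<^sup>2 \<le> (\<Sum>j<N. cmod (a j) * cmod w ^ j)\<^sup>2"
    by (intro power_mono norm_ge_zero, rule order_trans[OF norm_sum]) (simp add: norm_mult norm_power)
  also have "\<dots> \<le> (\<Sum>j<N. (cmod (a j))\<^sup>2) * (\<Sum>j<N. (cmod w ^ j)\<^sup>2)"
    by (rule Cauchy_Schwarz_ineq_sum)
  also have "(\<Sum>j<N. (cmod w ^ j)\<^sup>2) \<le> (\<Sum>j<N. cmod w ^ j)"
    using assms by (intro sum_mono) (simp add: power2_eq_square mult_left_le power_le_one)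
  also have "\<dots> \<le> 1 / (1 - cmod w)"
    using assms sum_le_suminf[OF summable_geometric[of "cmod w"], of "{..<N}"] suminf_geometric[of "cmod w"] by simp
  finally show ?thesis by (simp add: mult_left_mono sum_nonneg)
qed

section \<open>The arc towards 1, turn by turn\<close>

context spiral_symbol
begin

text \<open>The shift by 2 * pi makes x \<ge> 0 parametrise the end [3 * pi / 2, 2 * pi) of the
  interval of integration.\<close>

definition theta :: "real \<Rightarrow> real" where "theta x = 2 * pi + lower_arc x"

lemma cis_theta: "cis (theta x) = cis (lower_arc x)"
  by (simp add: theta_def cis_mult[symmetric])

lemma theta_0: "theta 0 = 3 * pi / 2"
  by (simp add: theta_def lower_arc_def arctan_one)

lemma theta_less: "theta x < 2 * pi"
  by (simp add: theta_def lower_arc_def)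

lemma theta_mono: "x \<le> y \<Longrightarrow> theta x \<le> theta y"
  by (simp add: theta_def lower_arc_def arctan_le_iff)

lemma theta_deriv: "(theta has_field_derivative 4 * exp (- 2 * x) / (1 + exp (- 4 * x))) (at x within A)"
proof -
  have "(exp (- 2 * x))\<^sup>2 = exp (- 4 * x)" by (simp add: exp_double[symmetric])
  thus ?thesis unfolding theta_def lower_arc_def
    by (auto intro!: derivative_eq_intros simp: divide_inverse)
qed

lemma theta_tendsto: "(\<lambda>K. theta (2 * pi * real K)) \<longlonglongrightarrow> 2 * pi"
proof -
  have "(\<lambda>K. exp (- 4 * pi) ^ K) \<longlonglongrightarrow> 0" by (intro LIMSEQ_power_zero) simp
  moreover have "exp (- 4 * pi) ^ K = exp (- 2 * (2 * pi * real K))" for K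
    by (simp add: exp_of_nat_mult[symmetric] algebra_simps)
  ultimately have "(\<lambda>K. exp (- 2 * (2 * pi * real K))) \<longlonglongrightarrow> 0" by simp
  hence "(\<lambda>K. 2 * pi + - 2 * arctan (exp (- 2 * (2 * pi * real K)))) \<longlonglongrightarrow> 2 * pi + - 2 * arctan 0"
    by (intro tendsto_intros)
  thus ?thesis by (simp add: theta_def lower_arc_def)
qed

definition decay_const :: real where "decay_const = eps * exp (- p * (2 * pi + 2)) / 4"

text \<open>Up to constants, the length of the k-th arc times an upper bound for |phi|^(2n) on
  it.\<close>

definition block_term :: "nat \<Rightarrow> nat \<Rightarrow> real" where
  "block_term n k = exp (- 4 * pi * real k) *
     exp (- 2 * real n * (decay_const * ((real k + 1)\<^sup>2 * exp (- 2 * pi * p * real k))))"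

definition block_sum :: "nat \<Rightarrow> real" where "block_sum n = suminf (block_term n)"

lemma decay_const_pos: "0 < decay_const"
  using eps_pos by (simp add: decay_const_def)

text \<open>Lets the turn k = 0 also dominate the factor exp (- 2 * n * gap) of the far arc.\<close>

lemma decay_const_le_gap: "decay_const \<le> gap"
proof -
  have "exp (- p * (2 * pi + 2)) \<le> exp (- 2 * p)" using p pi_gt_zero by (simp add: algebra_simps)
  hence "eps * exp (- p * (2 * pi + 2)) / 4 \<le> eps * exp (- 2 * p)"
    using eps_pos by (smt (verit) exp_gt_zero mult_left_mono field_sum_of_halves zero_less_mult_iff divide_le_eq)
  moreover have "eps * exp (- p * (2 * pi + 2)) / 4 \<le> 3 * pi / 8"
  proof -
    have "eps * exp (- p * (2 * pi + 2)) \<le> 1 * 1"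
      using eps_le_1 eps_pos p pi_gt_zero by (intro mult_mono) auto
    thus ?thesis using pi_gt3 by simp
  qed
  ultimately show ?thesis by (simp add: decay_const_def gap_def)
qed

lemma block_term_nonneg: "0 \<le> block_term n k"
  by (simp add: block_term_def)

lemma block_term_le: "block_term n k \<le> exp (- 4 * pi) ^ k"
proof -
  have "block_term n k \<le> exp (- 4 * pi * real k) * 1"
    unfolding block_term_def using decay_const_pos by (intro mult_left_mono) auto
  thus ?thesis by (simp add: exp_of_nat_mult[symmetric] algebra_simps)
qed

lemma summable_block_term: "summable (block_term n)"
proof (rule summable_comparison_test')
  show "summable (\<lambda>k. exp (- 4 * pi) ^ k)" by (intro summable_geometric) simp
  show "norm (block_term n k) \<le> exp (- 4 * pi) ^ k" for k
    using block_term_le[of n k] block_term_nonneg[of n k] by (simp only: real_norm_def abs_of_nonneg)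
qed

text \<open>Substituting t = theta (2 * pi * k + y) turns the arc into a full turn 0 \<le> y \<le> 2
  * pi, with density at most 4 * exp (- 4 * pi * k). The factor |phi|^(2n) is replaced by its upper
  bound, and \<open>spiral_block_bound\<close> handles the polynomial.\<close>

lemma block_integral_le:
  fixes a :: "nat \<Rightarrow> complex" and n N :: nat
  defines "b \<equiv> \<lambda>t. (cmod (phi (cis t) ^ n * (\<Sum>j<N. a j * phi (cis t) ^ j)))\<^sup>2"
  shows "integral {theta (2 * pi * real k)..theta (2 * pi * real (Suc k))} b
    \<le> (4 * (2 * block_const * (2 + block_const)\<^sup>2 * (2 * pi)) * (\<Sum>j<N. (cmod (a j))\<^sup>2)) * block_term n k"
proof -
  let ?\<alpha> = "2 * pi * real k"
  let ?Q = "\<Sum>j<N. (cmod (a j))\<^sup>2"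
  define T where "T y = theta (?\<alpha> + y)" for y
  define E where "E = exp (- 2 * real n * (decay_const * ((real k + 1)\<^sup>2 * exp (- 2 * pi * p * real k))))"
  have T: "T 0 = theta ?\<alpha>" "T (2 * pi) = theta (2 * pi * real (Suc k))"
    by (simp_all add: T_def algebra_simps)
  have T_range: "T ` {0..2*pi} \<subseteq> {theta ?\<alpha>..theta (2 * pi * real (Suc k))}"
    by (auto simp: T_def algebra_simps intro!: theta_mono)
  have nz: "cis t \<noteq> 1 \<and> cis t \<noteq> -1" if "t \<in> {theta ?\<alpha>..theta (2 * pi * real (Suc k))}" for t
  proof -
    have "3 * pi / 2 \<le> t" "t < 2 * pi"
      using that theta_mono[of 0 ?\<alpha>] theta_less[of "2 * pi * real (Suc k)"] theta_0 by auto
    hence "sin t < 0" by (intro sin_lt_zero) (use pi_gt_zero in linarith)+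
    thus ?thesis by (auto simp: complex_eq_iff)
  qed
  have contphi: "continuous_on {theta ?\<alpha>..theta (2 * pi * real (Suc k))} (\<lambda>t. phi (cis t))"
    by (intro continuous_on_compose2[OF phi_continuous] continuous_intros) (use nz in auto)
  hence cont: "continuous_on {theta ?\<alpha>..theta (2 * pi * real (Suc k))} b"
    unfolding b_def by (intro continuous_intros)
  have deriv: "(T has_field_derivative 4 * exp (- 2 * (?\<alpha> + y)) / (1 + exp (- 4 * (?\<alpha> + y)))) (at y within {0..2*pi})" for y
  proof -
    have "((\<lambda>y. ?\<alpha> + y) has_field_derivative 1) (at y within {0..2*pi})"
      by (auto intro!: derivative_eq_intros)
    from DERIV_chain2[OF theta_deriv this] show ?thesis unfolding T_def by simp
  qed
  have sub: "((\<lambda>y. (4 * exp (- 2 * (?\<alpha> + y)) / (1 + exp (- 4 * (?\<alpha> + y)))) *\<^sub>R b (T y)) has_integral (integral {T 0..T (2*pi)} b)) {0..2*pi}"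
    by (rule has_integral_substitution[OF _ _ T_range cont deriv]) (auto simp: T_def theta_mono)
  define hk where "hk y = h (?\<alpha> + y)" for y
  define S where "S y = (cmod (\<Sum>j<N. a j * (of_real (exp (- hk y)) * cis y) ^ j))\<^sup>2" for y
  have conthk: "continuous_on A hk" for A unfolding hk_def
    by (intro continuous_on_compose2[OF continuous_on_h[of UNIV]] continuous_intros) auto
  have cisk: "cis (?\<alpha> + y) = cis y" for y
    using cis_multiple_2pi[of "of_nat k"] by (simp add: cis_mult[symmetric])
  have bT: "b (T y) = exp (- 2 * real n * hk y) * S y" for y
  proof -
    have ph: "phi (cis (T y)) = of_real (exp (- hk y)) * cis y"
      unfolding T_def cis_theta phi_lower_arc cisk hk_def ..
    show ?thesis unfolding b_def ph S_def
      by (simp add: norm_mult norm_power power_mult_distrib exp_of_nat_mult[symmetric] exp_double[symmetric] algebra_simps)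
  qed
  have wle: "(4 * exp (- 2 * (?\<alpha> + y)) / (1 + exp (- 4 * (?\<alpha> + y)))) *\<^sub>R b (T y) \<le> (4 * exp (- 4 * pi * real k) * E) * S y"
    if y: "y \<in> {0..2*pi}" for y
  proof -
    have "4 * exp (- 2 * (?\<alpha> + y)) / (1 + exp (- 4 * (?\<alpha> + y))) \<le> 4 * exp (- 2 * (?\<alpha> + y)) / 1"
      by (intro divide_left_mono) (auto simp: add_pos_pos)
    also have "\<dots> \<le> 4 * exp (- 4 * pi * real k)" using y by simp
    finally have 1: "4 * exp (- 2 * (?\<alpha> + y)) / (1 + exp (- 4 * (?\<alpha> + y))) \<le> 4 * exp (- 4 * pi * real k)" .
    have "decay_const * ((real k + 1)\<^sup>2 * exp (- 2 * pi * p * real k)) \<le> hk y"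
      unfolding hk_def decay_const_def using y by (intro h_lower_block) auto
    hence "real n * (decay_const * ((real k + 1)\<^sup>2 * exp (- 2 * pi * p * real k))) \<le> real n * hk y"
      by (rule mult_left_mono) simp
    hence 2: "exp (- 2 * real n * hk y) \<le> E" unfolding E_def by simp
    have "(4 * exp (- 2 * (?\<alpha> + y)) / (1 + exp (- 4 * (?\<alpha> + y)))) * (exp (- 2 * real n * hk y) * S y)
       \<le> (4 * exp (- 4 * pi * real k)) * (E * S y)"
      using 1 2 by (intro mult_mono mult_right_mono) (auto simp: S_def)
    thus ?thesis by (simp add: bT mult.assoc)
  qed
  have contS: "continuous_on {0..2*pi} S" unfolding S_def by (intro continuous_intros conthk)
  have "integral {theta ?\<alpha>..theta (2 * pi * real (Suc k))} b
     \<le> integral {0..2*pi} (\<lambda>y. (4 * exp (- 4 * pi * real k) * E) * S y)"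
    unfolding T[symmetric] integral_unique[OF sub, symmetric]
    by (intro integral_le wle has_integral_integrable[OF sub] integrable_continuous_interval continuous_intros contS)
  also have "\<dots> = (4 * exp (- 4 * pi * real k) * E) * integral {0..2*pi} S" by simp
  also have "integral {0..2*pi} S \<le> 2 * block_const * (2 + block_const)\<^sup>2 * (2 * pi * ?Q)"
    unfolding S_def
    by (intro spiral_block_bound conthk block_const_ge_1) (auto simp: hk_def h_pos intro!: h_compare add_nonneg_nonneg mult_nonneg_nonneg)
  finally show ?thesis by (simp add: block_term_def E_def mult_ac mult_left_mono)
qed

text \<open>The first summand is the length of the far arc times the pointwise polynomial bound at
  radius exp (- gap); the second collects the constants of a single turn.\<close>

definition embed_const :: real where
  "embed_const = 3 * pi / 2 / (1 - exp (- gap)) + 4 * (2 * block_const * (2 + block_const)\<^sup>2 * (2 * pi))"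

lemma embed_const_nonneg: "0 \<le> embed_const"
  using gap_pos block_const_ge_1 by (auto simp: embed_const_def intro!: add_nonneg_nonneg divide_nonneg_nonneg mult_nonneg_nonneg)

text \<open>The integrand is set to 0 at the angles of 1 and -1, where the symbol is not controlled.
  The interval is cut into the far arc, K turns and a remainder, and the remainder vanishes as K
  grows.\<close>

lemma boundary_integral_le:
  fixes a :: "nat \<Rightarrow> complex" and n N :: nat
  defines "b \<equiv> \<lambda>t. if t \<in> {0, pi, 2*pi} then 0 else (cmod (phi (cis t) ^ n * (\<Sum>j<N. a j * phi (cis t) ^ j)))\<^sup>2"
  assumes int: "b integrable_on {0..2*pi}"
  shows "integral {0..2*pi} b \<le> embed_const * block_sum n * (\<Sum>j<N. (cmod (a j))\<^sup>2)"
proof -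
  let ?Q = "\<Sum>j<N. (cmod (a j))\<^sup>2"
  let ?g = "\<lambda>w. \<Sum>j<N. a j * w ^ j"
  define c where "c t = (cmod (phi (cis t) ^ n * ?g (phi (cis t))))\<^sup>2" for t
  define B where "B = 4 * (2 * block_const * (2 + block_const)\<^sup>2 * (2 * pi))"
  define M where "M = (\<Sum>j<N. cmod (a j))\<^sup>2"
  have Q0: "0 \<le> ?Q" by (intro sum_nonneg) auto
  have B0: "0 \<le> B" using block_const_ge_1 by (simp add: B_def)
  have M0: "0 \<le> M" by (simp add: M_def)
  have nz: "cis t \<noteq> 1 \<and> cis t \<noteq> -1" if "t \<in> {0..2*pi}" "t \<notin> {0, pi, 2*pi}" for t
  proof -
    have "sin t \<noteq> 0"
    proof (cases "t < pi")
      case True thus ?thesis using that sin_gt_zero[of t] by auto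
    next
      case False thus ?thesis using that sin_lt_zero[of t] by auto
    qed
    thus ?thesis by (auto simp: complex_eq_iff)
  qed
  have bM: "b t \<le> M" if t: "t \<in> {0..2*pi}" for t
  proof (cases "t \<in> {0, pi, 2*pi}")
    case False
    have n1: "cmod (phi (cis t)) \<le> 1" using phi_norm_less_1[of "cis t"] nz[OF t False] by simp
    have "cmod (?g (phi (cis t))) \<le> (\<Sum>j<N. cmod (a j))"
      using n1 by (intro order_trans[OF norm_sum] sum_mono) (auto simp: norm_mult norm_power mult_left_le power_le_one)
    hence "cmod (phi (cis t) ^ n * ?g (phi (cis t))) \<le> 1 * (\<Sum>j<N. cmod (a j))"
      unfolding norm_mult using n1 by (intro mult_mono) (auto simp: norm_power power_le_one)
    thus ?thesis using False by (auto simp: b_def M_def intro!: power_mono)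
  qed (use M0 in \<open>auto simp: b_def\<close>)
  have far: "b t \<le> exp (- 2 * real n * gap) * (?Q / (1 - exp (- gap)))" if t: "t \<in> {0..3*pi/2}" for t
  proof (cases "t \<in> {0, pi, 2*pi}")
    case True
    thus ?thesis using Q0 gap_pos by (auto simp: b_def intro!: mult_nonneg_nonneg divide_nonneg_nonneg)
  next
    case False
    have t': "t \<in> {0..2*pi}" using t by auto
    have "Re (cis t) \<le> 0 \<or> 0 < Im (cis t)"
    proof (cases "t < pi")
      case True thus ?thesis using t False sin_gt_zero[of t] by auto
    next
      case F: False
      have "cos (t - pi) \<ge> 0" using t F by (intro cos_ge_zero) auto
      thus ?thesis by simp
    qed
    hence ph: "cmod (phi (cis t)) \<le> exp (- gap)"
      using nz[OF t' False] by (intro phi_far_arc) auto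
    have lt1: "cmod (phi (cis t)) < 1" using ph gap_pos by (meson exp_less_one_iff neg_less_0_iff_less order_le_less_trans)
    have "(cmod (?g (phi (cis t))))\<^sup>2 \<le> ?Q / (1 - cmod (phi (cis t)))"
      by (rule polynomial_norm_sq_le[OF lt1])
    also have "\<dots> \<le> ?Q / (1 - exp (- gap))"
      using ph lt1 gap_pos Q0 by (intro divide_left_mono mult_pos_pos) auto
    finally have 1: "(cmod (?g (phi (cis t))))\<^sup>2 \<le> ?Q / (1 - exp (- gap))" .
    have "(cmod (phi (cis t)) ^ n)\<^sup>2 \<le> (exp (- gap) ^ n)\<^sup>2" using ph by (intro power_mono) auto
    also have "\<dots> = exp (- 2 * real n * gap)" by (simp add: exp_of_nat_mult[symmetric] exp_double[symmetric] algebra_simps)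
    finally have 2: "(cmod (phi (cis t)) ^ n)\<^sup>2 \<le> exp (- 2 * real n * gap)" .
    have "b t = (cmod (phi (cis t)) ^ n)\<^sup>2 * (cmod (?g (phi (cis t))))\<^sup>2"
      using False by (simp add: b_def norm_mult norm_power power_mult_distrib)
    also have "\<dots> \<le> exp (- 2 * real n * gap) * (?Q / (1 - exp (- gap)))"
      using 1 2 by (intro mult_mono) auto
    finally show ?thesis .
  qed
  have int': "b integrable_on {s..t}" if "0 \<le> s" "t \<le> 2*pi" for s t
    by (rule integrable_on_subinterval[OF int]) (use that in auto)
  have th: "3 * pi / 2 \<le> theta (2 * pi * real k)" for k
    using theta_mono[of 0 "2 * pi * real k"] theta_0 by simp
  have th0: "0 \<le> theta (2 * pi * real k)" for k using th[of k] pi_gt_zero by linarith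
  have I1: "integral {0..3*pi/2} b \<le> integral {0..3*pi/2} (\<lambda>t. exp (- 2 * real n * gap) * (?Q / (1 - exp (- gap))))"
    by (intro integral_le int' far integrable_const_ivl) auto
  have blocks: "integral {3*pi/2..theta (2 * pi * real K)} b \<le> B * ?Q * (\<Sum>k<K. block_term n k)" for K
  proof (induction K)
    case 0 thus ?case by (simp add: theta_0)
  next
    case (Suc K)
    have le: "theta (2 * pi * real K) \<le> theta (2 * pi * real (Suc K))" by (intro theta_mono) simp
    have "integral {theta (2 * pi * real K)..theta (2 * pi * real (Suc K))} b
       = integral {theta (2 * pi * real K)..theta (2 * pi * real (Suc K))} c"
    proof (rule integral_cong)
      fix t assume t: "t \<in> {theta (2 * pi * real K)..theta (2 * pi * real (Suc K))}"
      have "3 * pi / 2 \<le> t" "t < 2 * pi" using t th[of K] theta_less[of "2 * pi * real (Suc K)"] by auto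
      hence "t \<noteq> 0" "t \<noteq> pi" "t \<noteq> 2 * pi" using pi_gt_zero by linarith+
      thus "b t = c t" by (simp add: b_def c_def)
    qed
    also have "\<dots> \<le> (B * ?Q) * block_term n K" unfolding c_def B_def by (rule block_integral_le)
    finally have *: "integral {theta (2 * pi * real K)..theta (2 * pi * real (Suc K))} b \<le> (B * ?Q) * block_term n K" .
    have "integral {3*pi/2..theta (2 * pi * real (Suc K))} b = integral {3*pi/2..theta (2 * pi * real K)} b
      + integral {theta (2 * pi * real K)..theta (2 * pi * real (Suc K))} b"
      by (rule Henstock_Kurzweil_Integration.integral_combine[symmetric, OF th le int']) (use theta_less[of "2 * pi * real (Suc K)"] in auto)
    with * Suc.IH show ?case by (simp add: distrib_left)
  qed
  \<comment> \<open>The crude bound \<open>M\<close> depends on the polynomial, which does no harm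
    because the interval shrinks to a point.\<close>
  have tail: "integral {theta (2 * pi * real K)..2*pi} b \<le> M * (2 * pi - theta (2 * pi * real K))" for K
  proof -
    have "integral {theta (2 * pi * real K)..2*pi} b \<le> integral {theta (2 * pi * real K)..2*pi} (\<lambda>t. M)"
      using th0[of K] by (intro integral_le int' bM integrable_const_ivl) auto
    thus ?thesis using theta_less[of "2 * pi * real K"] by (simp add: mult.commute)
  qed
  have tot: "integral {0..2*pi} b \<le> (3 * pi / 2 / (1 - exp (- gap))) * block_sum n * ?Q + B * ?Q * block_sum n + M * (2 * pi - theta (2 * pi * real K))" for K
  proof -
    have "integral {0..2*pi} b = integral {0..3*pi/2} b + integral {3*pi/2..2*pi} b"
      by (intro Henstock_Kurzweil_Integration.integral_combine[symmetric] int') auto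
    also have "integral {3*pi/2..2*pi} b = integral {3*pi/2..theta (2 * pi * real K)} b + integral {theta (2 * pi * real K)..2*pi} b"
      using th[of K] theta_less[of "2 * pi * real K"]
      by (intro Henstock_Kurzweil_Integration.integral_combine[symmetric] int') (auto intro: less_imp_le)
    also have "integral {0..3*pi/2} b \<le> (3 * pi / 2 / (1 - exp (- gap))) * exp (- 2 * real n * gap) * ?Q"
      using I1 by (simp add: mult_ac)
    also have "\<dots> \<le> (3 * pi / 2 / (1 - exp (- gap))) * block_sum n * ?Q"
    proof -
      have "real n * decay_const \<le> real n * gap" using decay_const_le_gap by (intro mult_left_mono) auto
      hence "exp (- 2 * real n * gap) \<le> block_term n 0" by (simp add: block_term_def)
      also have "\<dots> \<le> block_sum n"
        unfolding block_sum_def using sum_le_suminf[OF summable_block_term, of "{0}" n] block_term_nonneg by simp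
      finally show ?thesis using Q0 gap_pos
        by (intro mult_right_mono mult_left_mono) (auto intro!: divide_nonneg_nonneg)
    qed
    also have "integral {3*pi/2..theta (2 * pi * real K)} b \<le> B * ?Q * block_sum n"
    proof -
      have "(\<Sum>k<K. block_term n k) \<le> block_sum n"
        unfolding block_sum_def by (intro sum_le_suminf summable_block_term) (auto simp: block_term_nonneg)
      thus ?thesis using blocks[of K] B0 Q0 by (meson mult_left_mono mult_nonneg_nonneg order_trans)
    qed
    finally show ?thesis using tail[of K] by simp
  qed
  have lim: "(\<lambda>K. (3 * pi / 2 / (1 - exp (- gap))) * block_sum n * ?Q + B * ?Q * block_sum n + M * (2 * pi - theta (2 * pi * real K)))
     \<longlonglongrightarrow> (3 * pi / 2 / (1 - exp (- gap))) * block_sum n * ?Q + B * ?Q * block_sum n + M * (2 * pi - 2 * pi)"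
    by (intro tendsto_intros theta_tendsto)
  have "integral {0..2*pi} b \<le> (3 * pi / 2 / (1 - exp (- gap))) * block_sum n * ?Q + B * ?Q * block_sum n + M * (2 * pi - 2 * pi)"
    using LIMSEQ_le_const[OF lim] tot by blast
  also have "\<dots> = embed_const * block_sum n * ?Q"
    by (simp add: embed_const_def B_def algebra_simps)
  finally show ?thesis .
qed

text \<open>Bessel's inequality on circles of radius \<open>r < 1\<close>, and dominated convergence as \<open>r\<close> tends to 1.\<close>

lemma composed_polynomial_coefficients:
  fixes a :: "nat \<Rightarrow> complex" and n N :: nat
  defines "G \<equiv> \<lambda>z. phi z ^ n * (\<Sum>j<N. a j * phi z ^ j)"
  shows "(\<Sum>k<m. (cmod ((deriv ^^ k) G 0 / fact k))\<^sup>2) \<le> embed_const * block_sum n * (\<Sum>j<N. (cmod (a j))\<^sup>2)"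
proof -
  let ?Q = "\<Sum>j<N. (cmod (a j))\<^sup>2"
  define M where "M = (\<Sum>j<N. cmod (a j))\<^sup>2"
  define r where "r i = 1 - 1 / real (i + 2)" for i
  define f where "f i t = (if t \<in> {0, pi, 2*pi} then 0 else (cmod (G (of_real (r i) * cis t)))\<^sup>2)" for i t
  define b where "b t = (if t \<in> {0, pi, 2*pi} then 0 else (cmod (G (cis t)))\<^sup>2)" for t
  define d where "d k = (deriv ^^ k) G 0 / fact k" for k
  have r: "0 < r i" "r i < 1" for i by (auto simp: r_def divide_less_eq)
  have r_lim: "r \<longlonglongrightarrow> 1"
  proof -
    have "(\<lambda>i. 1 - 1 / real (i + 2)) \<longlonglongrightarrow> 1 - 0"
      using LIMSEQ_ignore_initial_segment[OF lim_1_over_n, of 2] by (intro tendsto_intros) simp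
    thus ?thesis by (simp add: r_def[abs_def])
  qed
  have holG: "G holomorphic_on ball 0 1" unfolding G_def by (intro holomorphic_intros phi_holomorphic)
  have contG: "continuous_on (cball 0 1 - {1, -1}) G" unfolding G_def by (intro continuous_intros phi_continuous)
  have bound: "(cmod (G z))\<^sup>2 \<le> M" if "cmod z < 1" for z
  proof -
    have "z \<noteq> 1" "z \<noteq> -1" using that by auto
    hence n1: "cmod (phi z) \<le> 1" using phi_norm_less_1[of z] that by auto
    have "cmod (\<Sum>j<N. a j * phi z ^ j) \<le> (\<Sum>j<N. cmod (a j))"
      using n1 by (intro order_trans[OF norm_sum] sum_mono) (auto simp: norm_mult norm_power mult_left_le power_le_one)
    hence "cmod (G z) \<le> 1 * (\<Sum>j<N. cmod (a j))"
      unfolding G_def norm_mult using n1 by (intro mult_mono) (auto simp: norm_power power_le_one)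
    thus ?thesis by (auto simp: M_def intro!: power_mono)
  qed
  have rz: "cmod (of_real (r i) * cis t) < 1" for i t using r[of i] by (simp add: norm_mult)
  have cont_i: "continuous_on {0..2*pi} (\<lambda>t. (cmod (G (of_real (r i) * cis t)))\<^sup>2)" for i
    using r[of i] by (intro continuous_intros continuous_on_circle[OF holG]) auto
  have neg: "negligible {0, pi, 2*pi}" by (intro negligible_finite) auto
  have f_int: "f i integrable_on {0..2*pi}" for i
    by (rule integrable_spike[OF integrable_continuous_interval[OF cont_i[of i]] neg]) (auto simp: f_def)
  have f_eq: "integral {0..2*pi} (f i) = integral {0..2*pi} (\<lambda>t. (cmod (G (of_real (r i) * cis t)))\<^sup>2)" for i
    by (rule integral_spike[OF neg]) (auto simp: f_def)
  have conv: "(\<lambda>i. f i t) \<longlonglongrightarrow> b t" if t: "t \<in> {0..2*pi}" for t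
  proof (cases "t \<in> {0, pi, 2*pi}")
    case False
    have "sin t \<noteq> 0"
    proof (cases "t < pi")
      case True thus ?thesis using t False sin_gt_zero[of t] by auto
    next
      case F: False thus ?thesis using t False sin_lt_zero[of t] by auto
    qed
    hence ne: "cis t \<in> cball 0 1 - {1, -1}" by (auto simp: complex_eq_iff)
    have "of_real (r i) * cis t \<in> cball 0 1 - {1, -1}" for i
    proof -
      have "cmod (of_real (r i) * cis t) \<noteq> 1" using rz[of i t] by simp
      moreover have "cmod (of_real (r i) * cis t) \<le> 1" using rz[of i t] by simp
      ultimately show ?thesis by auto
    qed
    moreover have "(\<lambda>i. of_real (r i) * cis t) \<longlonglongrightarrow> of_real 1 * cis t"
      by (intro tendsto_intros r_lim)
    ultimately have "(\<lambda>i. G (of_real (r i) * cis t)) \<longlonglongrightarrow> G (cis t)"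
      using contG ne unfolding continuous_on_sequentially by (auto simp: o_def)
    thus ?thesis using False by (simp add: f_def b_def tendsto_intros)
  qed (auto simp: f_def b_def)
  have dom: "norm (f i t) \<le> M" if "t \<in> {0..2*pi}" for i t
    using bound[OF rz[of i t]] by (auto simp: f_def M_def)
  have dc: "b integrable_on {0..2*pi}" "(\<lambda>i. integral {0..2*pi} (f i)) \<longlonglongrightarrow> integral {0..2*pi} b"
    by (rule dominated_convergence[OF f_int integrable_const_ivl dom conv]; assumption)+
  have int_b: "integral {0..2*pi} b \<le> embed_const * block_sum n * ?Q"
    using dc(1) unfolding b_def G_def by (rule boundary_integral_le)
  have lim: "(\<lambda>i. 2 * pi * (\<Sum>k<m. (cmod (d k * of_real (r i) ^ k))\<^sup>2)) \<longlonglongrightarrow> 2 * pi * (\<Sum>k<m. (cmod (d k * of_real 1 ^ k))\<^sup>2)"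
    by (intro tendsto_intros r_lim)
  have le: "2 * pi * (\<Sum>k<m. (cmod (d k * of_real (r i) ^ k))\<^sup>2) \<le> integral {0..2*pi} (f i)" for i
    unfolding f_eq d_def using r[of i] by (intro circle_bessel[OF holG]) auto
  have "2 * pi * (\<Sum>k<m. (cmod (d k * of_real 1 ^ k))\<^sup>2) \<le> integral {0..2*pi} b"
    by (rule LIMSEQ_le[OF lim dc(2)]) (use le in blast)
  hence "2 * pi * (\<Sum>k<m. (cmod (d k))\<^sup>2) \<le> embed_const * block_sum n * ?Q" using int_b by simp
  moreover have "1 * (\<Sum>k<m. (cmod (d k))\<^sup>2) \<le> 2 * pi * (\<Sum>k<m. (cmod (d k))\<^sup>2)"
    using pi_gt3 by (intro mult_right_mono sum_nonneg) auto
  ultimately show ?thesis unfolding d_def by simp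
qed

end

section \<open>Decay of the embedding constants\<close>

text \<open>Condensation leaves 1 / (1 + n * ln 2)^2. The 1 next to the logarithm keeps the
  denominator positive at n = 1; the term at n = 0 is a division by zero with value 0.\<close>

lemma summable_inverse_n_log_squared:
  "summable (\<lambda>n. 1 / (real n * (1 + ln (real n))\<^sup>2))"
proof -
  define f where "f n = 1 / (real n * (1 + ln (real n))\<^sup>2)" for n
  have "summable f \<longleftrightarrow> summable (\<lambda>n. 2 ^ n * f (2 ^ n))"
  proof (rule condensation_test)
    show "f (Suc m) \<le> f m" if "0 < m" for m
    proof -
      have "0 \<le> ln (real m)" using that by simp
      moreover have "ln (real m) \<le> ln (real (Suc m))" using that by simp
      ultimately have le: "real m * (1 + ln (real m))\<^sup>2 \<le> real (Suc m) * (1 + ln (real (Suc m)))\<^sup>2"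
        by (intro mult_mono power_mono) auto
      have "0 < 1 + ln (real m)" using \<open>0 \<le> ln (real m)\<close> by linarith
      hence pos: "0 < real m * (1 + ln (real m))\<^sup>2" using that by (intro mult_pos_pos zero_less_power) simp_all
      show ?thesis unfolding f_def by (rule frac_le[OF zero_le_one order_refl pos le])
    qed
  qed (simp add: f_def)
  moreover have "summable (\<lambda>n. 2 ^ n * f (2 ^ n))"
  proof (rule summable_comparison_test')
    show "summable (\<lambda>n. 4 * inverse (real (Suc n) ^ 2))"
    proof (rule summable_mult)
      have "summable (\<lambda>n. inverse (real n ^ 2))" by (rule inverse_power_summable) simp
      thus "summable (\<lambda>n. inverse (real (Suc n) ^ 2))" using summable_Suc_iff[of "\<lambda>n. inverse (real n ^ 2)"] by blast
    qed
    fix n :: nat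
    have ln2: "1 / 2 \<le> ln (2::real)" using ln_le_minus_one[of "1 / 2 :: real"] by (simp add: ln_div)
    have "2 ^ n * f (2 ^ n) = 1 / (1 + real n * ln 2)\<^sup>2"
      by (simp add: f_def ln_realpow)
    also have "\<dots> \<le> 1 / ((real n + 1) / 2)\<^sup>2"
    proof (intro divide_left_mono power_mono)
      have "real n * (1 / 2) \<le> real n * ln 2" using ln2 by (intro mult_left_mono) auto
      thus "(real n + 1) / 2 \<le> 1 + real n * ln 2" by simp
      thus "0 < (1 + real n * ln 2)\<^sup>2 * ((real n + 1) / 2)\<^sup>2"
        by (smt (verit) mult_pos_pos of_nat_0_le_iff zero_less_power half_gt_zero)
    qed auto
    also have "\<dots> = 4 * inverse (real (Suc n) ^ 2)" by (simp add: field_simps power2_eq_square)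
    finally show "norm (2 ^ n * f (2 ^ n)) \<le> 4 * inverse (real (Suc n) ^ 2)"
      by (simp add: f_def)
  qed
  ultimately show ?thesis unfolding f_def[abs_def] by blast
qed

context spiral_symbol
begin

text \<open>For \<open>n\<close> about \<open>level j\<close>, the \<open>j\<close>-th turn of the spiral has distance about \<open>1 / n\<close> from the circle.\<close>

definition level :: "nat \<Rightarrow> real" where
  "level j = exp (2 * pi * p * real j) / (real j + 1)\<^sup>2"

text \<open>Relative to exp (- 4 * pi * j), the contribution of the turn i steps before the j-th:
  its arc is longer by exp (4 * pi * i), but |phi|^(2n) is exponentially small in
  \<open>level i\<close>.\<close>

definition block_weight :: "nat \<Rightarrow> real" where
  "block_weight i = exp (4 * pi * real i) * exp (- 2 * decay_const * level i)"

lemma exp_ge_fourth_power: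
  fixes y :: real assumes "0 \<le> y"
  shows "(1 + y / 4) ^ 4 \<le> exp y"
proof -
  have "(1 + y / 4) ^ 4 \<le> exp (y / 4) ^ 4"
    using assms exp_ge_add_one_self[of "y / 4"] by (intro power_mono) auto
  also have "\<dots> = exp (of_nat 4 * (y / 4))" by (rule exp_of_nat_mult[symmetric])
  finally show ?thesis by simp
qed

text \<open>The exponential dominates a fourth power, so division by (i + 1)^2 leaves quadratic
  growth, enough to beat the linear exponent 4 * pi * i in \<open>block_weight\<close>.\<close>

lemma level_ge: "(min 1 (pi * p / 2)) ^ 4 * (real i + 1)\<^sup>2 \<le> level i"
proof -
  let ?\<kappa> = "min 1 (pi * p / 2)"
  have k0: "0 < ?\<kappa>" using p by simp
  have "?\<kappa> * (real i + 1) \<le> 1 + (2 * pi * p * real i) / 4"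
  proof -
    have "?\<kappa> * real i \<le> pi * p / 2 * real i" by (intro mult_right_mono) auto
    also have "\<dots> = (2 * pi * p * real i) / 4" by simp
    finally have "?\<kappa> * real i \<le> (2 * pi * p * real i) / 4" .
    moreover have "?\<kappa> \<le> 1" by simp
    ultimately show ?thesis by (simp only: distrib_left mult_1_right)
  qed
  hence "(?\<kappa> * (real i + 1)) ^ 4 \<le> (1 + (2 * pi * p * real i) / 4) ^ 4"
    using k0 by (intro power_mono mult_nonneg_nonneg) auto
  also have "\<dots> \<le> exp (2 * pi * p * real i)" using p by (intro exp_ge_fourth_power) auto
  finally have "?\<kappa> ^ 4 * ((real i + 1)\<^sup>2 * (real i + 1)\<^sup>2) \<le> exp (2 * pi * p * real i)"
    by (simp only: power_mult_distrib power_add[symmetric]) simp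
  thus ?thesis unfolding level_def by (simp add: le_divide_eq mult.assoc)
qed

lemma summable_block_weight: "summable block_weight"
proof -
  define \<beta> where "\<beta> = 2 * decay_const * (min 1 (pi * p / 2)) ^ 4"
  have "0 < min 1 (pi * p / 2)" using p by simp
  hence b0: "0 < \<beta>" unfolding \<beta>_def using decay_const_pos by (intro mult_pos_pos zero_less_power) auto
  \<comment> \<open>From completing the square; 4 * pi + 1 instead of 4 * pi saves a factor exp (-
    i) for the geometric series.\<close>
  define D where "D = (4 * pi + 1)\<^sup>2 / (4 * \<beta>)"
  have le: "block_weight i \<le> exp D * exp (- 1) ^ i" for i
  proof -
    have "\<beta> * (real i + 1)\<^sup>2 \<le> 2 * decay_const * level i"
      using mult_left_mono[OF level_ge[of i], of "2 * decay_const"] decay_const_pos by (simp add: \<beta>_def mult.assoc)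
    moreover have "(4 * pi + 1) * real i \<le> \<beta> * (real i)\<^sup>2 + D"
    proof -
      have "0 \<le> \<beta> * (real i - (4 * pi + 1) / (2 * \<beta>))\<^sup>2" using b0 by simp
      also have "\<dots> = \<beta> * (real i)\<^sup>2 + D - (4 * pi + 1) * real i"
        using b0 unfolding D_def by (simp add: power2_diff power_divide) (simp add: field_simps power2_eq_square)
      finally show ?thesis by simp
    qed
    moreover have "\<beta> * (real i)\<^sup>2 \<le> \<beta> * (real i + 1)\<^sup>2" using b0 by (intro mult_left_mono power_mono) auto
    ultimately have "4 * pi * real i - 2 * decay_const * level i \<le> D - real i" by (simp add: algebra_simps)
    hence "exp (4 * pi * real i - 2 * decay_const * level i) \<le> exp (D - real i)" by simp
    thus ?thesis by (simp add: block_weight_def exp_diff exp_minus exp_of_nat_mult[symmetric] divide_inverse power_inverse)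
  qed
  have "summable (\<lambda>i. exp D * exp (- 1) ^ i)"
    by (intro summable_mult summable_geometric) simp
  moreover have "norm (block_weight i) \<le> exp D * exp (- 1) ^ i" for i
    using le[of i] by (simp only: block_weight_def real_norm_def abs_mult abs_exp_cancel)
  ultimately show ?thesis by (rule summable_comparison_test')
qed

definition block_sum_const :: real where
  "block_sum_const = suminf block_weight + suminf (\<lambda>k. exp (- 4 * pi) ^ k)"

lemma block_weight_nonneg: "0 \<le> block_weight i" by (simp add: block_weight_def)

text \<open>Turns from the j-th on are summed by their lengths alone. Earlier turns are longer but
  lie deeper in the disc, and \<open>block_weight\<close> measures that damping.\<close>

lemma block_sum_le:
  assumes "level j \<le> real n"
  shows "block_sum n \<le> block_sum_const * exp (- 4 * pi * real j)"
proof -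
  let ?q = "exp (- 4 * pi)"
  have near: "block_term n k \<le> exp (- 4 * pi * real j) * block_weight (j - k)" if "k \<le> j" for k
  proof -
    define i where "i = j - k"
    have ji: "real j = real i + real k" using that by (simp add: i_def)
    \<comment> \<open>Because of j + 1 \<le> (i + 1) * (k + 1) for j = i + k, \<open>level\<close>
      behaves like an exponential up to the factor (k + 1)^2.\<close>
    have "(real j + 1)\<^sup>2 \<le> ((real i + 1) * (real k + 1))\<^sup>2"
      unfolding ji by (intro power_mono) (auto simp: algebra_simps)
    hence "level i * (real j + 1)\<^sup>2 \<le> level i * ((real i + 1)\<^sup>2 * (real k + 1)\<^sup>2)"
      by (intro mult_left_mono) (auto simp: level_def power_mult_distrib)
    also have "\<dots> = exp (2 * pi * p * real i) * (real k + 1)\<^sup>2" by (simp add: level_def)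
    finally have "level i \<le> exp (2 * pi * p * real i) * (real k + 1)\<^sup>2 / (real j + 1)\<^sup>2"
      by (simp add: le_divide_eq)
    also have "\<dots> = level j * ((real k + 1)\<^sup>2 * exp (- 2 * pi * p * real k))"
      by (simp add: level_def ji algebra_simps exp_add[symmetric] exp_minus exp_diff) (simp add: field_simps exp_add)
    also have "\<dots> \<le> real n * ((real k + 1)\<^sup>2 * exp (- 2 * pi * p * real k))"
      using assms by (intro mult_right_mono) auto
    finally have "2 * decay_const * level i \<le> 2 * decay_const * (real n * ((real k + 1)\<^sup>2 * exp (- 2 * pi * p * real k)))"
      using decay_const_pos by (intro mult_left_mono) auto
    hence "exp (- 2 * real n * (decay_const * ((real k + 1)\<^sup>2 * exp (- 2 * pi * p * real k)))) \<le> exp (- 2 * decay_const * level i)"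
      by (simp add: mult_ac)
    hence "block_term n k \<le> exp (- 4 * pi * real k) * exp (- 2 * decay_const * level i)"
      unfolding block_term_def by (intro mult_left_mono) auto
    also have "exp (- 4 * pi * real k) = exp (- 4 * pi * real j) * exp (4 * pi * real i)"
      by (simp add: ji exp_add[symmetric] algebra_simps)
    finally show ?thesis by (simp add: block_weight_def i_def mult.assoc)
  qed
  have s: "summable (\<lambda>k. ?q ^ k)" by (intro summable_geometric) simp
  have "block_sum n = (\<Sum>k. block_term n (k + j)) + (\<Sum>k<j. block_term n k)"
    unfolding block_sum_def by (rule suminf_split_initial_segment[OF summable_block_term])
  also have "(\<Sum>k. block_term n (k + j)) \<le> (\<Sum>k. exp (- 4 * pi * real j) * ?q ^ k)"
  proof (intro suminf_le summable_mult s)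
    show "summable (\<lambda>k. block_term n (k + j))" using summable_block_term by (rule summable_ignore_initial_segment)
    show "block_term n (k + j) \<le> exp (- 4 * pi * real j) * ?q ^ k" for k
    proof -
      have "block_term n (k + j) \<le> ?q ^ (k + j)" by (rule block_term_le)
      also have "\<dots> = ?q ^ j * ?q ^ k" by (simp add: power_add)
      also have "?q ^ j = exp (- 4 * pi * real j)" by (simp add: exp_of_nat_mult[symmetric] algebra_simps)
      finally show ?thesis .
    qed
  qed
  also have "\<dots> = exp (- 4 * pi * real j) * (\<Sum>k. ?q ^ k)" by (rule suminf_mult[OF s])
  also have "(\<Sum>k<j. block_term n k) \<le> (\<Sum>k<j. exp (- 4 * pi * real j) * block_weight (j - k))"
    by (intro sum_mono near) auto
  also have "\<dots> = exp (- 4 * pi * real j) * (\<Sum>k<j. block_weight (j - k))" by (simp add: sum_distrib_left)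
  also have "(\<Sum>k<j. block_weight (j - k)) = (\<Sum>i\<in>{1..j}. block_weight i)"
    by (rule sum.reindex_bij_witness[of _ "\<lambda>i. j - i" "\<lambda>k. j - k"]) auto
  also have "\<dots> \<le> suminf block_weight"
    by (intro sum_le_suminf summable_block_weight) (auto simp: block_weight_nonneg)
  finally show ?thesis by (simp add: block_sum_const_def algebra_simps)
qed

text \<open>For small p \<open>level\<close> decreases at first, so j is the least index for which n
  lies below the next level; the case j = 0 is covered by \<open>level 0 = 1\<close>.\<close>

lemma level_exists:
  assumes "1 \<le> n"
  obtains j where "level j \<le> real n" "real n < level (Suc j)"
proof -
  define P where "P j \<longleftrightarrow> real n < level (Suc j)" for j
  let ?\<kappa> = "(min 1 (pi * p / 2)) ^ 4"
  have k0: "0 < ?\<kappa>" using p by (intro zero_less_power) simp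
  have "\<exists>j. P j"
  proof -
    obtain j where j: "real n / ?\<kappa> < real j" using reals_Archimedean2 by blast
    have "real j \<le> (real (Suc j) + 1)\<^sup>2" by (simp add: power2_eq_square algebra_simps)
    hence "?\<kappa> * real j \<le> ?\<kappa> * (real (Suc j) + 1)\<^sup>2" using k0 by (intro mult_left_mono) auto
    also have "\<dots> \<le> level (Suc j)" by (rule level_ge)
    finally have "real n < level (Suc j)" using j k0 by (simp add: divide_less_eq mult.commute)
    thus ?thesis unfolding P_def by blast
  qed
  define j where "j = (LEAST j. P j)"
  have 1: "P j" unfolding j_def using \<open>\<exists>j. P j\<close> by (rule LeastI_ex)
  have 2: "level j \<le> real n"
  proof (cases j)
    case 0
    thus ?thesis using assms by (simp add: level_def)
  next
    case (Suc i)
    hence "\<not> P i" unfolding j_def by (metis lessI not_less_Least)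
    thus ?thesis unfolding P_def Suc by simp
  qed
  show thesis using that[OF 2] 1 unfolding P_def by blast
qed

text \<open>Bounds the squared norm of the composition operator on functions with a zero of order at
  least n at the origin.\<close>

definition coeff_bound :: "nat \<Rightarrow> real" where "coeff_bound n = embed_const * block_sum n"

lemma coeff_bound_nonneg: "0 \<le> coeff_bound n"
  unfolding coeff_bound_def block_sum_def
  by (intro mult_nonneg_nonneg embed_const_nonneg suminf_nonneg summable_block_term block_term_nonneg)

text \<open>The power p / 2 turns exp (- 4 * pi * j) into exp (- 2 * pi * p * j). As n lies below
  the level j + 1, this is at most a constant over n * (j + 2)^2, and j + 2 is at least of order 1 +
  ln n.\<close>

lemma summable_coeff_bound: "summable (\<lambda>n. coeff_bound n powr (p / 2))"
proof -
  \<comment> \<open>Small enough for both a \<le> 1 and a * ln n \<le> j + 1, so that a * (1 + ln n)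
    \<le> j + 2.\<close>
  define a where "a = min 1 (1 / (2 * pi * p))"
  have a: "0 < a" "a \<le> 1" "a \<le> 1 / (2 * pi * p)" using p by (auto simp: a_def)
  define C where "C = (embed_const * block_sum_const) powr (p / 2) * exp (2 * pi * p) / a\<^sup>2"
  have main: "coeff_bound n powr (p / 2) \<le> C * (1 / (real n * (1 + ln (real n))\<^sup>2))" if n: "1 \<le> n" for n
  proof -
    obtain j where j: "level j \<le> real n" "real n < level (Suc j)" using level_exists[OF n] .
    have lnn: "0 \<le> ln (real n)" using n by simp
    have "coeff_bound n \<le> embed_const * (block_sum_const * exp (- 4 * pi * real j))"
      unfolding coeff_bound_def by (intro mult_left_mono block_sum_le j embed_const_nonneg)
    hence "coeff_bound n powr (p / 2) \<le> (embed_const * block_sum_const * exp (- 4 * pi * real j)) powr (p / 2)"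
      using p by (intro powr_mono2 coeff_bound_nonneg) (auto simp: mult.assoc)
    also have "\<dots> = (embed_const * block_sum_const) powr (p / 2) * exp (- 4 * pi * real j) powr (p / 2)"
      by (rule powr_mult)
    also have "exp (- 4 * pi * real j) powr (p / 2) = exp (2 * pi * p) * (1 / exp (2 * pi * p * real (Suc j)))"
    proof -
      have "exp (- 4 * pi * real j) powr (p / 2) = exp (p / 2 * (- 4 * pi * real j))" by (simp add: powr_def)
      also have "\<dots> = exp (2 * pi * p + - (2 * pi * p * real (Suc j)))" by (rule arg_cong) (simp add: algebra_simps)
      finally show ?thesis by (simp only: exp_add exp_minus divide_inverse mult_1_left)
    qed
    also have "(embed_const * block_sum_const) powr (p / 2) * (exp (2 * pi * p) * (1 / exp (2 * pi * p * real (Suc j))))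
        \<le> (embed_const * block_sum_const) powr (p / 2) * (exp (2 * pi * p) * (1 / (real n * (a * (1 + ln (real n)))\<^sup>2)))"
    proof (intro mult_left_mono divide_left_mono)
      have lt: "real n * (real (Suc j) + 1)\<^sup>2 < exp (2 * pi * p * real (Suc j))"
        using j(2) by (simp add: level_def less_divide_eq)
      \<comment> \<open>The level bound is first used without its square, to compare j with ln n,
        and afterwards with it.\<close>
      have "real n * 1 \<le> real n * (real (Suc j) + 1)\<^sup>2" by (intro mult_left_mono) (auto simp: one_le_power)
      hence "real n < exp (2 * pi * p * real (Suc j))" using lt by simp
      hence "ln (real n) < 2 * pi * p * real (Suc j)" using n by (metis exp_gt_zero ln_exp ln_less_cancel_iff of_nat_0_less_iff less_le_trans zero_less_one)
      hence "1 / (2 * pi * p) * ln (real n) \<le> real (Suc j)" using p by (simp add: field_simps)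
      moreover have "a * ln (real n) \<le> 1 / (2 * pi * p) * ln (real n)" using a lnn by (intro mult_right_mono) auto
      ultimately have "a * (1 + ln (real n)) \<le> real (Suc j) + 1" using a by (simp only: distrib_left)
      hence "(a * (1 + ln (real n)))\<^sup>2 \<le> (real (Suc j) + 1)\<^sup>2" using a lnn by (intro power_mono) auto
      hence "real n * (a * (1 + ln (real n)))\<^sup>2 \<le> real n * (real (Suc j) + 1)\<^sup>2" by (intro mult_left_mono) auto
      thus "real n * (a * (1 + ln (real n)))\<^sup>2 \<le> exp (2 * pi * p * real (Suc j))" using lt by linarith
      have "0 < a * (1 + ln (real n))" using a lnn by (intro mult_pos_pos) auto
      thus "0 < exp (2 * pi * p * real (Suc j)) * (real n * (a * (1 + ln (real n)))\<^sup>2)"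
        using n by (intro mult_pos_pos) auto
    qed auto
    also have "\<dots> = C * (1 / (real n * (1 + ln (real n))\<^sup>2))"
      by (simp add: C_def power_mult_distrib)
    finally show ?thesis .
  qed
  show ?thesis
  proof (rule summable_comparison_test'[where N = 1])
    show "summable (\<lambda>n. C * (1 / (real n * (1 + ln (real n))\<^sup>2)))"
      by (intro summable_mult summable_inverse_n_log_squared)
  qed (use main in auto)
qed

lemma coeff_bound_tendsto_0: "coeff_bound \<longlonglongrightarrow> 0"
proof -
  have "(\<lambda>n. coeff_bound n powr (p / 2)) \<longlonglongrightarrow> 0" by (rule summable_LIMSEQ_zero[OF summable_coeff_bound])
  hence "(\<lambda>n. (coeff_bound n powr (p / 2)) powr (2 / p)) \<longlonglongrightarrow> 0"
    by (rule tendsto_zero_powrI[OF _ tendsto_const]) (use p in auto)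
  moreover have "(coeff_bound n powr (p / 2)) powr (2 / p) = coeff_bound n" for n
    using p coeff_bound_nonneg[of n] by (simp add: powr_powr)
  ultimately show ?thesis by simp
qed

end

section \<open>Hardy space\<close>

text \<open>The last assumption stands in for the triangle inequality: it follows for both spaces
  from the same inequality for complex numbers, under the sum or under the integral.\<close>

locale function_norm =
  fixes S :: "(complex \<Rightarrow> complex) set" and N :: "(complex \<Rightarrow> complex) \<Rightarrow> real"
  assumes zero_mem: "0 \<in> S"
    and scale_mem: "f \<in> S \<Longrightarrow> cscale c f \<in> S"
    and add_mem: "f \<in> S \<Longrightarrow> g \<in> S \<Longrightarrow> f + g \<in> S"
    and norm_nonneg: "f \<in> S \<Longrightarrow> 0 \<le> N f"
    and norm_zero: "N 0 = 0"
    and norm_diff_sq: "f \<in> S \<Longrightarrow> g \<in> S \<Longrightarrow> (N (f - g))\<^sup>2 \<le> 2 * (N f)\<^sup>2 + 2 * (N g)\<^sup>2"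
begin

lemma diff_mem: "f \<in> S \<Longrightarrow> g \<in> S \<Longrightarrow> f - g \<in> S"
proof -
  assume "f \<in> S" "g \<in> S"
  hence "f + cscale (-1) g \<in> S" by (intro add_mem scale_mem)
  moreover have "f + cscale (-1) g = f - g" by (simp add: cscale_def fun_eq_iff)
  ultimately show ?thesis by simp
qed

lemma bounded_operatorD:
  assumes "bounded_operator S N T"
  shows "f \<in> S \<Longrightarrow> T f \<in> S"
    "f \<in> S \<Longrightarrow> g \<in> S \<Longrightarrow> T (f + g) = T f + T g"
    "f \<in> S \<Longrightarrow> T (cscale c f) = cscale c (T f)"
  using assms by (auto simp: bounded_operator_def)

lemma bounded_operator_0: "bounded_operator S N T \<Longrightarrow> T 0 = 0"
  using bounded_operatorD(3)[of T 0 0] zero_mem by (simp add: cscale_def zero_fun_def)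

text \<open>\<open>operator_norm\<close> is a supremum of reals and says something only for a
  bounded set; the bound comes from the quadratic inequality for differences.\<close>

lemma norm_le_operator_norm_diff:
  assumes T: "bounded_operator S N T" and R: "bounded_operator S N R" and f: "f \<in> S" "N f \<le> 1"
  shows "N (T f - R f) \<le> operator_norm S N (T - R)"
proof -
  obtain K1 where K1: "\<And>f. f \<in> S \<Longrightarrow> N (T f) \<le> K1 * N f" using T unfolding bounded_operator_def by blast
  obtain K2 where K2: "\<And>f. f \<in> S \<Longrightarrow> N (R f) \<le> K2 * N f" using R unfolding bounded_operator_def by blast
  have le: "(N (U g))\<^sup>2 \<le> K\<^sup>2" if "g \<in> S" "N g \<le> 1" "\<And>f. f \<in> S \<Longrightarrow> N (U f) \<le> K * N f" "U g \<in> S" for U K g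
  proof -
    have "N (U g) \<le> K * N g" using that by blast
    also have "\<dots> \<le> \<bar>K\<bar> * 1" using that norm_nonneg[of g] by (intro mult_mono) auto
    finally have "\<bar>N (U g)\<bar> \<le> \<bar>K\<bar>" using norm_nonneg[of "U g"] that by simp
    thus ?thesis by (simp add: abs_le_square_iff)
  qed
  have bdd: "bdd_above ((\<lambda>f. N ((T - R) f)) ` {f \<in> S. N f \<le> 1})"
  proof (rule bdd_aboveI2)
    fix g assume g: "g \<in> {f \<in> S. N f \<le> 1}"
    have "(N (T g - R g))\<^sup>2 \<le> 2 * (N (T g))\<^sup>2 + 2 * (N (R g))\<^sup>2"
      using g by (intro norm_diff_sq bounded_operatorD(1)[OF T] bounded_operatorD(1)[OF R]) auto
    also have "\<dots> \<le> 2 * K1\<^sup>2 + 2 * K2\<^sup>2"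
    proof -
      have "(N (T g))\<^sup>2 \<le> K1\<^sup>2" by (rule le[where U = T]) (use K1 g bounded_operatorD(1)[OF T] in auto)
      moreover have "(N (R g))\<^sup>2 \<le> K2\<^sup>2" by (rule le[where U = R]) (use K2 g bounded_operatorD(1)[OF R] in auto)
      ultimately show ?thesis by simp
    qed
    finally show "N ((T - R) g) \<le> sqrt (2 * K1\<^sup>2 + 2 * K2\<^sup>2)" by (simp add: real_le_rsqrt)
  qed
  have "f \<in> {f \<in> S. N f \<le> 1}" using f by simp
  from cSUP_upper[OF this bdd] show ?thesis by (simp add: operator_norm_def)
qed

lemma operator_norm_diff_nonneg:
  assumes "bounded_operator S N T" "bounded_operator S N R"
  shows "0 \<le> operator_norm S N (T - R)"
  using norm_le_operator_norm_diff[OF assms zero_mem] norm_zero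
    bounded_operator_0[OF assms(1)] bounded_operator_0[OF assms(2)] by simp

text \<open>Shows that the infimum defining \<open>approximation_number\<close> ranges over a
  nonempty set; the range {0} has the empty basis.\<close>

lemma zero_operator: "bounded_operator S N (\<lambda>f. 0)" "rank_less S (\<lambda>f. 0) (Suc n)"
proof -
  show "bounded_operator S N (\<lambda>f. 0)"
    unfolding bounded_operator_def using zero_mem norm_zero norm_nonneg
    by (auto simp: cscale_def fun_eq_iff intro!: exI[of _ 0])
  have "(\<lambda>f. 0) ` S = {0 :: complex \<Rightarrow> complex}" using zero_mem by auto
  thus "rank_less S (\<lambda>f. 0) (Suc n)"
    unfolding rank_less_def by (intro exI[of _ "{}"]) (auto simp: cfun.span_empty cfun.independent_empty)
qed

lemma approximation_number_ge:
  assumes "\<And>R. bounded_operator S N R \<Longrightarrow> rank_less S R (Suc n) \<Longrightarrow> c \<le> operator_norm S N (T - R)"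
  shows "c \<le> approximation_number S N T (Suc n)"
  unfolding approximation_number_def
  using zero_operator assms by (intro cINF_greatest) auto

lemma approximation_number_le:
  assumes T: "bounded_operator S N T" and R: "bounded_operator S N R" "rank_less S R n"
  shows "approximation_number S N T n \<le> operator_norm S N (T - R)"
  unfolding approximation_number_def
  using R by (intro cINF_lower bdd_belowI2[of _ 0] operator_norm_diff_nonneg[OF T]) auto

lemma approximation_number_nonneg:
  assumes T: "bounded_operator S N T"
  shows "0 \<le> approximation_number S N T (Suc n)"
  by (intro approximation_number_ge operator_norm_diff_nonneg T)

lemma sum_mem: "finite I \<Longrightarrow> (\<And>i. i \<in> I \<Longrightarrow> e i \<in> S) \<Longrightarrow> (\<Sum>i\<in>I. cscale (a i) (e i)) \<in> S"
  by (induction I rule: finite_induct) (auto simp: zero_mem intro!: add_mem scale_mem)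

lemma bounded_operator_sum:
  assumes T: "bounded_operator S N T"
  shows "finite I \<Longrightarrow> (\<And>i. i \<in> I \<Longrightarrow> e i \<in> S) \<Longrightarrow>
    T (\<Sum>i\<in>I. cscale (a i) (e i)) = (\<Sum>i\<in>I. cscale (a i) (T (e i)))"
proof (induction I rule: finite_induct)
  case (insert i I)
  have "T (cscale (a i) (e i) + (\<Sum>i\<in>I. cscale (a i) (e i))) = T (cscale (a i) (e i)) + T (\<Sum>i\<in>I. cscale (a i) (e i))"
    using insert by (intro bounded_operatorD(2)[OF T] scale_mem sum_mem) auto
  thus ?case unfolding sum.insert[OF insert(1,2)]
    using insert bounded_operatorD(3)[OF T, of "e i" "a i"] by (simp only: insertI1 insertI2)
qed (simp add: bounded_operator_0[OF T])

text \<open>A dimension count: \<open>card I\<close> vectors are sent into the span of fewer.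
  Independence is a property of sets, so coinciding images are treated separately, by the difference
  of two vectors.\<close>

lemma rank_less_kernel:
  assumes R: "bounded_operator S N R" and rk: "rank_less S R (card (I :: 'i set))"
    and I: "finite I" and e: "\<And>i. i \<in> I \<Longrightarrow> e i \<in> S"
  obtains a :: "'i \<Rightarrow> complex" where "\<exists>i\<in>I. a i \<noteq> 0" "R (\<Sum>i\<in>I. cscale (a i) (e i)) = 0"
proof -
  obtain B where B: "finite B" "cfun.independent B" "cfun.span B = R ` S" "card B < card I"
    using rk by (auto simp: rank_less_def)
  have "\<exists>a. (\<exists>i\<in>I. a i \<noteq> 0) \<and> (\<Sum>i\<in>I. cscale (a i) (R (e i))) = 0"
  proof (cases "inj_on (\<lambda>i. R (e i)) I")
    case True
    let ?V = "(\<lambda>i. R (e i)) ` I"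
    have "\<not> cfun.independent ?V"
    proof
      assume "cfun.independent ?V"
      moreover have "?V \<subseteq> cfun.span B" unfolding B(3) using e by auto
      ultimately have "card ?V \<le> card B" using cfun.independent_span_bound[OF B(1)] by blast
      thus False using B(4) card_image[OF True] by simp
    qed
    then obtain u v where u: "v \<in> ?V" "u v \<noteq> 0" "(\<Sum>v\<in>?V. cscale (u v) v) = 0"
      using cfun.dependent_finite[of ?V] I by auto
    have "(\<Sum>i\<in>I. cscale (u (R (e i))) (R (e i))) = 0" using u(3) sum.reindex[OF True, of "\<lambda>v. cscale (u v) v"] by (simp add: o_def)
    thus ?thesis using u by (intro exI[of _ "\<lambda>i. u (R (e i))"]) auto
  next
    case False
    then obtain i j where ij: "i \<in> I" "j \<in> I" "i \<noteq> j" "R (e i) = R (e j)" by (auto simp: inj_on_def)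
    define a where "a k = (if k = i then 1 else if k = j then -1 else (0::complex))" for k
    have "(\<Sum>k\<in>I. cscale (a k) (R (e k))) = (\<Sum>k\<in>{i, j}. cscale (a k) (R (e k)))"
      using ij I by (intro sum.mono_neutral_right) (auto simp: a_def cscale_def fun_eq_iff)
    also have "\<dots> = 0" using ij by (simp add: a_def cscale_def fun_eq_iff)
    finally show ?thesis using ij by (intro exI[of _ a]) (auto simp: a_def)
  qed
  then obtain a where "\<exists>i\<in>I. a i \<noteq> 0" "(\<Sum>i\<in>I. cscale (a i) (R (e i))) = 0" by blast
  thus thesis using that bounded_operator_sum[OF R I e, where a = a] by auto
qed

end

section \<open>Taylor coefficients and the Hardy norm\<close>

definition coef :: "(complex \<Rightarrow> complex) \<Rightarrow> nat \<Rightarrow> complex" where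
  "coef f k = (deriv ^^ k) f 0 / fact k"

lemma fps_nth_expansion: "fps_nth (fps_expansion f 0) k = coef f k"
  by (simp add: fps_expansion_def coef_def)

lemma coef_cong: "(\<And>z. z \<in> ball 0 1 \<Longrightarrow> f z = g z) \<Longrightarrow> coef f k = coef g k"
proof -
  assume "\<And>z. z \<in> ball 0 1 \<Longrightarrow> f z = g z"
  hence "\<forall>\<^sub>F z in nhds 0. f z = g z" by (intro eventually_nhds_in_open[of "ball 0 1", THEN eventually_mono]) auto
  hence "fps_expansion f 0 = fps_expansion g 0" by (rule fps_expansion_cong)
  thus ?thesis by (simp add: fps_nth_expansion[symmetric])
qed

lemma coef_add:
  assumes "f holomorphic_on ball 0 1" "g holomorphic_on ball 0 1"
  shows "coef (f + g) k = coef f k + coef g k"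
proof -
  have "f + g = (\<lambda>z. f z + g z)" by (simp add: fun_eq_iff)
  thus ?thesis using higher_deriv_add[OF assms, of 0 k] by (simp add: coef_def add_divide_distrib)
qed

lemma coef_diff:
  assumes "f holomorphic_on ball 0 1" "g holomorphic_on ball 0 1"
  shows "coef (f - g) k = coef f k - coef g k"
proof -
  have "f - g = (\<lambda>z. f z - g z)" by (simp add: fun_eq_iff)
  thus ?thesis using higher_deriv_diff[OF assms, of 0 k] by (simp add: coef_def diff_divide_distrib)
qed

lemma coef_cscale:
  assumes "f holomorphic_on ball 0 1"
  shows "coef (cscale c f) k = c * coef f k"
  using higher_deriv_cmult[OF assms, of 0 k c] by (simp add: coef_def cscale_def)

lemma coef_sums: "f holomorphic_on ball 0 1 \<Longrightarrow> z \<in> ball 0 1 \<Longrightarrow> (\<lambda>k. coef f k * z ^ k) sums f z"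
  using holomorphic_power_series[of f 0 1 z] by (simp add: coef_def)

lemma coef_eqI:
  assumes "\<And>z. z \<in> ball 0 1 \<Longrightarrow> (\<lambda>k. b k * z ^ k) sums f z"
  shows "coef f k = b k"
proof -
  have "\<forall>\<^sub>F z in nhds 0. (\<lambda>k. fps_nth (Abs_fps b) k * z ^ k) sums f z"
    by (intro eventually_nhds_in_open[of "ball 0 1", THEN eventually_mono]) (auto simp: assms)
  hence "f has_fps_expansion Abs_fps b" by (rule has_fps_expansionI)
  hence "fps_expansion f 0 = Abs_fps b" by (rule fps_expansion_eqI)
  thus ?thesis by (simp add: fps_nth_expansion[symmetric])
qed

lemma hardy_space_iff:
  "f \<in> hardy_space \<longleftrightarrow> f holomorphic_on ball 0 1 \<and> (\<forall>z. z \<notin> ball 0 1 \<longrightarrow> f z = 0) \<and> summable (\<lambda>k. (cmod (coef f k))\<^sup>2)"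
  by (auto simp: hardy_space_def disc_functions_def fps_nth_expansion)

lemma hardy_norm_sq: "f \<in> hardy_space \<Longrightarrow> (hardy_norm f)\<^sup>2 = (\<Sum>k. (cmod (coef f k))\<^sup>2)"
  unfolding hardy_norm_def fps_nth_expansion hardy_space_iff
  by (subst real_sqrt_pow2) (auto intro!: suminf_nonneg)

lemma hardy_holomorphic: "f \<in> hardy_space \<Longrightarrow> f holomorphic_on ball 0 1"
  by (simp add: hardy_space_iff)

lemma hardy_summable: "f \<in> hardy_space \<Longrightarrow> summable (\<lambda>k. (cmod (coef f k))\<^sup>2)"
  by (simp add: hardy_space_iff)

lemma hardy_partial_sum_le: "f \<in> hardy_space \<Longrightarrow> (\<Sum>k<m. (cmod (coef f k))\<^sup>2) \<le> (hardy_norm f)\<^sup>2"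
  unfolding hardy_norm_sq using hardy_summable by (intro sum_le_suminf) auto

lemma hardy_norm_sq_le:
  assumes "f \<in> hardy_space" "\<And>m. (\<Sum>k<m. (cmod (coef f k))\<^sup>2) \<le> C"
  shows "(hardy_norm f)\<^sup>2 \<le> C"
  unfolding hardy_norm_sq[OF assms(1)] using hardy_summable[OF assms(1)] assms(2) by (intro suminf_le_const) auto

lemma hardy_spaceI:
  assumes "f holomorphic_on ball 0 1" "\<And>z. z \<notin> ball 0 1 \<Longrightarrow> f z = 0"
    and "\<And>m. (\<Sum>k<m. (cmod (coef f k))\<^sup>2) \<le> C"
  shows "f \<in> hardy_space"
  unfolding hardy_space_iff using assms by (auto intro!: summableI_nonneg_bounded[of _ C])

lemma norm_diff_sq_le: "(cmod (a - b))\<^sup>2 \<le> 2 * (cmod a)\<^sup>2 + 2 * (cmod b)\<^sup>2"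
proof -
  have "(cmod (a - b))\<^sup>2 \<le> (cmod a + cmod b)\<^sup>2" by (intro power_mono norm_triangle_ineq4) auto
  also have "\<dots> \<le> 2 * (cmod a)\<^sup>2 + 2 * (cmod b)\<^sup>2"
    using sum_squares_bound[of "cmod a" "cmod b"] by (simp add: power2_sum)
  finally show ?thesis .
qed

interpretation hardy: function_norm hardy_space hardy_norm
proof
  have c0: "coef 0 k = 0" for k
    by (rule coef_eqI) (simp add: zero_fun_def)
  have hol0: "(0 :: complex \<Rightarrow> complex) holomorphic_on A" for A
    by (simp add: zero_fun_def)
  show "0 \<in> hardy_space" by (rule hardy_spaceI[where C = 0]) (auto simp: hol0 c0)
  show "hardy_norm 0 = 0" by (simp add: hardy_norm_def fps_nth_expansion c0)
  fix f g assume f: "f \<in> hardy_space"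
  note hf = hardy_holomorphic[OF f]
  show "0 \<le> hardy_norm f"
    unfolding hardy_norm_def fps_nth_expansion using hardy_summable[OF f]
    by (intro real_sqrt_ge_zero suminf_nonneg) auto
  show "cscale c f \<in> hardy_space" for c
  proof (rule hardy_spaceI[where C = "(cmod c)\<^sup>2 * (hardy_norm f)\<^sup>2"])
    show "cscale c f holomorphic_on ball 0 1" unfolding cscale_def by (intro holomorphic_intros hf)
    show "cscale c f z = 0" if "z \<notin> ball 0 1" for z using f that by (auto simp: cscale_def hardy_space_iff)
    show "(\<Sum>k<m. (cmod (coef (cscale c f) k))\<^sup>2) \<le> (cmod c)\<^sup>2 * (hardy_norm f)\<^sup>2" for m
      unfolding coef_cscale[OF hf] norm_mult power_mult_distrib sum_distrib_left[symmetric]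
      by (intro mult_left_mono hardy_partial_sum_le f) auto
  qed
  assume g: "g \<in> hardy_space"
  note hg = hardy_holomorphic[OF g]
  \<comment> \<open>The values c = -1 and c = 1 cover sums and differences together.\<close>
  have diff: "(\<Sum>k<m. (cmod (coef f k - c * coef g k))\<^sup>2) \<le> 2 * (hardy_norm f)\<^sup>2 + 2 * (hardy_norm g)\<^sup>2" if "cmod c = 1" for m c
  proof -
    have "(\<Sum>k<m. (cmod (coef f k - c * coef g k))\<^sup>2) \<le> (\<Sum>k<m. 2 * (cmod (coef f k))\<^sup>2 + 2 * (cmod (c * coef g k))\<^sup>2)"
      by (intro sum_mono norm_diff_sq_le)
    also have "\<dots> = 2 * (\<Sum>k<m. (cmod (coef f k))\<^sup>2) + 2 * (\<Sum>k<m. (cmod (coef g k))\<^sup>2)"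
      using that by (simp add: sum.distrib sum_distrib_left norm_mult)
    also have "\<dots> \<le> 2 * (hardy_norm f)\<^sup>2 + 2 * (hardy_norm g)\<^sup>2"
      by (intro add_mono mult_left_mono hardy_partial_sum_le f g) auto
    finally show ?thesis .
  qed
  show "f + g \<in> hardy_space"
  proof (rule hardy_spaceI)
    have "f + g = (\<lambda>z. f z + g z)" by (simp add: fun_eq_iff)
    thus "f + g holomorphic_on ball 0 1" using hf hg by (simp add: holomorphic_on_add)
    show "(f + g) z = 0" if "z \<notin> ball 0 1" for z using f g that by (auto simp: hardy_space_iff)
    show "(\<Sum>k<m. (cmod (coef (f + g) k))\<^sup>2) \<le> 2 * (hardy_norm f)\<^sup>2 + 2 * (hardy_norm g)\<^sup>2" for m
      using diff[of "-1" m] by (simp add: coef_add[OF hf hg])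
  qed
  have "f - g \<in> hardy_space"
  proof (rule hardy_spaceI)
    have "f - g = (\<lambda>z. f z - g z)" by (simp add: fun_eq_iff)
    thus "f - g holomorphic_on ball 0 1" using hf hg by (simp add: holomorphic_on_diff)
    show "(f - g) z = 0" if "z \<notin> ball 0 1" for z using f g that by (auto simp: hardy_space_iff)
    show "(\<Sum>k<m. (cmod (coef (f - g) k))\<^sup>2) \<le> 2 * (hardy_norm f)\<^sup>2 + 2 * (hardy_norm g)\<^sup>2" for m
      using diff[of 1 m] by (simp add: coef_diff[OF hf hg])
  qed
  thus "(hardy_norm (f - g))\<^sup>2 \<le> 2 * (hardy_norm f)\<^sup>2 + 2 * (hardy_norm g)\<^sup>2"
    using diff[of 1] by (intro hardy_norm_sq_le) (auto simp: coef_diff[OF hf hg])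
qed

section \<open>Monomials, power series and truncation\<close>

definition disc_monomial :: "nat \<Rightarrow> complex \<Rightarrow> complex" where
  "disc_monomial j z = (if z \<in> ball 0 1 then z ^ j else 0)"

definition disc_series :: "(nat \<Rightarrow> complex) \<Rightarrow> complex \<Rightarrow> complex" where
  "disc_series b z = (if z \<in> ball 0 1 then (\<Sum>k. b k * z ^ k) else 0)"

lemma disc_series:
  assumes "\<And>m. (\<Sum>k<m. (cmod (b k))\<^sup>2) \<le> C"
  shows "disc_series b \<in> hardy_space" "coef (disc_series b) k = b k" "(hardy_norm (disc_series b))\<^sup>2 \<le> C"
proof -
  have bk: "cmod (b k) \<le> sqrt C" for k
  proof -
    have "(cmod (b k))\<^sup>2 \<le> (\<Sum>k<Suc k. (cmod (b k))\<^sup>2)" by (simp add: sum_nonneg)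
    also have "\<dots> \<le> C" by (rule assms)
    finally show ?thesis by (rule real_le_rsqrt)
  qed
  have sums: "(\<lambda>k. b k * z ^ k) sums disc_series b z" if z: "z \<in> ball 0 1" for z
  proof -
    have "summable (\<lambda>k. b k * z ^ k)"
    proof (rule summable_comparison_test')
      show "summable (\<lambda>k. sqrt C * cmod z ^ k)" using z by (intro summable_mult summable_geometric) auto
      show "norm (b k * z ^ k) \<le> sqrt C * cmod z ^ k" for k
        using bk[of k] by (simp add: norm_mult norm_power mult_right_mono)
    qed
    thus ?thesis using z by (simp add: disc_series_def summable_sums)
  qed
  have hol: "disc_series b holomorphic_on ball 0 1"
    by (rule power_series_holomorphic[of 0 1 b]) (use sums in simp)
  show c: "coef (disc_series b) k = b k" for k using sums by (rule coef_eqI)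
  show m: "disc_series b \<in> hardy_space"
    by (rule hardy_spaceI[OF hol, of C]) (use assms in \<open>auto simp: c disc_series_def\<close>)
  show "(hardy_norm (disc_series b))\<^sup>2 \<le> C" by (rule hardy_norm_sq_le[OF m]) (simp add: c assms)
qed

text \<open>The orthogonal projection onto the polynomials of degree less than n.\<close>

definition truncation :: "nat \<Rightarrow> (complex \<Rightarrow> complex) \<Rightarrow> complex \<Rightarrow> complex" where
  "truncation n f = disc_series (\<lambda>k. if k < n then coef f k else 0)"

lemma truncation_bound:
  "(\<Sum>k<m. (cmod (if k < n then coef f k else 0))\<^sup>2) \<le> (\<Sum>k<n. (cmod (coef f k))\<^sup>2)"
proof -
  have "(\<Sum>k<m. (cmod (if k < n then coef f k else 0))\<^sup>2) \<le> (\<Sum>k<max m n. (cmod (if k < n then coef f k else 0))\<^sup>2)"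
    by (intro sum_mono2) auto
  also have "\<dots> = (\<Sum>k<n. (cmod (coef f k))\<^sup>2)"
    by (intro sum.mono_neutral_cong_right) auto
  finally show ?thesis .
qed

lemma truncation:
  "truncation n f \<in> hardy_space" "coef (truncation n f) k = (if k < n then coef f k else 0)"
  "(hardy_norm (truncation n f))\<^sup>2 \<le> (\<Sum>k<n. (cmod (coef f k))\<^sup>2)"
  unfolding truncation_def using disc_series[OF truncation_bound] by blast+

lemma truncation_eq_sum: "truncation n f = (\<Sum>j<n. cscale (coef f j) (disc_monomial j))"
proof
  fix z
  have "(\<Sum>j<n. cscale (coef f j) (disc_monomial j)) z = (\<Sum>j<n. coef f j * disc_monomial j z)"
    by (induction n) (auto simp: cscale_def)
  also have "\<dots> = truncation n f z"
  proof (cases "z \<in> ball 0 1")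
    case True
    have "(\<Sum>k. (if k < n then coef f k else 0) * z ^ k) = (\<Sum>k<n. (if k < n then coef f k else 0) * z ^ k)"
      by (rule suminf_finite) auto
    thus ?thesis using True by (simp add: truncation_def disc_series_def disc_monomial_def)
  qed (simp add: truncation_def disc_series_def disc_monomial_def)
  finally show "truncation n f z = (\<Sum>j<n. cscale (coef f j) (disc_monomial j)) z" by simp
qed

lemma disc_monomial_hardy: "disc_monomial j \<in> hardy_space"
  and coef_disc_monomial: "coef (disc_monomial j) k = (if k = j then 1 else 0)"
proof -
  have s: "(\<lambda>k. (if k = j then 1 else 0) * z ^ k) sums disc_monomial j z" if "z \<in> ball 0 1" for z
    using sums_single[of j "\<lambda>k. z ^ k"] that by (simp add: disc_monomial_def if_distrib[of "\<lambda>x. x * _"] cong: if_cong)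
  show c: "coef (disc_monomial j) k = (if k = j then 1 else 0)" for k using s by (rule coef_eqI)
  have "disc_monomial j holomorphic_on ball 0 1"
    by (rule power_series_holomorphic[of 0 1 "\<lambda>k. if k = j then 1 else 0"]) (use s in simp)
  thus "disc_monomial j \<in> hardy_space"
  proof (rule hardy_spaceI)
    show "disc_monomial j z = 0" if "z \<notin> ball 0 1" for z using that by (simp add: disc_monomial_def)
    show "(\<Sum>k<m. (cmod (coef (disc_monomial j) k))\<^sup>2) \<le> 1" for m
      by (simp add: c if_distrib[of cmod] if_distrib[of "\<lambda>x. x\<^sup>2"] cong: if_cong)
  qed
qed

section \<open>The composition operator on the Hardy space\<close>

lemma composition_operator_linear:
  "composition_operator \<phi> (f + g) = composition_operator \<phi> f + composition_operator \<phi> g"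
  "composition_operator \<phi> (f - g) = composition_operator \<phi> f - composition_operator \<phi> g"
  "composition_operator \<phi> (cscale c f) = cscale c (composition_operator \<phi> f)"
  by (auto simp: composition_operator_def cscale_def fun_eq_iff)

lemma truncation_linear:
  assumes "f \<in> hardy_space" "g \<in> hardy_space"
  shows "truncation n (f + g) = truncation n f + truncation n g"
  unfolding truncation_eq_sum coef_add[OF assms[THEN hardy_holomorphic]]
  by (simp add: cfun.scale_left_distrib sum.distrib del: plus_fun_apply)

lemma truncation_cscale:
  assumes "f \<in> hardy_space"
  shows "truncation n (cscale c f) = cscale c (truncation n f)"
  unfolding truncation_eq_sum coef_cscale[OF hardy_holomorphic[OF assms]]
  by (simp add: cfun.scale_sum_right)

context spiral_symbol
begin

abbreviation Cphi :: "(complex \<Rightarrow> complex) \<Rightarrow> complex \<Rightarrow> complex" where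
  "Cphi \<equiv> composition_operator phi"

lemma phi_disc: "z \<in> ball 0 1 \<Longrightarrow> phi z \<in> ball 0 1"
proof -
  assume z: "z \<in> ball 0 1"
  hence "z \<noteq> 1" "z \<noteq> -1" by auto
  thus ?thesis using phi_norm_less_1[of z] z by simp
qed

lemma holomorphic_composition:
  assumes "f holomorphic_on ball 0 1"
  shows "(\<lambda>z. f (phi z)) holomorphic_on ball 0 1"
  using holomorphic_on_compose_gen[OF phi_holomorphic assms] phi_disc by (auto simp: o_def image_subset_iff)

text \<open>The boundary estimate is known for \<open>phi ^ n\<close> times a polynomial in phi.
  Writing f = z^n * g, the partial sums of g provide such functions, which converge uniformly near
  0. Each Taylor coefficient converges, and for fixed m the bound passes to the limit.\<close>

lemma composition_coef_bound:
  assumes f: "f \<in> hardy_space" and z: "\<And>j. j < n \<Longrightarrow> coef f j = 0"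
  shows "(\<Sum>k<m. (cmod (coef (Cphi f) k))\<^sup>2) \<le> coeff_bound n * (hardy_norm f)\<^sup>2"
proof -
  define a where "a j = coef f (j + n)" for j
  define G where "G N z = phi z ^ n * (\<Sum>j<N. a j * phi z ^ j)" for N z
  note hf = hardy_holomorphic[OF f]
  have aQ: "(\<Sum>j<N. (cmod (a j))\<^sup>2) \<le> (hardy_norm f)\<^sup>2" for N
  proof -
    have "(\<Sum>j<N. (cmod (a j))\<^sup>2) = (\<Sum>k\<in>{n..<N+n}. (cmod (coef f k))\<^sup>2)"
      unfolding a_def by (rule sum.reindex_bij_witness[of _ "\<lambda>k. k - n" "\<lambda>j. j + n"]) auto
    also have "\<dots> \<le> (\<Sum>k<N+n. (cmod (coef f k))\<^sup>2)" by (intro sum_mono2) auto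
    also have "\<dots> \<le> (hardy_norm f)\<^sup>2" by (rule hardy_partial_sum_le[OF f])
    finally show ?thesis .
  qed
  have a_le: "cmod (a j) \<le> sqrt ((hardy_norm f)\<^sup>2)" for j
  proof -
    have "(cmod (a j))\<^sup>2 \<le> (\<Sum>j<Suc j. (cmod (a j))\<^sup>2)" by (simp add: sum_nonneg)
    also have "\<dots> \<le> (hardy_norm f)\<^sup>2" by (rule aQ)
    finally show ?thesis by (rule real_le_rsqrt)
  qed
  have "continuous_on (cball 0 (1/2)) (\<lambda>z. cmod (phi z))"
    by (intro continuous_intros holomorphic_on_imp_continuous_on holomorphic_on_subset[OF phi_holomorphic]) auto
  \<comment> \<open>On a smaller disc |phi| has a maximum below 1, which supplies the geometric
    majorant.\<close>
  then obtain z0 where z0: "z0 \<in> cball 0 (1/2)" "\<And>z. z \<in> cball 0 (1/2) \<Longrightarrow> cmod (phi z) \<le> cmod (phi z0)"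
    using continuous_attains_sup[of "cball 0 (1/2)" "\<lambda>z. cmod (phi z)"] by auto
  define \<rho> where "\<rho> = cmod (phi z0)"
  have \<rho>: "0 \<le> \<rho>" "\<rho> < 1" using phi_disc[of z0] z0(1) by (auto simp: \<rho>_def)
  have ul: "uniform_limit (ball 0 (1/2)) (\<lambda>N z. \<Sum>j<N. phi z ^ n * (a j * phi z ^ j)) (\<lambda>z. \<Sum>j. phi z ^ n * (a j * phi z ^ j)) sequentially"
  proof (rule Weierstrass_m_test)
    show "summable (\<lambda>j. sqrt ((hardy_norm f)\<^sup>2) * \<rho> ^ j)" using \<rho> by (intro summable_mult summable_geometric) auto
    fix j and z :: complex assume z: "z \<in> ball 0 (1/2)"
    have p1: "cmod (phi z) \<le> \<rho>" using z0(2)[of z] z by (auto simp: \<rho>_def)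
    have "cmod (phi z ^ n * (a j * phi z ^ j)) = cmod (phi z) ^ n * (cmod (a j) * cmod (phi z) ^ j)"
      by (simp add: norm_mult norm_power)
    also have "\<dots> \<le> 1 * (sqrt ((hardy_norm f)\<^sup>2) * \<rho> ^ j)"
      using p1 \<rho> a_le[of j] by (intro mult_mono power_mono power_le_one mult_nonneg_nonneg) auto
    finally show "norm (phi z ^ n * (a j * phi z ^ j)) \<le> sqrt ((hardy_norm f)\<^sup>2) * \<rho> ^ j" by simp
  qed
  have lim: "(\<Sum>j. phi z ^ n * (a j * phi z ^ j)) = f (phi z)" if "z \<in> ball 0 (1/2)" for z
  proof -
    have "phi z \<in> ball 0 1" using that by (intro phi_disc) auto
    from coef_sums[OF hf this] have s: "(\<lambda>k. coef f k * phi z ^ k) sums f (phi z)" .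
    hence "(\<lambda>j. coef f (j + n) * phi z ^ (j + n)) sums (f (phi z) - (\<Sum>k<n. coef f k * phi z ^ k))"
      by (rule sums_split_initial_segment)
    hence "(\<lambda>j. coef f (j + n) * phi z ^ (j + n)) sums f (phi z)" using z by simp
    thus ?thesis by (simp add: sums_iff a_def power_add mult_ac)
  qed
  have ulG: "uniform_limit (ball 0 (1/2)) G (\<lambda>z. f (phi z)) sequentially"
    using ul by (rule uniform_limit_cong'[THEN iffD1, rotated 2]) (auto simp: lim G_def sum_distrib_left)
  have holG: "G N holomorphic_on ball 0 (1/2)" for N
    unfolding G_def by (intro holomorphic_intros holomorphic_on_subset[OF phi_holomorphic]) auto
  have conv: "(\<lambda>N. (deriv ^^ k) (G N) 0) \<longlonglongrightarrow> (deriv ^^ k) (\<lambda>z. f (phi z)) 0" for k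
    by (rule higher_deriv_complex_uniform_limit[OF ulG]) (auto intro!: always_eventually holG)
  have cf: "coef (Cphi f) k = coef (\<lambda>z. f (phi z)) k" for k
    by (rule coef_cong) (simp add: composition_operator_def)
  have le: "(\<Sum>k<m. (cmod ((deriv ^^ k) (G N) 0 / fact k))\<^sup>2) \<le> coeff_bound n * (hardy_norm f)\<^sup>2" for N
  proof -
    have "(\<Sum>k<m. (cmod ((deriv ^^ k) (G N) 0 / fact k))\<^sup>2) \<le> coeff_bound n * (\<Sum>j<N. (cmod (a j))\<^sup>2)"
      unfolding G_def coeff_bound_def by (rule composed_polynomial_coefficients)
    also have "\<dots> \<le> coeff_bound n * (hardy_norm f)\<^sup>2" by (intro mult_left_mono aQ coeff_bound_nonneg)
    finally show ?thesis .
  qed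
  have "(\<lambda>N. \<Sum>k<m. (cmod ((deriv ^^ k) (G N) 0 / fact k))\<^sup>2) \<longlonglongrightarrow> (\<Sum>k<m. (cmod ((deriv ^^ k) (\<lambda>z. f (phi z)) 0 / fact k))\<^sup>2)"
    by (intro tendsto_intros conv) auto
  from LIMSEQ_le_const2[OF this] le
  have "(\<Sum>k<m. (cmod ((deriv ^^ k) (\<lambda>z. f (phi z)) 0 / fact k))\<^sup>2) \<le> coeff_bound n * (hardy_norm f)\<^sup>2" by blast
  thus ?thesis unfolding cf by (simp add: coef_def)
qed

lemma Cphi_hardy:
  assumes "f \<in> hardy_space"
  shows "Cphi f \<in> hardy_space"
proof (rule hardy_spaceI)
  show "Cphi f holomorphic_on ball 0 1"
    using holomorphic_composition[OF hardy_holomorphic[OF assms]]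
    by (rule holomorphic_transform) (simp add: composition_operator_def)
  show "Cphi f z = 0" if "z \<notin> ball 0 1" for z using that by (simp add: composition_operator_def)
  show "(\<Sum>k<m. (cmod (coef (Cphi f) k))\<^sup>2) \<le> coeff_bound 0 * (hardy_norm f)\<^sup>2" for m
    by (rule composition_coef_bound[OF assms]) auto
qed

lemma Cphi_norm_sq:
  assumes "f \<in> hardy_space" "\<And>j. j < n \<Longrightarrow> coef f j = 0"
  shows "(hardy_norm (Cphi f))\<^sup>2 \<le> coeff_bound n * (hardy_norm f)\<^sup>2"
  by (intro hardy_norm_sq_le Cphi_hardy composition_coef_bound assms)

lemma Cphi_norm:
  assumes "f \<in> hardy_space" "\<And>j. j < n \<Longrightarrow> coef f j = 0"
  shows "hardy_norm (Cphi f) \<le> sqrt (coeff_bound n) * hardy_norm f"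
proof -
  have "hardy_norm (Cphi f) \<le> sqrt (coeff_bound n * (hardy_norm f)\<^sup>2)"
    by (rule real_le_rsqrt[OF Cphi_norm_sq[OF assms]])
  thus ?thesis using hardy.norm_nonneg[OF assms(1)] by (simp add: real_sqrt_mult)
qed

lemma Cphi_bounded: "bounded_operator hardy_space hardy_norm Cphi"
  unfolding bounded_operator_def
proof (intro conjI allI ballI)
  show "\<exists>K. \<forall>f\<in>hardy_space. hardy_norm (Cphi f) \<le> K * hardy_norm f"
    using Cphi_norm[where n = 0] by blast
qed (simp_all only: Cphi_hardy composition_operator_linear)

lemma truncation_norm_le: "f \<in> hardy_space \<Longrightarrow> hardy_norm (truncation n f) \<le> hardy_norm f"
proof -
  assume f: "f \<in> hardy_space"
  have "(hardy_norm (truncation n f))\<^sup>2 \<le> (hardy_norm f)\<^sup>2"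
    using truncation(3) hardy_partial_sum_le[OF f] by (rule order_trans)
  thus ?thesis using hardy.norm_nonneg[OF f] by (rule power2_le_imp_le)
qed

lemma tail:
  assumes f: "f \<in> hardy_space"
  shows "f - truncation n f \<in> hardy_space" "j < n \<Longrightarrow> coef (f - truncation n f) j = 0"
    "hardy_norm (f - truncation n f) \<le> hardy_norm f"
proof -
  have c: "coef (f - truncation n f) k = (if k < n then 0 else coef f k)" for k
    using coef_diff[OF hardy_holomorphic[OF f] hardy_holomorphic[OF truncation(1)[of n f]]]
    by (simp add: truncation(2))
  show m: "f - truncation n f \<in> hardy_space" by (intro hardy.diff_mem f truncation(1))
  show "j < n \<Longrightarrow> coef (f - truncation n f) j = 0" by (simp add: c)
  have "(hardy_norm (f - truncation n f))\<^sup>2 \<le> (hardy_norm f)\<^sup>2"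
  proof (rule hardy_norm_sq_le[OF m])
    fix m
    have "(\<Sum>k<m. (cmod (coef (f - truncation n f) k))\<^sup>2) \<le> (\<Sum>k<m. (cmod (coef f k))\<^sup>2)"
      by (intro sum_mono) (simp add: c)
    also have "\<dots> \<le> (hardy_norm f)\<^sup>2" by (rule hardy_partial_sum_le[OF f])
    finally show "(\<Sum>k<m. (cmod (coef (f - truncation n f) k))\<^sup>2) \<le> (hardy_norm f)\<^sup>2" .
  qed
  thus "hardy_norm (f - truncation n f) \<le> hardy_norm f" using hardy.norm_nonneg[OF f] by (rule power2_le_imp_le)
qed

lemma truncated_bounded: "bounded_operator hardy_space hardy_norm (\<lambda>f. Cphi (truncation n f))"
  unfolding bounded_operator_def
proof (intro conjI allI ballI)
  show "\<exists>K. \<forall>f\<in>hardy_space. hardy_norm (Cphi (truncation n f)) \<le> K * hardy_norm f"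
  proof (intro exI ballI)
    fix f assume f: "f \<in> hardy_space"
    have "hardy_norm (Cphi (truncation n f)) \<le> sqrt (coeff_bound 0) * hardy_norm (truncation n f)"
      by (intro Cphi_norm truncation(1)) auto
    also have "\<dots> \<le> sqrt (coeff_bound 0) * hardy_norm f"
      using f coeff_bound_nonneg[of 0] by (intro mult_left_mono truncation_norm_le) auto
    finally show "hardy_norm (Cphi (truncation n f)) \<le> sqrt (coeff_bound 0) * hardy_norm f" .
  qed
qed (simp_all only: Cphi_hardy truncation(1) truncation_linear truncation_cscale composition_operator_linear)

text \<open>\<open>rank_less\<close> asks for a basis of the exact range, so a maximal independent
  subset of the images of n monomials is taken. The index is n + 1 because the rank may equal
  n.\<close>

lemma truncated_rank: "rank_less hardy_space (\<lambda>f. Cphi (truncation n f)) (Suc n)"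
proof -
  let ?R = "\<lambda>f. Cphi (truncation n f)"
  let ?B = "(\<lambda>j. Cphi (disc_monomial j)) ` {..<n}"
  note Rb = truncated_bounded[of n]
  have R_eq: "?R f = (\<Sum>j<n. cscale (coef f j) (Cphi (disc_monomial j)))" for f
    unfolding truncation_eq_sum
    by (rule hardy.bounded_operator_sum[OF Cphi_bounded]) (auto intro: disc_monomial_hardy)
  have sub1: "?R ` hardy_space \<subseteq> cfun.span ?B"
    unfolding R_eq by (intro image_subsetI cfun.span_sum cfun.span_scale cfun.span_base) auto
  have mono: "?R (disc_monomial j) = Cphi (disc_monomial j)" if "j < n" for j
  proof -
    have "truncation n (disc_monomial j) = (\<Sum>k<n. cscale (if k = j then 1 else 0) (disc_monomial k))"
      unfolding truncation_eq_sum coef_disc_monomial ..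
    also have "\<dots> = (\<Sum>k\<in>{j}. cscale (if k = j then 1 else 0) (disc_monomial k))"
      using that by (intro sum.mono_neutral_right) (auto simp: cscale_def fun_eq_iff)
    finally show ?thesis by (simp add: cscale_def)
  qed
  have "cfun.subspace (?R ` hardy_space)"
    unfolding cfun.subspace_def
  proof (intro conjI ballI allI)
    show "0 \<in> ?R ` hardy_space"
      using hardy.zero_mem hardy.bounded_operator_0[OF Rb] by (metis imageI)
  next
    fix x y assume "x \<in> ?R ` hardy_space" "y \<in> ?R ` hardy_space"
    then obtain f g where "f \<in> hardy_space" "g \<in> hardy_space" "x = ?R f" "y = ?R g" by blast
    thus "x + y \<in> ?R ` hardy_space"
      using hardy.bounded_operatorD(2)[OF Rb, of f g] hardy.add_mem[of f g] by (metis imageI)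
  next
    fix c x assume "x \<in> ?R ` hardy_space"
    then obtain f where "f \<in> hardy_space" "x = ?R f" by blast
    thus "cscale c x \<in> ?R ` hardy_space"
      using hardy.bounded_operatorD(3)[OF Rb, of f c] hardy.scale_mem[of f c] by (metis imageI)
  qed
  moreover have "?B \<subseteq> ?R ` hardy_space"
  proof
    fix x assume "x \<in> ?B"
    then obtain j where "j < n" "x = Cphi (disc_monomial j)" by auto
    thus "x \<in> ?R ` hardy_space" using mono[of j] disc_monomial_hardy[of j] by (metis imageI)
  qed
  ultimately have sub2: "cfun.span ?B \<subseteq> ?R ` hardy_space" by (intro cfun.span_minimal)
  obtain B where B: "B \<subseteq> ?B" "cfun.independent B" "?B \<subseteq> cfun.span B"
    using cfun.maximal_independent_subset[of ?B] by blast
  have fin: "finite B" using B(1) finite_subset by blast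
  have "cfun.span B = cfun.span ?B"
    using B by (metis cfun.span_mono cfun.span_minimal cfun.subspace_span subset_antisym)
  moreover have "card B < Suc n"
    using card_mono[OF _ B(1)] card_image_le[of "{..<n}" "\<lambda>j. Cphi (disc_monomial j)"] by simp
  ultimately show ?thesis
    unfolding rank_less_def using fin B(2) sub1 sub2 by (intro exI[of _ B]) auto
qed

text \<open>The competitor truncates first. The error then acts on tails, whose first n coefficients
  vanish, and there \<open>coeff_bound n\<close> applies.\<close>

lemma approximation_number_bound:
  "approximation_number hardy_space hardy_norm Cphi (Suc n) \<le> sqrt (coeff_bound n)"
proof -
  let ?R = "\<lambda>f. Cphi (truncation n f)"
  have "approximation_number hardy_space hardy_norm Cphi (Suc n) \<le> operator_norm hardy_space hardy_norm (Cphi - ?R)"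
    by (intro hardy.approximation_number_le Cphi_bounded truncated_bounded truncated_rank)
  also have "\<dots> \<le> sqrt (coeff_bound n)"
    unfolding operator_norm_def
  proof (rule cSUP_least)
    show "{f \<in> hardy_space. hardy_norm f \<le> 1} \<noteq> {}" using hardy.zero_mem hardy.norm_zero by force
    fix f assume "f \<in> {f \<in> hardy_space. hardy_norm f \<le> 1}"
    hence f: "f \<in> hardy_space" "hardy_norm f \<le> 1" by auto
    have "hardy_norm ((Cphi - ?R) f) = hardy_norm (Cphi (f - truncation n f))" by (simp add: composition_operator_linear)
    also have "\<dots> \<le> sqrt (coeff_bound n) * hardy_norm (f - truncation n f)"
      by (intro Cphi_norm tail f)
    also have "\<dots> \<le> sqrt (coeff_bound n) * 1"
      using tail(3)[OF f(1)] f(2) coeff_bound_nonneg[of n] by (intro mult_left_mono) (auto intro: order_trans)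
    finally show "hardy_norm ((Cphi - ?R) f) \<le> sqrt (coeff_bound n)" by (simp only: mult_1_right)
  qed
  finally show ?thesis .
qed

text \<open>A diagonal choice makes all coefficients converge. Differences are split into head and
  tail: the tails are uniformly small because \<open>coeff_bound\<close> tends to 0, the heads
  involve finitely many coefficients.\<close>

lemma Cphi_compact: "compact_operator hardy_space hardy_norm Cphi"
  unfolding compact_operator_def
proof (intro conjI allI impI Cphi_bounded)
  fix u :: "nat \<Rightarrow> complex \<Rightarrow> complex"
  assume u: "\<forall>n. u n \<in> hardy_space \<and> hardy_norm (u n) \<le> 1"
  have sq1: "(hardy_norm (u n))\<^sup>2 \<le> 1" for n using u hardy.norm_nonneg[of "u n"] by (simp add: power_le_one)
  have c1: "cmod (coef (u n) k) \<le> 1" for n k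
  proof -
    have "(cmod (coef (u n) k))\<^sup>2 \<le> (\<Sum>k<Suc k. (cmod (coef (u n) k))\<^sup>2)" by (simp add: sum_nonneg)
    also have "\<dots> \<le> (hardy_norm (u n))\<^sup>2" using u by (intro hardy_partial_sum_le) auto
    also have "\<dots> \<le> 1" by (rule sq1)
    finally show ?thesis by (simp add: abs_square_le_1)
  qed
  obtain r where r: "strict_mono (r :: nat \<Rightarrow> nat)" "\<And>k. k \<in> UNIV \<Longrightarrow> \<exists>l. (\<lambda>n. coef (u (r n)) k) \<longlonglongrightarrow> l"
  proof (rule function_convergent_subsequence[of "UNIV :: nat set" "\<lambda>n. coef (u n)" 1])
    show "norm (coef (u n) k) \<le> 1" for n k by (rule c1)
    fix k :: "nat \<Rightarrow> nat"
    assume "strict_mono k" "\<And>x. x \<in> UNIV \<Longrightarrow> \<exists>l. (\<lambda>n. coef (u (k n)) x) \<longlonglongrightarrow> l"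
    thus thesis by (rule that)
  qed simp
  hence "\<forall>k. \<exists>l. (\<lambda>n. coef (u (r n)) k) \<longlonglongrightarrow> l" by simp
  from choice[OF this] obtain b where b: "\<And>k. (\<lambda>n. coef (u (r n)) k) \<longlonglongrightarrow> b k" by blast
  have bsum: "(\<Sum>k<m. (cmod (b k))\<^sup>2) \<le> 1" for m
  proof (rule LIMSEQ_le_const2)
    show "(\<lambda>n. \<Sum>k<m. (cmod (coef (u (r n)) k))\<^sup>2) \<longlonglongrightarrow> (\<Sum>k<m. (cmod (b k))\<^sup>2)" by (intro tendsto_intros b)
    show "\<exists>N. \<forall>n\<ge>N. (\<Sum>k<m. (cmod (coef (u (r n)) k))\<^sup>2) \<le> 1"
      by (intro exI allI impI order_trans[OF hardy_partial_sum_le sq1]) (use u in blast)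
  qed
  define f where "f = disc_series b"
  have f: "f \<in> hardy_space" "\<And>k. coef f k = b k" "(hardy_norm f)\<^sup>2 \<le> 1" unfolding f_def using disc_series[OF bsum] by auto
  define d where "d n = u (r n) - f" for n
  have dm: "d n \<in> hardy_space" for n unfolding d_def using u f by (intro hardy.diff_mem) auto
  have dn: "(hardy_norm (d n))\<^sup>2 \<le> 4" for n
  proof -
    have "(hardy_norm (d n))\<^sup>2 \<le> 2 * (hardy_norm (u (r n)))\<^sup>2 + 2 * (hardy_norm f)\<^sup>2"
      unfolding d_def using u f by (intro hardy.norm_diff_sq) auto
    thus ?thesis using sq1[of "r n"] f(3) by simp
  qed
  have dc: "(\<lambda>n. coef (d n) k) \<longlonglongrightarrow> 0" for k
  proof -
    have "coef (d n) k = coef (u (r n)) k - b k" for n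
      unfolding d_def using coef_diff[of "u (r n)" f k] u f hardy_holomorphic by auto
    thus ?thesis using tendsto_diff[OF b[of k] tendsto_const[of "b k"]] by simp
  qed
  have "(\<lambda>n. (hardy_norm (Cphi (d n)))\<^sup>2) \<longlonglongrightarrow> 0"
  proof (rule LIMSEQ_I)
    fix e :: real assume e: "0 < e"
    \<comment> \<open>8 is the factor 2 of the quadratic inequality times the bound 4 for the
      squared norm of \<open>d n\<close>.\<close>
    have "(\<lambda>M. 8 * coeff_bound M) \<longlonglongrightarrow> 8 * 0" by (intro tendsto_intros coeff_bound_tendsto_0)
    from order_tendstoD(2)[OF this, of "e / 2"] e obtain M where M: "8 * coeff_bound M < e / 2"
      by (auto simp: eventually_sequentially)
    have "(\<lambda>n. 2 * (coeff_bound 0 * (\<Sum>k<M. (cmod (coef (d n) k))\<^sup>2))) \<longlonglongrightarrow> 2 * (coeff_bound 0 * (\<Sum>k<M. (cmod 0)\<^sup>2))"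
      by (intro tendsto_intros dc)
    from order_tendstoD(2)[OF this, of "e / 2"] e
    obtain n0 where n0: "\<And>n. n \<ge> n0 \<Longrightarrow> 2 * (coeff_bound 0 * (\<Sum>k<M. (cmod (coef (d n) k))\<^sup>2)) < e / 2"
      by (auto simp: eventually_sequentially)
    have "norm ((hardy_norm (Cphi (d n)))\<^sup>2 - 0) < e" if "n \<ge> n0" for n
    proof -
      let ?P = "truncation M (d n)"
      have P: "- ?P \<in> hardy_space"
        using hardy.diff_mem[OF hardy.zero_mem truncation(1)[of M "d n"]] by simp
      have 1: "(hardy_norm (Cphi (d n - ?P)))\<^sup>2 \<le> coeff_bound M * 4"
      proof -
        have "(hardy_norm (Cphi (d n - ?P)))\<^sup>2 \<le> coeff_bound M * (hardy_norm (d n - ?P))\<^sup>2"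
          by (intro Cphi_norm_sq tail dm)
        also have "(hardy_norm (d n - ?P))\<^sup>2 \<le> (hardy_norm (d n))\<^sup>2"
          by (intro power_mono tail hardy.norm_nonneg dm)
        also have "\<dots> \<le> 4" by (rule dn)
        finally show ?thesis by (simp add: coeff_bound_nonneg mult_left_mono)
      qed
      have 2: "(hardy_norm (Cphi ?P))\<^sup>2 \<le> coeff_bound 0 * (\<Sum>k<M. (cmod (coef (d n) k))\<^sup>2)"
      proof -
        have "(hardy_norm (Cphi ?P))\<^sup>2 \<le> coeff_bound 0 * (hardy_norm ?P)\<^sup>2"
          by (intro Cphi_norm_sq truncation(1)) auto
        also have "\<dots> \<le> coeff_bound 0 * (\<Sum>k<M. (cmod (coef (d n) k))\<^sup>2)"
          by (intro mult_left_mono truncation(3) coeff_bound_nonneg)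
        finally show ?thesis .
      qed
      \<comment> \<open>Head and tail are written as a difference, the form in which the quadratic
        inequality is available.\<close>
      have "Cphi (d n) = Cphi (d n - ?P) - Cphi (- ?P)"
        unfolding composition_operator_linear(2)[symmetric] by simp
      hence "(hardy_norm (Cphi (d n)))\<^sup>2 \<le> 2 * (hardy_norm (Cphi (d n - ?P)))\<^sup>2 + 2 * (hardy_norm (Cphi (- ?P)))\<^sup>2"
        using hardy.norm_diff_sq[OF Cphi_hardy[OF tail(1)[OF dm]] Cphi_hardy[OF P]] by simp
      also have "hardy_norm (Cphi (- ?P)) = hardy_norm (Cphi ?P)"
      proof -
        have eq: "Cphi (- ?P) = cscale (-1) (Cphi ?P)" by (auto simp: composition_operator_def cscale_def fun_eq_iff)
        have "coef (Cphi (- ?P)) k = - coef (Cphi ?P) k" for k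
          unfolding eq coef_cscale[OF hardy_holomorphic[OF Cphi_hardy[OF truncation(1)]]] by simp
        thus ?thesis unfolding hardy_norm_def fps_nth_expansion by simp
      qed
      finally have "(hardy_norm (Cphi (d n)))\<^sup>2 < e" using 1 2 M n0[OF that] by linarith
      thus ?thesis by simp
    qed
    thus "\<exists>no. \<forall>n\<ge>no. norm ((hardy_norm (Cphi (d n)))\<^sup>2 - 0) < e" by blast
  qed
  hence "(\<lambda>n. sqrt ((hardy_norm (Cphi (d n)))\<^sup>2)) \<longlonglongrightarrow> sqrt 0" by (rule tendsto_real_sqrt)
  moreover have "sqrt ((hardy_norm (Cphi (d n)))\<^sup>2) = hardy_norm (Cphi (u (r n)) - Cphi f)" for n
    using hardy.norm_nonneg[OF Cphi_hardy[OF dm]] by (simp add: d_def composition_operator_linear)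
  ultimately have "(\<lambda>n. hardy_norm (Cphi (u (r n)) - Cphi f)) \<longlonglongrightarrow> 0" by simp
  thus "\<exists>g\<in>hardy_space. \<exists>r :: nat \<Rightarrow> nat. strict_mono r \<and> (\<lambda>n. hardy_norm (Cphi (u (r n)) - g)) \<longlonglongrightarrow> 0"
    using r(1) Cphi_hardy[OF f(1)] by blast
qed

lemma Cphi_schatten_hardy: "Cphi \<in> schatten_class p hardy_space hardy_norm"
proof -
  have "summable (\<lambda>n. approximation_number hardy_space hardy_norm Cphi (Suc n) powr p)"
  proof (rule summable_comparison_test'[OF summable_coeff_bound])
    fix n
    have "approximation_number hardy_space hardy_norm Cphi (Suc n) powr p \<le> sqrt (coeff_bound n) powr p"
      using p by (intro powr_mono2 approximation_number_bound hardy.approximation_number_nonneg[OF Cphi_bounded]) auto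
    also have "\<dots> = coeff_bound n powr (p / 2)"
      using coeff_bound_nonneg[of n] by (simp add: powr_half_sqrt[symmetric] powr_powr)
    finally show "norm (approximation_number hardy_space hardy_norm Cphi (Suc n) powr p) \<le> coeff_bound n powr (p / 2)" by simp
  qed
  thus ?thesis unfolding schatten_class_def using Cphi_compact by simp
qed

end

section \<open>Bergman space\<close>

lemma borel_measurable_norm_sq_disc:
  assumes "f holomorphic_on ball 0 1"
  shows "(\<lambda>z. indicator (ball 0 1) z *\<^sub>R (cmod (f z))\<^sup>2) \<in> borel_measurable borel"
  using assms by (intro borel_measurable_continuous_on_indicator continuous_intros holomorphic_on_imp_continuous_on) auto

lemma bergman_space_iff:
  "f \<in> bergman_space \<longleftrightarrow> f holomorphic_on ball 0 1 \<and> (\<forall>z. z \<notin> ball 0 1 \<longrightarrow> f z = 0) \<and>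
     set_integrable lborel (ball 0 1) (\<lambda>z. (cmod (f z))\<^sup>2)"
  by (auto simp: bergman_space_def disc_functions_def)

lemma bergman_norm_sq: "pi * (bergman_norm f)\<^sup>2 = (LINT z:ball 0 1|lborel. (cmod (f z))\<^sup>2)"
proof -
  have "0 \<le> (LINT z:ball 0 1|lborel. (cmod (f z))\<^sup>2)"
    unfolding set_lebesgue_integral_def by (intro Bochner_Integration.integral_nonneg) auto
  thus ?thesis by (simp add: bergman_norm_def)
qed

text \<open>One pointwise domination settles membership and norm for multiples, sums and differences
  alike.\<close>

lemma bergman_dominated:
  assumes "f \<in> bergman_space" "g \<in> bergman_space" "u holomorphic_on ball 0 1" "\<And>z. z \<notin> ball 0 1 \<Longrightarrow> u z = 0"
    and le: "\<And>z. (cmod (u z))\<^sup>2 \<le> A * (cmod (f z))\<^sup>2 + B * (cmod (g z))\<^sup>2"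
  shows "u \<in> bergman_space" "(bergman_norm u)\<^sup>2 \<le> A * (bergman_norm f)\<^sup>2 + B * (bergman_norm g)\<^sup>2"
proof -
  have f: "set_integrable lborel (ball 0 1) (\<lambda>z. A * (cmod (f z))\<^sup>2)"
    and g: "set_integrable lborel (ball 0 1) (\<lambda>z. B * (cmod (g z))\<^sup>2)"
    using assms(1,2) by (auto simp: bergman_space_iff intro!: set_integrable_mult_right)
  have fg: "set_integrable lborel (ball 0 1) (\<lambda>z. A * (cmod (f z))\<^sup>2 + B * (cmod (g z))\<^sup>2)"
    using f g by (rule set_integral_add)
  have u: "set_integrable lborel (ball 0 1) (\<lambda>z. (cmod (u z))\<^sup>2)"
    using fg
  proof (rule set_integrable_bound)
    show "set_borel_measurable lborel (ball 0 1) (\<lambda>z. (cmod (u z))\<^sup>2)"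
      unfolding set_borel_measurable_def using borel_measurable_norm_sq_disc[OF assms(3)] by simp
    show "AE z in lborel. z \<in> ball 0 1 \<longrightarrow> norm ((cmod (u z))\<^sup>2) \<le> norm (A * (cmod (f z))\<^sup>2 + B * (cmod (g z))\<^sup>2)"
      using le by (auto intro!: AE_I2 intro: order_trans[OF _ abs_ge_self])
  qed
  show "u \<in> bergman_space" using u assms by (auto simp: bergman_space_iff)
  have "pi * (bergman_norm u)\<^sup>2 \<le> (LINT z:ball 0 1|lborel. A * (cmod (f z))\<^sup>2 + B * (cmod (g z))\<^sup>2)"
    unfolding bergman_norm_sq by (intro set_integral_mono u fg le)
  also have "\<dots> = A * (pi * (bergman_norm f)\<^sup>2) + B * (pi * (bergman_norm g)\<^sup>2)"
    unfolding bergman_norm_sq by (simp add: set_integral_add[OF f g])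
  finally have "pi * (bergman_norm u)\<^sup>2 \<le> pi * (A * (bergman_norm f)\<^sup>2 + B * (bergman_norm g)\<^sup>2)"
    by (simp add: algebra_simps)
  thus "(bergman_norm u)\<^sup>2 \<le> A * (bergman_norm f)\<^sup>2 + B * (bergman_norm g)\<^sup>2"
    using pi_gt_zero by (simp only: mult_le_cancel_left_pos)
qed

interpretation bergman: function_norm bergman_space bergman_norm
proof
  show zm: "0 \<in> bergman_space" by (simp add: bergman_space_iff zero_fun_def set_integrable_def)
  show "bergman_norm 0 = 0" by (simp add: bergman_norm_def set_lebesgue_integral_def)
  show "0 \<le> bergman_norm f" for f
    unfolding bergman_norm_def set_lebesgue_integral_def
    by (intro real_sqrt_ge_zero divide_nonneg_nonneg Bochner_Integration.integral_nonneg) auto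
  fix f g assume f: "f \<in> bergman_space"
  show "cscale c f \<in> bergman_space" for c
    by (rule bergman_dominated(1)[OF f zm, where A = "(cmod c)\<^sup>2" and B = 0])
       (use f in \<open>auto simp: cscale_def bergman_space_iff norm_mult power_mult_distrib intro!: holomorphic_intros\<close>)
  assume g: "g \<in> bergman_space"
  show "f + g \<in> bergman_space"
  proof (rule bergman_dominated(1)[OF f g, where A = 2 and B = 2])
    have "f + g = (\<lambda>z. f z + g z)" by (simp add: fun_eq_iff)
    thus "f + g holomorphic_on ball 0 1" using f g by (simp add: bergman_space_iff holomorphic_on_add)
    show "(f + g) z = 0" if "z \<notin> ball 0 1" for z using f g that by (simp add: bergman_space_iff)
    show "(cmod ((f + g) z))\<^sup>2 \<le> 2 * (cmod (f z))\<^sup>2 + 2 * (cmod (g z))\<^sup>2" for z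
      using norm_diff_sq_le[of "f z" "- g z"] by simp
  qed
  show "(bergman_norm (f - g))\<^sup>2 \<le> 2 * (bergman_norm f)\<^sup>2 + 2 * (bergman_norm g)\<^sup>2"
  proof (rule bergman_dominated(2)[OF f g])
    have "f - g = (\<lambda>z. f z - g z)" by (simp add: fun_eq_iff)
    thus "f - g holomorphic_on ball 0 1" using f g by (simp add: bergman_space_iff holomorphic_on_diff)
    show "(f - g) z = 0" if "z \<notin> ball 0 1" for z using f g that by (simp add: bergman_space_iff)
    show "(cmod ((f - g) z))\<^sup>2 \<le> 2 * (cmod (f z))\<^sup>2 + 2 * (cmod (g z))\<^sup>2" for z
      using norm_diff_sq_le[of "f z" "g z"] by simp
  qed
qed

lemma disc_monomial_bergman: "disc_monomial j \<in> bergman_space"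
proof -
  have hol: "disc_monomial j holomorphic_on ball 0 1" by (rule hardy_holomorphic[OF disc_monomial_hardy])
  have one: "set_integrable lborel (ball (0::complex) 1) (\<lambda>z. 1 :: real)"
    unfolding set_integrable_def by (simp add: emeasure_disc)
  have "set_integrable lborel (ball 0 1) (\<lambda>z. (cmod (disc_monomial j z))\<^sup>2)"
    using one
  proof (rule set_integrable_bound)
    show "set_borel_measurable lborel (ball 0 1) (\<lambda>z. (cmod (disc_monomial j z))\<^sup>2)"
      unfolding set_borel_measurable_def using borel_measurable_norm_sq_disc[OF hol] by simp
    show "AE z in lborel. z \<in> ball 0 1 \<longrightarrow> norm ((cmod (disc_monomial j z))\<^sup>2) \<le> norm (1::real)"
      by (auto intro!: AE_I2 simp: disc_monomial_def norm_power power_le_one)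
  qed
  thus ?thesis using hol by (simp add: bergman_space_iff disc_monomial_def)
qed

lemma bergman_norm_sq_nn:
  assumes "f \<in> bergman_space"
  shows "ennreal (pi * (bergman_norm f)\<^sup>2) = (\<integral>\<^sup>+w. ennreal ((cmod (f w))\<^sup>2) * indicator (ball 0 1) w \<partial>lborel)"
proof -
  have "(\<integral>\<^sup>+w. ennreal (indicator (ball 0 1) w *\<^sub>R (cmod (f w))\<^sup>2) \<partial>lborel) = ennreal (pi * (bergman_norm f)\<^sup>2)"
    unfolding bergman_norm_sq set_lebesgue_integral_def
    using assms by (intro nn_integral_eq_integral) (auto simp: bergman_space_iff set_integrable_def)
  moreover have "ennreal (indicator (ball 0 1) w *\<^sub>R (cmod (f w))\<^sup>2) = ennreal ((cmod (f w))\<^sup>2) * indicator (ball 0 1) w" for w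
    by (auto simp: indicator_def)
  ultimately show ?thesis by simp
qed

text \<open>The sub-mean value inequality on disjoint discs; pi cancels because the norm is taken
  with respect to area divided by pi.\<close>

lemma bergman_norm_sq_ge_samples:
  assumes f: "f \<in> bergman_space" and I: "finite I" and \<rho>: "0 < \<rho>"
    and sub: "\<And>i. i \<in> I \<Longrightarrow> ball (z i) \<rho> \<subseteq> ball 0 1"
    and disj: "\<And>i j. i \<in> I \<Longrightarrow> j \<in> I \<Longrightarrow> i \<noteq> j \<Longrightarrow> 2 * \<rho> \<le> cmod (z i - z j)"
  shows "\<rho>\<^sup>2 * (\<Sum>i\<in>I. (cmod (f (z i)))\<^sup>2) \<le> (bergman_norm f)\<^sup>2"
proof -
  let ?F = "\<lambda>w. ennreal ((cmod (f w))\<^sup>2)"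
  have hol: "f holomorphic_on ball 0 1" using f by (simp add: bergman_space_iff)
  have meas: "(\<lambda>w. ?F w * indicator (ball (z i) \<rho>) w) \<in> borel_measurable lborel" if "i \<in> I" for i
  proof -
    have "continuous_on (ball (z i) \<rho>) (\<lambda>w. (cmod (f w))\<^sup>2)"
      using hol sub[OF that] by (intro continuous_intros holomorphic_on_imp_continuous_on holomorphic_on_subset[OF hol]) auto
    from borel_measurable_continuous_on_indicator[OF _ this]
    have "(\<lambda>w. ennreal (indicator (ball (z i) \<rho>) w *\<^sub>R (cmod (f w))\<^sup>2)) \<in> borel_measurable borel" by simp
    also have "(\<lambda>w. ennreal (indicator (ball (z i) \<rho>) w *\<^sub>R (cmod (f w))\<^sup>2)) = (\<lambda>w. ?F w * indicator (ball (z i) \<rho>) w)"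
      by (auto simp: indicator_def fun_eq_iff)
    finally show ?thesis by simp
  qed
  have disjoint: "w \<notin> ball (z j) \<rho>" if "w \<in> ball (z i) \<rho>" "i \<in> I" "j \<in> I" "i \<noteq> j" for w i j
  proof
    assume "w \<in> ball (z j) \<rho>"
    hence "dist (z i) (z j) < \<rho> + \<rho>" using that dist_triangle_less_add[of "z i" w \<rho> "z j" \<rho>] by (auto simp: dist_commute)
    thus False using disj[OF that(2-4)] by (simp add: dist_norm)
  qed
  have pt: "(\<Sum>i\<in>I. ?F w * indicator (ball (z i) \<rho>) w) \<le> ?F w * indicator (ball 0 1) w" for w
  proof (cases "\<exists>i\<in>I. w \<in> ball (z i) \<rho>")
    case True
    then obtain i where i: "i \<in> I" "w \<in> ball (z i) \<rho>" by blast
    have "(\<Sum>j\<in>I. ?F w * indicator (ball (z j) \<rho>) w) = (\<Sum>j\<in>{i}. ?F w * indicator (ball (z j) \<rho>) w)"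
      using i I disjoint by (intro sum.mono_neutral_right) (auto simp: indicator_def)
    thus ?thesis using i sub[of i] by (auto simp: indicator_def)
  qed (auto simp: indicator_def)
  have "ennreal (pi * (\<rho>\<^sup>2 * (\<Sum>i\<in>I. (cmod (f (z i)))\<^sup>2))) = (\<Sum>i\<in>I. ennreal (pi * \<rho>\<^sup>2 * (cmod (f (z i)))\<^sup>2))"
    by (subst sum_ennreal) (auto simp: sum_distrib_left mult.assoc)
  also have "\<dots> \<le> (\<Sum>i\<in>I. \<integral>\<^sup>+w. ?F w * indicator (ball (z i) \<rho>) w \<partial>lborel)"
    by (intro sum_mono area_submean holomorphic_on_subset[OF hol] sub \<rho>)
  also have "\<dots> = (\<integral>\<^sup>+w. (\<Sum>i\<in>I. ?F w * indicator (ball (z i) \<rho>) w) \<partial>lborel)"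
    by (rule nn_integral_sum[symmetric]) (rule meas)
  also have "\<dots> \<le> (\<integral>\<^sup>+w. ?F w * indicator (ball 0 1) w \<partial>lborel)" by (intro nn_integral_mono pt)
  also have "\<dots> = ennreal (pi * (bergman_norm f)\<^sup>2)" by (rule bergman_norm_sq_nn[OF f, symmetric])
  finally have "pi * (\<rho>\<^sup>2 * (\<Sum>i\<in>I. (cmod (f (z i)))\<^sup>2)) \<le> pi * (bergman_norm f)\<^sup>2"
    by (subst (asm) ennreal_le_iff) auto
  thus ?thesis using pi_gt_zero by (simp only: mult_le_cancel_left_pos)
qed

text \<open>In degrees at least m the squared norm of a monomial is at most 1 / (m + 1); the factor
  2 is that of the monomial estimate. The window contains exactly m degrees.\<close>

lemma bergman_polynomial_norm_sq_le:
  fixes a :: "nat \<Rightarrow> complex" and m :: nat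
  defines "f \<equiv> (\<Sum>j\<in>{m..<2*m}. cscale (a j) (disc_monomial j))"
  shows "f \<in> bergman_space" "(bergman_norm f)\<^sup>2 \<le> 2 / (m + 1) * (\<Sum>j\<in>{m..<2*m}. (cmod (a j))\<^sup>2)"
    "z \<in> ball 0 1 \<Longrightarrow> f z = (\<Sum>j\<in>{m..<2*m}. a j * z ^ j)"
proof -
  define b where "b j = (if m \<le> j then a j else 0)" for j
  have sumapp: "(\<Sum>j\<in>J. cscale (a j) (disc_monomial j)) z = (\<Sum>j\<in>J. a j * disc_monomial j z)" if "finite J" for J z
    using that by (induction J rule: finite_induct) (auto simp: cscale_def)
  show mem: "f \<in> bergman_space" unfolding f_def by (intro bergman.sum_mem disc_monomial_bergman) auto
  show fz: "z \<in> ball 0 1 \<Longrightarrow> f z = (\<Sum>j\<in>{m..<2*m}. a j * z ^ j)" for z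
    unfolding f_def by (simp add: sumapp disc_monomial_def)
  have fb: "f z = (\<Sum>j<2*m. b j * z ^ j)" if "z \<in> ball 0 1" for z
    unfolding fz[OF that] by (intro sum.mono_neutral_cong_left) (auto simp: b_def)
  have "ennreal (pi * (bergman_norm f)\<^sup>2) = (\<integral>\<^sup>+w. ennreal ((cmod (f w))\<^sup>2) * indicator (ball 0 1) w \<partial>lborel)"
    by (rule bergman_norm_sq_nn[OF mem])
  also have "\<dots> = (\<integral>\<^sup>+w. ennreal ((cmod (\<Sum>j<2*m. b j * w ^ j))\<^sup>2) * indicator (ball 0 1) w \<partial>lborel)"
    by (intro nn_integral_cong) (auto simp: fb indicator_def)
  also have "\<dots> \<le> ennreal (2 * pi / (m + 1) * (\<Sum>j<2*m. (cmod (b j))\<^sup>2))"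
    by (rule disc_area_polynomial_le) (simp add: b_def)
  finally have "pi * (bergman_norm f)\<^sup>2 \<le> 2 * pi / (m + 1) * (\<Sum>j<2*m. (cmod (b j))\<^sup>2)"
    by (subst (asm) ennreal_le_iff) (auto intro!: mult_nonneg_nonneg divide_nonneg_nonneg sum_nonneg)
  also have "(\<Sum>j<2*m. (cmod (b j))\<^sup>2) = (\<Sum>j\<in>{m..<2*m}. (cmod (a j))\<^sup>2)"
    by (intro sum.mono_neutral_cong_right) (auto simp: b_def)
  finally have "pi * (bergman_norm f)\<^sup>2 \<le> pi * (2 / (m + 1) * (\<Sum>j\<in>{m..<2*m}. (cmod (a j))\<^sup>2))" by (simp add: mult.assoc mult.left_commute)
  thus "(bergman_norm f)\<^sup>2 \<le> 2 / (m + 1) * (\<Sum>j\<in>{m..<2*m}. (cmod (a j))\<^sup>2)"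
    using pi_gt_zero by (simp only: mult_le_cancel_left_pos)
qed

text \<open>A geometric sum whose ratio is an m-th root of unity, different from 1 for distinct j
  and l because |j - l| < m.\<close>

lemma roots_of_unity_orthogonal:
  fixes j l m :: nat
  assumes "j < m" "l < m"
  shows "(\<Sum>k<m. (cis (2 * pi * k / m) ^ j * cnj (cis (2 * pi * k / m)) ^ l)) = (if j = l then of_nat m else 0)"
proof -
  define x where "x = cis (2 * pi * (real j - real l) / m)"
  have m: "0 < m" using assms by simp
  have eq: "cis (2 * pi * k / m) ^ j * cnj (cis (2 * pi * k / m)) ^ l = x ^ k" for k
  proof -
    have "cis (2 * pi * k / m) ^ j * cnj (cis (2 * pi * k / m)) ^ l
        = cis (real j * (2 * pi * k / m) + real l * (- (2 * pi * k / m)))"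
      by (simp only: cis_cnj Complex.DeMoivre cis_mult)
    also have "\<dots> = cis (real k * (2 * pi * (real j - real l) / m))"
      by (rule arg_cong[of _ _ cis]) (simp add: diff_divide_distrib algebra_simps)
    finally show ?thesis by (simp only: x_def Complex.DeMoivre)
  qed
  show ?thesis
  proof (cases "j = l")
    case True
    hence "x = 1" by (simp add: x_def)
    thus ?thesis unfolding eq using True by simp
  next
    case False
    have "x \<noteq> 1"
    proof
      assume "x = 1"
      hence "Re x = 1" by simp
      hence "cos (2 * pi * (real j - real l) / m) = 1" by (simp add: x_def)
      then obtain i :: int where "2 * pi * (real j - real l) / m = of_int i * 2 * pi"
        by (auto simp: cos_one_2pi_int)
      hence "(2 * pi) * ((real j - real l) / m) = (2 * pi) * of_int i" by (simp add: mult.commute)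
      hence "(real j - real l) / m = of_int i" using pi_neq_zero by (subst (asm) mult_cancel_left) auto
      hence "real j - real l = of_int i * real m" using m by (simp add: field_simps)
      hence "of_int (int j - int l) = (of_int (i * int m) :: real)" by simp
      hence "int j - int l = i * int m" by (simp only: of_int_eq_iff)
      moreover have "\<bar>int j - int l\<bar> < int m" using assms by auto
      ultimately have "\<bar>i\<bar> * int m < 1 * int m" by (simp add: abs_mult)
      hence "i = 0" using m by (simp only: mult_less_cancel_right_pos of_nat_0_less_iff)
      thus False using \<open>int j - int l = i * int m\<close> False by simp
    qed
    moreover have "x ^ m = 1"
    proof -
      have "x ^ m = cis (real m * (2 * pi * (real j - real l) / m))" by (simp only: x_def Complex.DeMoivre)
      also have "real m * (2 * pi * (real j - real l) / m) = 2 * pi * of_int (int j - int l)" using m by simp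
      finally show ?thesis by (simp only: cis_multiple_2pi Ints_of_int)
    qed
    ultimately have "(\<Sum>k<m. x ^ k) = 0" by (simp add: geometric_sum)
    thus ?thesis unfolding eq using False by simp
  qed
qed

text \<open>The discrete Fourier transform is unitary up to scaling, so m values on a regular m-gon
  recover the coefficient norm exactly.\<close>

lemma discrete_parseval:
  fixes b :: "nat \<Rightarrow> complex"
  shows "(\<Sum>k<m. (cmod (\<Sum>j<m. b j * cis (2 * pi * real k / real m) ^ j))\<^sup>2) = m * (\<Sum>j<m. (cmod (b j))\<^sup>2)"
proof -
  have "complex_of_real (\<Sum>k<m. (cmod (\<Sum>j<m. b j * cis (2 * pi * real k / real m) ^ j))\<^sup>2)
     = (\<Sum>k<m. \<Sum>j<m. \<Sum>l<m. b j * cnj (b l) * (cis (2 * pi * k / m) ^ j * cnj (cis (2 * pi * k / m)) ^ l))"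
    by (simp only: of_real_sum of_real_norm_sq_sum)
  also have "\<dots> = (\<Sum>j<m. \<Sum>k<m. \<Sum>l<m. b j * cnj (b l) * (cis (2 * pi * k / m) ^ j * cnj (cis (2 * pi * k / m)) ^ l))"
    by (rule sum.swap)
  also have "\<dots> = (\<Sum>j<m. \<Sum>l<m. \<Sum>k<m. b j * cnj (b l) * (cis (2 * pi * k / m) ^ j * cnj (cis (2 * pi * k / m)) ^ l))"
    by (intro sum.cong refl sum.swap)
  also have "\<dots> = (\<Sum>j<m. \<Sum>l<m. b j * cnj (b l) * (if j = l then of_nat m else 0))"
    unfolding sum_distrib_left[symmetric] by (intro sum.cong refl arg_cong2[of _ _ _ _ "(*)"] roots_of_unity_orthogonal) auto
  also have "\<dots> = (\<Sum>j<m. b j * cnj (b j) * of_nat m)"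
    by (simp add: if_distrib[of "\<lambda>x. _ * x"] cong: if_cong)
  also have "\<dots> = of_real (m * (\<Sum>j<m. (cmod (b j))\<^sup>2))"
    by (simp add: complex_norm_square[symmetric] sum_distrib_left mult_ac)
  finally show ?thesis by (simp only: of_real_eq_iff)
qed

section \<open>The composition operator on the Bergman space\<close>

lemma sin_ge_half:
  fixes y :: real
  assumes "0 \<le> y" "y \<le> 1"
  shows "y / 2 \<le> sin y"
proof (cases "y = 0")
  case False
  have "\<exists>z. 0 < z \<and> z < y \<and> sin y - sin 0 = (y - 0) * cos z"
    using assms False by (intro MVT2) (auto intro!: derivative_eq_intros)
  then obtain z where z: "0 < z" "z < y" "sin y = y * cos z" by auto
  have "cos (pi / 3) \<le> cos z" using z assms pi_gt3 by (intro cos_monotone_0_pi_le) auto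
  hence "1 / 2 \<le> cos z" by (simp add: cos_60)
  hence "y * (1 / 2) \<le> y * cos z" using assms by (intro mult_left_mono) auto
  thus ?thesis using z(3) by simp
qed simp

text \<open>With v the Cayley image of z, 1 - z = 2 / (v + 1) and 1 - |z|^2 = Re v * |1 - z|^2,
  while |v + 1| is at most 2 * exp (2 * Re w).\<close>

lemma from_strip_modulus:
  assumes "0 < Im w" "Im w < pi / 2" "0 \<le> Re w"
  shows "exp (- 2 * Re w) * sin (2 * Im w) / 2 \<le> 1 - cmod (from_strip w)"
proof -
  let ?v = "- \<i> * exp (2 * w)"
  let ?z = "from_strip w"
  have v: "0 < Re ?v" by (rule from_strip(1)[OF assms(1,2)])
  have nv: "cmod ?v = exp (2 * Re w)" by (simp add: norm_mult)
  have n: "?v + 1 \<noteq> 0"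
  proof
    assume "?v + 1 = 0" hence "Re (?v + 1) = 0" by (simp only: zero_complex.sel)
    thus False using v by simp
  qed
  have "cmod (?v + 1) \<le> exp (2 * Re w) + 1" using norm_triangle_ineq[of ?v 1] nv by simp
  also have "\<dots> \<le> 2 * exp (2 * Re w)" using assms(3) by simp
  finally have le: "cmod (?v + 1) \<le> 2 * exp (2 * Re w)" .
  have c: "cayley ?z = ?v" unfolding cayley_def from_strip_def using n by (simp add: field_simps)
  have "1 - ?z = 2 / (?v + 1)" unfolding from_strip_def using n by (simp add: field_simps)
  hence n1: "cmod (1 - ?z) = 2 / cmod (?v + 1)" by (simp only: norm_divide norm_numeral)
  have z1: "cmod ?z < 1" by (rule from_strip(2)[OF assms(1,2)])
  have pos: "0 < cmod (?v + 1)" using n by simp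
  have "Re ?v = (1 - (cmod ?z)\<^sup>2) / (2 / cmod (?v + 1))\<^sup>2"
    using Re_cayley[of ?z] unfolding c n1 .
  hence "1 - (cmod ?z)\<^sup>2 = Re ?v * (2 / cmod (?v + 1))\<^sup>2" using pos by (simp add: field_simps)
  also have "\<dots> \<ge> Re ?v * (2 / (2 * exp (2 * Re w)))\<^sup>2"
    using v le pos by (intro mult_left_mono power_mono divide_left_mono) auto
  also have "Re ?v * (2 / (2 * exp (2 * Re w)))\<^sup>2 = exp (- 2 * Re w) * sin (2 * Im w)"
    by (simp add: Im_exp exp_minus power2_eq_square field_simps)
  finally have 1: "exp (- 2 * Re w) * sin (2 * Im w) \<le> 1 - (cmod ?z)\<^sup>2" .
  have "1 - (cmod ?z)\<^sup>2 = (1 - cmod ?z) * (1 + cmod ?z)" by (simp add: power2_eq_square algebra_simps)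
  also have "\<dots> \<le> (1 - cmod ?z) * 2" using z1 by (intro mult_left_mono) auto
  finally show ?thesis using 1 by simp
qed

text \<open>The images differ by 2 * (v - v') / ((v + 1) * (v' + 1)), and |v - v'| is at least the
  difference of the moduli, which depends on the real parts alone.\<close>

lemma from_strip_separation:
  assumes w: "0 < Im w" "Im w < pi / 2" "0 \<le> Re w" and w': "0 < Im w'" "Im w' < pi / 2" "0 \<le> Re w'"
    and X: "Re w \<le> X" "Re w' \<le> X"
  shows "exp (- 2 * X) * \<bar>Re w - Re w'\<bar> \<le> cmod (from_strip w - from_strip w')"
proof -
  \<comment> \<open>With the real parts ordered, the factor exp (2 * Re w') of the smaller one
    cancels and exp (- 2 * Re w) remains.\<close>
  have ordered: "exp (- 2 * X) * (Re w - Re w') \<le> cmod (from_strip w - from_strip w')"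
    if w: "0 < Im w" "Im w < pi / 2" "0 \<le> Re w" and w': "0 < Im w'" "Im w' < pi / 2" "0 \<le> Re w'"
    and X: "Re w \<le> X" "Re w' \<le> Re w" for w w'
  proof -
    define v where "v = - \<i> * exp (2 * w)"
    define v' where "v' = - \<i> * exp (2 * w')"
    have nv: "cmod v = exp (2 * Re w)" "cmod v' = exp (2 * Re w')" by (simp_all add: v_def v'_def norm_mult)
    have v: "0 < Re v" "0 < Re v'" unfolding v_def v'_def using from_strip(1) w w' by blast+
    have n: "v + 1 \<noteq> 0" "v' + 1 \<noteq> 0" using v by (auto simp: complex_eq_iff)
    have "cmod (v + 1) \<le> exp (2 * Re w) + 1" "cmod (v' + 1) \<le> exp (2 * Re w') + 1"
      using norm_triangle_ineq[of v 1] norm_triangle_ineq[of v' 1] nv by simp_all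
    moreover have "1 \<le> exp (2 * Re w)" "1 \<le> exp (2 * Re w')" using w w' by simp_all
    ultimately have le: "cmod (v + 1) \<le> 2 * exp (2 * Re w)" "cmod (v' + 1) \<le> 2 * exp (2 * Re w')" by linarith+
    have "1 + (2 * Re w - 2 * Re w') \<le> exp (2 * Re w - 2 * Re w')" by (rule exp_ge_add_one_self)
    hence "exp (2 * Re w') * (1 + (2 * Re w - 2 * Re w')) \<le> exp (2 * Re w') * exp (2 * Re w - 2 * Re w')"
      by (intro mult_left_mono) auto
    hence "2 * exp (2 * Re w') * (Re w - Re w') \<le> exp (2 * Re w) - exp (2 * Re w')"
      by (simp add: exp_add[symmetric] algebra_simps)
    also have "\<dots> \<le> cmod (v - v')" using norm_triangle_ineq2[of v v'] nv by simp
    finally have d: "2 * exp (2 * Re w') * (Re w - Re w') \<le> cmod (v - v')" .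
    have "from_strip w - from_strip w' = 2 * (v - v') / ((v + 1) * (v' + 1))"
      unfolding from_strip_def v_def[symmetric] v'_def[symmetric] using n by (simp add: field_simps)
    hence eq: "cmod (from_strip w - from_strip w') = 2 * cmod (v - v') / (cmod (v + 1) * cmod (v' + 1))"
      by (simp only: norm_divide norm_mult norm_numeral)
    have "exp (- 2 * X) * (Re w - Re w') \<le> exp (- 2 * Re w) * (Re w - Re w')"
      using X by (intro mult_right_mono) auto
    also have "\<dots> = 2 * (2 * exp (2 * Re w') * (Re w - Re w')) / ((2 * exp (2 * Re w)) * (2 * exp (2 * Re w')))"
      by (simp add: exp_minus field_simps)
    also have "\<dots> \<le> 2 * cmod (v - v') / ((2 * exp (2 * Re w)) * (2 * exp (2 * Re w')))"
      using d by (intro divide_right_mono mult_left_mono) auto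
    also have "\<dots> \<le> 2 * cmod (v - v') / (cmod (v + 1) * cmod (v' + 1))"
      using le n by (intro divide_left_mono mult_mono mult_pos_pos) auto
    finally show ?thesis unfolding eq .
  qed
  show ?thesis
  proof (cases "Re w' \<le> Re w")
    case True
    thus ?thesis using ordered[OF w w' X(1) True] by simp
  next
    case False
    thus ?thesis using ordered[OF w' w X(2)] by (simp add: norm_minus_commute)
  qed
qed

section \<open>Sample points and the Bergman lower bound\<close>

context spiral_symbol
begin

text \<open>Banach's fixed point theorem for w |-> c - i * H w on the disc of radius s / 2 around c
  = t + i * s: smallness of \<open>H\<close> keeps the disc invariant, its Lipschitz constant gives
  the contraction. Over a solution the symbol takes exactly the value exp (i * c).\<close>

lemma solve_strip_equation:
  assumes s: "0 < s" "s \<le> 1 / 4" and x: "0 \<le> x" "x + 1 \<le> t"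
    and small: "\<And>w. w \<in> quarter_strip \<Longrightarrow> x \<le> Re w \<Longrightarrow> cmod (H w) \<le> s / 4"
  obtains w where "s / 2 \<le> Im w" "Im w \<le> 3 * s / 2" "\<bar>Re w - t\<bar> \<le> s / 2" "w \<in> quarter_strip"
    "w + \<i> * H w = Complex t s"
proof -
  let ?c = "Complex t s"
  let ?K = "cball ?c (s / 2)"
  have K: "s / 2 \<le> Im w \<and> Im w \<le> 3 * s / 2 \<and> \<bar>Re w - t\<bar> \<le> s / 2" if "w \<in> ?K" for w
  proof -
    have "cmod (w - ?c) \<le> s / 2" using that by (simp add: dist_norm norm_minus_commute)
    hence "\<bar>Re (w - ?c)\<bar> \<le> s / 2" "\<bar>Im (w - ?c)\<bar> \<le> s / 2"
      using abs_Re_le_cmod[of "w - ?c"] abs_Im_le_cmod[of "w - ?c"] by linarith+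
    hence "\<bar>Re w - t\<bar> \<le> s / 2" "\<bar>Im w - s\<bar> \<le> s / 2" by simp_all
    thus ?thesis by (intro conjI) linarith+
  qed
  have strip: "w \<in> quarter_strip" if "w \<in> ?K" for w
    using K[OF that] s pi_gt3 unfolding quarter_strip_def mem_Collect_eq by linarith
  have Re_ge: "x \<le> Re w" if "w \<in> ?K" for w using K[OF that] s x by linarith
  have "\<exists>!w\<in>?K. ?c - \<i> * H w = w"
  proof (rule Banach_fix[where c = "1 / 4"])
    show "complete ?K" by (simp add: complete_eq_closed)
    show "?K \<noteq> {}" using s by auto
    show "(\<lambda>w. ?c - \<i> * H w) ` ?K \<subseteq> ?K"
    proof (rule image_subsetI)
      fix w assume w: "w \<in> ?K"
      have "cmod (H w) \<le> s / 4" by (rule small[OF strip[OF w] Re_ge[OF w]])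
      thus "?c - \<i> * H w \<in> ?K" using s by (simp add: dist_norm norm_mult)
    qed
    show "dist (?c - \<i> * H w) (?c - \<i> * H w') \<le> 1 / 4 * dist w w'" if "w \<in> ?K" "w' \<in> ?K" for w w'
    proof -
      have "(?c - \<i> * H w) - (?c - \<i> * H w') = - (\<i> * (H w - H w'))" by (simp add: algebra_simps)
      hence "dist (?c - \<i> * H w) (?c - \<i> * H w') = cmod (H w - H w')"
        by (simp only: dist_norm norm_minus_cancel norm_mult norm_ii mult_1_left)
      thus ?thesis using H_lipschitz[OF strip[OF that(1)] strip[OF that(2)]] by (simp add: dist_norm)
    qed
  qed auto
  then obtain w where w: "w \<in> ?K" "?c - \<i> * H w = w" by blast
  have "w + \<i> * H w = ?c" using w(2) by (metis diff_add_cancel)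
  thus thesis using that K[OF w(1)] strip[OF w(1)] by blast
qed

lemma phi_from_strip:
  assumes "0 < Im w" "Im w < pi / 2" "w + \<i> * H w = Complex t s"
  shows "phi (from_strip w) = of_real (exp (- s)) * cis t"
proof -
  have "phi (from_strip w) = exp (\<i> * w - H w)" unfolding phi_def from_strip(3)[OF assms(1,2)] ..
  also have "\<i> * w - H w = \<i> * (w + \<i> * H w)" by (simp add: algebra_simps)
  also have "\<dots> = of_real (- s) + \<i> * of_real t" unfolding assms(3) by (simp add: complex_eq_iff)
  also have "exp \<dots> = of_real (exp (- s)) * cis t" by (simp only: exp_add cis_conv_exp exp_of_real)
  finally show ?thesis .
qed

text \<open>The targets are equally spaced over one turn at height 1 / m. Hitting them exactly puts
  the values of the symbol on a regular m-gon, as the discrete Parseval identity requires.\<close>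

lemma sample_points:
  fixes m :: nat
  assumes m: "4 \<le> m" and x: "0 \<le> x"
    and small: "\<And>w. w \<in> quarter_strip \<Longrightarrow> x \<le> Re w \<Longrightarrow> cmod (H w) \<le> 1 / (4 * m)"
  obtains z :: "nat \<Rightarrow> complex" where
    "\<And>k. k < m \<Longrightarrow> phi (z k) = of_real (exp (- 1 / m)) * cis (x + 1 + 2 * pi * k / m)"
    "\<And>k. k < m \<Longrightarrow> ball (z k) (exp (- 2 * (x + 9)) / (4 * m)) \<subseteq> ball 0 1"
    "\<And>k. k < m \<Longrightarrow> cmod (z k) < 1"
    "\<And>k l. k < m \<Longrightarrow> l < m \<Longrightarrow> k \<noteq> l \<Longrightarrow> 2 * (exp (- 2 * (x + 9)) / (4 * m)) \<le> cmod (z k - z l)"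
proof -
  define s where "s = 1 / real m"
  define t where "t k = x + 1 + 2 * pi * real k / m" for k
  \<comment> \<open>9 exceeds 1 + 2 * pi + 1 / 8, a bound for how far a solution can lie to the
    right of x.\<close>
  define X where "X = x + 9"
  have s: "0 < s" "s \<le> 1 / 4" using m by (auto simp: s_def field_simps)
  have "\<exists>w. s / 2 \<le> Im w \<and> Im w \<le> 3 * s / 2 \<and> \<bar>Re w - t k\<bar> \<le> s / 2 \<and> w \<in> quarter_strip \<and> w + \<i> * H w = Complex (t k) s" for k
  proof -
    have "x + 1 \<le> t k" by (simp add: t_def)
    moreover have "cmod (H w) \<le> s / 4" if "w \<in> quarter_strip" "x \<le> Re w" for w
      using small[OF that] by (simp add: s_def mult.commute)
    ultimately show ?thesis using solve_strip_equation[OF s x] by metis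
  qed
  then obtain w where w: "\<And>k. s / 2 \<le> Im (w k)" "\<And>k. Im (w k) \<le> 3 * s / 2" "\<And>k. \<bar>Re (w k) - t k\<bar> \<le> s / 2"
    "\<And>k. w k \<in> quarter_strip" "\<And>k. w k + \<i> * H (w k) = Complex (t k) s" by metis
  have im: "0 < Im (w k)" "Im (w k) < pi / 2" for k
    using w(1)[of k] w(2)[of k] s pi_gt3 by linarith+
  have re0: "0 \<le> Re (w k)" for k
  proof -
    have "x + 1 \<le> t k" by (simp add: t_def)
    thus ?thesis using w(3)[of k] s x by linarith
  qed
  have reX: "Re (w k) \<le> X" if "k < m" for k
  proof -
    have "2 * pi * real k / m \<le> 2 * pi" using that by (simp add: divide_le_eq)
    hence "t k \<le> x + 1 + 2 * pi" by (simp add: t_def)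
    moreover have "pi < 3.2" using pi_approx by simp
    ultimately show ?thesis using w(3)[of k] s unfolding X_def by linarith
  qed
  \<comment> \<open>The quarter combines sin (2 * Im w) \<ge> s / 2 with the factor 1 / 2 in
    \<open>from_strip_modulus\<close>.\<close>
  define \<rho> where "\<rho> = exp (- 2 * X) * s / 4"
  have rho: "exp (- 2 * (x + 9)) / (4 * m) = \<rho>" by (simp add: \<rho>_def X_def s_def)
  define z where "z k = from_strip (w k)" for k
  have phi: "phi (z k) = of_real (exp (- 1 / m)) * cis (x + 1 + 2 * pi * k / m)" for k
    using phi_from_strip[OF im[of k] w(5)[of k]] by (simp add: z_def s_def t_def)
  have gap: "\<rho> \<le> 1 - cmod (z k)" if "k < m" for k
  proof -
    have "s / 2 \<le> sin (2 * Im (w k))"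
    proof -
      have "(2 * Im (w k)) / 2 \<le> sin (2 * Im (w k))"
        using im[of k] w(2)[of k] s by (intro sin_ge_half) auto
      thus ?thesis using w(1)[of k] by simp
    qed
    moreover have "exp (- 2 * X) \<le> exp (- 2 * Re (w k))" using reX[OF that] by simp
    ultimately have "exp (- 2 * X) * (s / 2) \<le> exp (- 2 * Re (w k)) * sin (2 * Im (w k))"
      using s by (intro mult_mono) auto
    also have "\<dots> \<le> 2 * (1 - cmod (z k))" using from_strip_modulus[OF im(1)[of k] im(2)[of k] re0[of k]] by (simp add: z_def)
    finally show ?thesis by (simp add: \<rho>_def)
  qed
  have rho_pos: "0 < \<rho>" using s by (simp add: \<rho>_def)
  have lt1: "cmod (z k) < 1" if "k < m" for k using gap[OF that] rho_pos by linarith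
  have sub: "ball (z k) \<rho> \<subseteq> ball 0 1" if "k < m" for k
  proof
    fix u assume "u \<in> ball (z k) \<rho>"
    hence "cmod (u - z k) < \<rho>" by (simp add: dist_norm norm_minus_commute)
    moreover have "cmod u \<le> cmod (z k) + cmod (u - z k)" using norm_triangle_ineq[of "z k" "u - z k"] by simp
    ultimately show "u \<in> ball 0 1" using gap[OF that] by simp
  qed
  have sep: "2 * \<rho> \<le> cmod (z k - z l)" if kl: "k < m" "l < m" "k \<noteq> l" for k l
  proof -
    let ?d = "w k - w l" and ?e = "\<i> * (H (w k) - H (w l))"
    have tt: "t k - t l = 2 * pi * (real k - real l) / m" by (simp add: t_def diff_divide_distrib algebra_simps)
    have "1 \<le> \<bar>real k - real l\<bar>" using kl(3) by linarith
    hence "6 * 1 \<le> (2 * pi) * \<bar>real k - real l\<bar>" using pi_gt3 by (intro mult_mono) auto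
    hence "6 / real m \<le> (2 * pi) * \<bar>real k - real l\<bar> / m" by (intro divide_right_mono) auto
    \<comment> \<open>Distinct targets are at least 6 * s apart. The perturbation by
      \<open>H\<close> changes differences of real parts by at most a third, which leaves more than
      the separation s that is kept.\<close>
    hence t_ge: "6 * s \<le> \<bar>t k - t l\<bar>" unfolding tt by (simp add: s_def abs_mult)
    have "?d + ?e = Complex (t k) s - Complex (t l) s"
      unfolding w(5)[symmetric] by (simp add: algebra_simps)
    hence de: "?d + ?e = of_real (t k - t l)" by (simp add: complex_eq_iff)
    have e: "cmod ?e \<le> 1 / 4 * cmod ?d" using H_lipschitz[OF w(4) w(4), of k l] by (simp add: norm_mult)
    have "cmod ?d \<le> cmod (?d + ?e) + cmod ?e" using norm_triangle_ineq4[of "?d + ?e" ?e] by simp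
    hence d: "cmod ?d \<le> \<bar>t k - t l\<bar> + 1 / 4 * cmod ?d" unfolding de using e by (simp only: norm_of_real)
    have "Re ?d = (t k - t l) - Re ?e" using arg_cong[OF de, of Re] by (simp only: plus_complex.sel Re_complex_of_real)
    moreover have "\<bar>Re ?e\<bar> \<le> 1 / 4 * cmod ?d" using abs_Re_le_cmod[of ?e] e by linarith
    ultimately have "\<bar>Re ?d\<bar> \<ge> \<bar>t k - t l\<bar> - 1 / 4 * cmod ?d" by linarith
    hence "s \<le> \<bar>Re ?d\<bar>" using d t_ge s by linarith
    hence "exp (- 2 * X) * s \<le> exp (- 2 * X) * \<bar>Re (w k) - Re (w l)\<bar>" by simp
    also have "\<dots> \<le> cmod (z k - z l)" unfolding z_def
      by (intro from_strip_separation im re0 reX kl)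
    finally have le: "exp (- 2 * X) * s \<le> cmod (z k - z l)" .
    have "0 < exp (- 2 * X) * s" using s by simp
    thus ?thesis using le unfolding \<rho>_def by linarith
  qed
  show thesis
  proof (rule that[of z])
  qed (use phi sub lt1 sep in \<open>simp_all only: rho\<close>)
qed

text \<open>x is the place where the decay bound for \<open>H\<close> falls to 1 / (4 * m), the size
  that the fixed point argument tolerates at height 1 / m; exp (- 2 * x) is then a constant times a
  power of m.\<close>

lemma small_H:
  fixes m :: nat
  assumes \<eta>: "0 < \<eta>" "\<eta> < p" and m: "1 \<le> m"
  defines "x \<equiv> ln (4 * (2 + 2 / \<eta>)\<^sup>2 * m) / (p - \<eta>)"
  shows "0 \<le> x" "\<And>w. w \<in> quarter_strip \<Longrightarrow> x \<le> Re w \<Longrightarrow> cmod (H w) \<le> 1 / (4 * m)"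
    "exp (- 2 * x) = (4 * (2 + 2 / \<eta>)\<^sup>2) powr (- 2 / (p - \<eta>)) * real m powr (- 2 / (p - \<eta>))"
proof -
  let ?C = "(2 + 2 / \<eta>)\<^sup>2"
  have C: "1 \<le> ?C" using \<eta> by (intro one_le_power) auto
  have Cm: "1 \<le> 4 * ?C * m"
  proof -
    have "1 * 1 \<le> (4 * ?C) * real m" using C m by (intro mult_mono) auto
    thus ?thesis by simp
  qed
  show x0: "0 \<le> x" unfolding x_def using Cm \<eta> by (intro divide_nonneg_nonneg) auto
  have ex: "exp (- (p - \<eta>) * x) = 1 / (4 * ?C * m)"
  proof -
    have "(p - \<eta>) * x = ln (4 * ?C * m)" unfolding x_def using \<eta> by simp
    hence "exp (- (p - \<eta>) * x) = exp (- ln (4 * ?C * m))" by (simp only: mult_minus_left)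
    also have "\<dots> = inverse (4 * ?C * m)" unfolding exp_minus using Cm by (subst exp_ln) linarith+
    finally show ?thesis by (simp only: inverse_eq_divide)
  qed
  show "cmod (H w) \<le> 1 / (4 * m)" if w: "w \<in> quarter_strip" "x \<le> Re w" for w
  proof -
    have "cmod (H w) \<le> ?C * exp (- (p - \<eta>) * Re w)" using H_decay[OF \<eta> w(1)] w(2) x0 by simp
    also have "\<dots> \<le> ?C * exp (- (p - \<eta>) * x)" using w(2) \<eta> by (intro mult_left_mono) auto
    also have "\<dots> = 1 / (4 * m)"
    proof -
      have "?C \<noteq> 0" using C by linarith
      thus ?thesis unfolding ex by simp
    qed
    finally show ?thesis .
  qed
  have "exp (- 2 * x) = (4 * ?C * m) powr (- 2 / (p - \<eta>))" using Cm m by (auto simp: powr_def x_def)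
  also have "\<dots> = (4 * ?C) powr (- 2 / (p - \<eta>)) * real m powr (- 2 / (p - \<eta>))" by (rule powr_mult)
  finally show "exp (- 2 * x) = (4 * ?C) powr (- 2 / (p - \<eta>)) * real m powr (- 2 / (p - \<eta>))" .
qed

text \<open>The m-dimensional space of polynomials with degrees from m to 2 * m - 1 meets the kernel
  of every operator of rank below m. On an element of that kernel, T - R acts as the composition
  operator, whose values at the sample points are bounded below by discrete Parseval.\<close>

lemma bergman_approximation_number_ge:
  fixes m :: nat
  assumes T: "bounded_operator bergman_space bergman_norm Cphi" and m: "4 \<le> m" and x: "0 \<le> x"
    and small: "\<And>w. w \<in> quarter_strip \<Longrightarrow> x \<le> Re w \<Longrightarrow> cmod (H w) \<le> 1 / (4 * m)"
  shows "exp (- 2 * (x + 9)) / 8 * exp (- 2) \<le> approximation_number bergman_space bergman_norm Cphi m"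
proof -
  obtain z :: "nat \<Rightarrow> complex" where z:
    "\<And>k. k < m \<Longrightarrow> phi (z k) = of_real (exp (- 1 / m)) * cis (x + 1 + 2 * pi * k / m)"
    "\<And>k. k < m \<Longrightarrow> ball (z k) (exp (- 2 * (x + 9)) / (4 * m)) \<subseteq> ball 0 1"
    "\<And>k. k < m \<Longrightarrow> cmod (z k) < 1"
    "\<And>k l. k < m \<Longrightarrow> l < m \<Longrightarrow> k \<noteq> l \<Longrightarrow> 2 * (exp (- 2 * (x + 9)) / (4 * m)) \<le> cmod (z k - z l)"
    using sample_points[OF m x small] by blast
  define \<rho> where "\<rho> = exp (- 2 * (x + 9)) / (4 * m)"
  define \<tau> where "\<tau> = of_real (exp (- 1 / m)) * cis (x + 1)"
  have m0: "0 < real m" using m by simp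
  have rho: "0 < \<rho>" using m0 by (simp add: \<rho>_def)
  have n\<tau>: "cmod \<tau> = exp (- 1 / m)" by (simp add: \<tau>_def norm_mult)
  have phiz: "phi (z k) = \<tau> * cis (2 * pi * k / m)" if "k < m" for k
    unfolding z(1)[OF that] \<tau>_def by (simp add: cis_mult)
  obtain n where n: "m = Suc n" using m by (cases m) auto
  have "exp (- 2 * (x + 9)) / 8 * exp (- 2) \<le> operator_norm bergman_space bergman_norm (Cphi - R)"
    if R: "bounded_operator bergman_space bergman_norm R" "rank_less bergman_space R (Suc n)" for R
  proof -
    let ?I = "{m..<2*m}"
    have cardI: "card ?I = Suc n" using n by simp
    obtain a0 :: "nat \<Rightarrow> complex" where a0: "\<exists>i\<in>?I. a0 i \<noteq> 0" "R (\<Sum>j\<in>?I. cscale (a0 j) (disc_monomial j)) = 0"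
      using bergman.rank_less_kernel[OF R(1), of ?I disc_monomial] R(2) unfolding cardI
      using disc_monomial_bergman by auto
    define Q where "Q = (\<Sum>j\<in>?I. (cmod (a0 j))\<^sup>2)"
    have Q: "0 < Q"
    proof -
      obtain i where "i \<in> ?I" "a0 i \<noteq> 0" using a0(1) by blast
      hence "0 < (\<Sum>j\<in>?I. (cmod (a0 j))\<^sup>2)" by (intro sum_pos2[of _ i]) auto
      thus ?thesis by (simp add: Q_def)
    qed
    \<comment> \<open>Makes the sum of the squared coefficients (m + 1) / 2, for which the
      polynomial estimate gives Bergman norm at most 1.\<close>
    define \<gamma> where "\<gamma> = sqrt ((m + 1) / (2 * Q))"
    have g2: "\<gamma>\<^sup>2 = (m + 1) / (2 * Q)" using Q by (simp add: \<gamma>_def)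
    define a where "a j = of_real \<gamma> * a0 j" for j
    define f where "f = (\<Sum>j\<in>?I. cscale (a j) (disc_monomial j))"
    have asum: "(\<Sum>j\<in>?I. (cmod (a j))\<^sup>2) = (m + 1) / 2"
    proof -
      have "(\<Sum>j\<in>?I. (cmod (a j))\<^sup>2) = \<gamma>\<^sup>2 * Q"
        by (simp add: a_def Q_def norm_mult power_mult_distrib sum_distrib_left)
      thus ?thesis using Q by (simp add: g2)
    qed
    have fm: "f \<in> bergman_space" and fn: "(bergman_norm f)\<^sup>2 \<le> 2 / (m + 1) * (\<Sum>j\<in>?I. (cmod (a j))\<^sup>2)"
      and fz: "\<And>z. z \<in> ball 0 1 \<Longrightarrow> f z = (\<Sum>j\<in>?I. a j * z ^ j)"
      unfolding f_def using bergman_polynomial_norm_sq_le[where a = a and m = m] by blast+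
    have fn1: "bergman_norm f \<le> 1"
    proof -
      have "2 / (real m + 1) * ((real m + 1) / 2) = 1" using m0 by (simp add: field_simps)
      hence "(bergman_norm f)\<^sup>2 \<le> 1\<^sup>2" using fn unfolding asum by (simp only: of_nat_add of_nat_1 power_one)
      thus ?thesis by (rule power2_le_imp_le) simp
    qed
    have "f = cscale (of_real \<gamma>) (\<Sum>j\<in>?I. cscale (a0 j) (disc_monomial j))"
      unfolding f_def a_def by (simp add: cfun.scale_sum_right)
    hence Rf: "R f = 0"
      using bergman.bounded_operatorD(3)[OF R(1) bergman.sum_mem[OF _ disc_monomial_bergman], of ?I "of_real \<gamma>" a0] a0(2)
      by (simp add: cscale_def zero_fun_def)
    have sample: "(\<Sum>k<m. (cmod (Cphi f (z k)))\<^sup>2) = exp (- 2) * (m * (\<Sum>j<m. (cmod (a (j + m) * \<tau> ^ j))\<^sup>2))"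
    proof -
      have "(cmod (Cphi f (z k)))\<^sup>2 = exp (- 2) * (cmod (\<Sum>j<m. (a (j + m) * \<tau> ^ j) * cis (2 * pi * real k / real m) ^ j))\<^sup>2" if k: "k < m" for k
      proof -
        let ?u = "\<tau> * cis (2 * pi * k / m)"
        have "z k \<in> ball 0 1" using z(3)[OF k] by simp
        hence "Cphi f (z k) = (\<Sum>j\<in>?I. a j * ?u ^ j)"
          using fz[OF phi_disc, of "z k"] phiz[OF k] by (simp add: composition_operator_def)
        also have "\<dots> = (\<Sum>j<m. a (j + m) * ?u ^ (j + m))"
          by (rule sum.reindex_bij_witness[of _ "\<lambda>j. j + m" "\<lambda>j. j - m"]) auto
        also have "\<dots> = ?u ^ m * (\<Sum>j<m. (a (j + m) * \<tau> ^ j) * cis (2 * pi * real k / real m) ^ j)"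
          by (simp add: sum_distrib_left power_add power_mult_distrib mult_ac)
        finally have eq: "Cphi f (z k) = ?u ^ m * (\<Sum>j<m. (a (j + m) * \<tau> ^ j) * cis (2 * pi * real k / real m) ^ j)" .
        \<comment> \<open>The common power of degree m costs a factor exp (- 2) on the circle of
          radius exp (- 1 / m).\<close>
        have "(cmod (?u ^ m))\<^sup>2 = (exp (- 1 / m) ^ m)\<^sup>2" by (simp add: norm_power norm_mult n\<tau>)
        also have "exp (- 1 / m) ^ m = exp (- 1)" unfolding exp_of_nat_mult[symmetric] using m0 by simp
        also have "(exp (- 1))\<^sup>2 = exp (- 2 :: real)" by (simp add: exp_double[symmetric])
        finally show ?thesis unfolding eq norm_mult power_mult_distrib by (simp only:)
      qed
      hence "(\<Sum>k<m. (cmod (Cphi f (z k)))\<^sup>2) = (\<Sum>k<m. exp (- 2) * (cmod (\<Sum>j<m. (a (j + m) * \<tau> ^ j) * cis (2 * pi * real k / real m) ^ j))\<^sup>2)"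
        by (intro sum.cong) auto
      also have "\<dots> = exp (- 2) * (m * (\<Sum>j<m. (cmod (a (j + m) * \<tau> ^ j))\<^sup>2))"
        by (simp only: sum_distrib_left[symmetric] discrete_parseval)
      finally show ?thesis .
    qed
    have "(\<Sum>j<m. (cmod (a (j + m)))\<^sup>2 * exp (- 2)) \<le> (\<Sum>j<m. (cmod (a (j + m) * \<tau> ^ j))\<^sup>2)"
    proof (rule sum_mono)
      fix j assume "j \<in> {..<m}"
      hence "real j / m \<le> 1" by simp
      hence "exp (- 2) \<le> exp (- 2 * (real j / m))" by simp
      also have "\<dots> = (exp (- 1 / m) ^ j)\<^sup>2" by (simp add: exp_of_nat_mult[symmetric] exp_double[symmetric])
      finally have "exp (- 2) \<le> (exp (- 1 / m) ^ j)\<^sup>2" .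
      thus "(cmod (a (j + m)))\<^sup>2 * exp (- 2) \<le> (cmod (a (j + m) * \<tau> ^ j))\<^sup>2"
        by (simp add: norm_mult norm_power n\<tau> power_mult_distrib mult_left_mono)
    qed
    moreover have "(\<Sum>j<m. (cmod (a (j + m)))\<^sup>2) = (\<Sum>j\<in>?I. (cmod (a j))\<^sup>2)"
      by (rule sum.reindex_bij_witness[of _ "\<lambda>j. j - m" "\<lambda>j. j + m"]) auto
    ultimately have a_ge: "(m + 1) / 2 * exp (- 2) \<le> (\<Sum>j<m. (cmod (a (j + m) * \<tau> ^ j))\<^sup>2)"
      unfolding sum_distrib_right[symmetric] asum by simp
    \<comment> \<open>The 1 / (16 * m^2) in \<rho>^2 meets m * (m + 1) / 2; the product exceeds 1 /
      32, of which 1 / 64 is kept for a simple square root.\<close>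
    have "(exp (- 2 * (x + 9)) / 8 * exp (- 2))\<^sup>2 \<le> \<rho>\<^sup>2 * (exp (- 2) * (m * ((m + 1) / 2 * exp (- 2))))"
    proof -
      have e4: "exp (- 2) * exp (- 2 :: real) = (exp (- 2))\<^sup>2" by (simp add: power2_eq_square)
      have "(exp (- 2 * (x + 9)) / 8 * exp (- 2))\<^sup>2 = (exp (- 2 * (x + 9)))\<^sup>2 / 64 * (exp (- 2))\<^sup>2"
        by (simp only: power_mult_distrib power_divide) simp
      also have "\<dots> \<le> (exp (- 2 * (x + 9)))\<^sup>2 * (((m + 1) / m) / 32) * (exp (- 2))\<^sup>2"
        using m0 by (intro mult_right_mono) (auto simp: field_simps)
      also have "\<dots> = \<rho>\<^sup>2 * (exp (- 2) * (m * ((m + 1) / 2 * exp (- 2))))"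
        using m0 unfolding \<rho>_def power_divide e4[symmetric] by (simp add: field_simps power2_eq_square)
      finally show ?thesis .
    qed
    also have "\<dots> \<le> \<rho>\<^sup>2 * (\<Sum>k<m. (cmod (Cphi f (z k)))\<^sup>2)"
      unfolding sample using a_ge by (intro mult_left_mono) auto
    also have "\<dots> \<le> (bergman_norm (Cphi f))\<^sup>2"
      using z unfolding \<rho>_def[symmetric]
      by (intro bergman_norm_sq_ge_samples bergman.bounded_operatorD(1)[OF T] fm rho) auto
    finally have "exp (- 2 * (x + 9)) / 8 * exp (- 2) \<le> bergman_norm (Cphi f)"
      by (rule power2_le_imp_le) (intro bergman.norm_nonneg bergman.bounded_operatorD(1)[OF T] fm)
    also have "\<dots> = bergman_norm (Cphi f - R f)" unfolding Rf by simp
    also have "\<dots> \<le> operator_norm bergman_space bergman_norm (Cphi - R)"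
      by (rule bergman.norm_le_operator_norm_diff[OF T R(1) fm fn1])
    finally show ?thesis .
  qed
  thus ?thesis unfolding n by (intro bergman.approximation_number_ge) auto
qed

lemma Cphi_not_schatten_bergman:
  assumes q: "0 < q" "q < p / 2"
  shows "Cphi \<notin> schatten_class q bergman_space bergman_norm"
proof
  assume "Cphi \<in> schatten_class q bergman_space bergman_norm"
  hence T: "bounded_operator bergman_space bergman_norm Cphi"
    and summ: "summable (\<lambda>n. approximation_number bergman_space bergman_norm Cphi (Suc n) powr q)"
    by (auto simp: schatten_class_def compact_operator_def)
  \<comment> \<open>Makes the exponent - 2 / (p - \<eta>) equal to - 1 / q, so that the q-th powers
    dominate a multiple of the harmonic series.\<close>
  define \<eta> where "\<eta> = p - 2 * q"
  have \<eta>: "0 < \<eta>" "\<eta> < p" "p - \<eta> = 2 * q" using q by (auto simp: \<eta>_def)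
  define c where "c = (4 * (2 + 2 / \<eta>)\<^sup>2) powr (- 2 / (p - \<eta>)) * exp (- 18) / 8 * exp (- 2)"
  have "0 < (2 + 2 / \<eta>)\<^sup>2" using \<eta> by (intro zero_less_power add_pos_pos) auto
  hence c: "0 < c" by (simp add: c_def)
  \<comment> \<open>The bound starts at n = 3 because the construction asks for at least four sample
    points and the index is \<open>Suc n\<close>.\<close>
  have ge: "c powr q * inverse (real (Suc n)) \<le> approximation_number bergman_space bergman_norm Cphi (Suc n) powr q" if n: "3 \<le> n" for n
  proof -
    define x where "x = ln (4 * (2 + 2 / \<eta>)\<^sup>2 * Suc n) / (p - \<eta>)"
    note sm = small_H[OF \<eta>(1,2), of "Suc n", folded x_def]
    have "exp (- 2 * (x + 9)) / 8 * exp (- 2) \<le> approximation_number bergman_space bergman_norm Cphi (Suc n)"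
      using n by (intro bergman_approximation_number_ge T sm) auto
    moreover have "exp (- 2 * (x + 9)) / 8 * exp (- 2) = c * real (Suc n) powr (- 2 / (p - \<eta>))"
    proof -
      have "exp (- 2 * (x + 9)) = exp (- 2 * x) * exp (- 18)" by (simp add: exp_add[symmetric])
      thus ?thesis using sm(3) by (simp add: c_def)
    qed
    ultimately have "c * real (Suc n) powr (- 2 / (p - \<eta>)) \<le> approximation_number bergman_space bergman_norm Cphi (Suc n)"
      by simp
    hence "(c * real (Suc n) powr (- 2 / (p - \<eta>))) powr q \<le> approximation_number bergman_space bergman_norm Cphi (Suc n) powr q"
      using c q by (intro powr_mono2) auto
    moreover have "(c * real (Suc n) powr (- 2 / (p - \<eta>))) powr q = c powr q * real (Suc n) powr (- 1)"
      using q by (simp add: powr_mult powr_powr \<eta>(3))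
    ultimately show ?thesis by (simp add: powr_minus)
  qed
  have "summable (\<lambda>n. c powr q * inverse (real (Suc n)))"
    by (rule summable_comparison_test'[OF summ, where N = 3]) (use ge in auto)
  hence "summable (\<lambda>n. inverse (real (Suc n)))" using c by (simp add: summable_cmult_iff)
  hence "summable (\<lambda>n. inverse (real n))" using summable_Suc_iff[of "\<lambda>n. inverse (real n)"] by blast
  thus False using not_summable_harmonic[where 'a = real] by simp
qed

text \<open>The sample points are reused with m = 4: the values at the first two differ by the
  factor i. The rate p / 2 is one admissible choice.\<close>

lemma phi_nonconstant: "\<not> phi constant_on ball 0 1"
proof
  assume "phi constant_on ball 0 1"
  then obtain b where b: "\<And>z. z \<in> ball 0 1 \<Longrightarrow> phi z = b" by (auto simp: constant_on_def)
  define x where "x = ln (4 * (2 + 2 / (p / 2))\<^sup>2 * (4::nat)) / (p - p / 2)"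
  have "0 < p / 2" "p / 2 < p" "(1::nat) \<le> 4" using p by auto
  note sm = small_H[OF this, folded x_def]
  obtain z :: "nat \<Rightarrow> complex" where
    z1: "\<And>k. k < 4 \<Longrightarrow> phi (z k) = of_real (exp (- 1 / (4::nat))) * cis (x + 1 + 2 * pi * k / (4::nat))"
    and z2: "\<And>k. k < 4 \<Longrightarrow> cmod (z k) < 1"
  proof (rule sample_points[of 4 x])
    show "4 \<le> (4::nat)" "0 \<le> x" by (simp, rule sm(1))
    show "cmod (H w) \<le> 1 / (4 * (4::nat))" if "w \<in> quarter_strip" "x \<le> Re w" for w
      using that by (rule sm(2))
  qed (rule that)
  have eq: "phi (z 0) = phi (z 1)" using z2[of 0] z2[of 1] b by simp
  define c where "c = of_real (exp (- 1 / (4::nat))) * cis (x + 1)"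
  have c: "c \<noteq> 0" by (simp add: c_def)
  have "phi (z 0) = c" using z1[of 0] by (simp add: c_def)
  moreover have "phi (z 1) = c * \<i>"
  proof -
    have "cis (x + 1 + 2 * pi * real 1 / real 4) = cis (x + 1) * cis (pi / 2)" unfolding cis_mult by simp
    thus ?thesis using z1[of 1] unfolding c_def by (simp only: cis_pi_half mult.assoc)
  qed
  ultimately have "c * 1 = c * \<i>" using eq by simp
  hence "1 = \<i>" using c by (subst (asm) mult_cancel_left) simp
  thus False by (simp add: complex_eq_iff)
qed

end

theorem theorem4p5:
  fixes p :: real
  assumes "0 < p"
  shows "\<exists>\<phi> :: complex \<Rightarrow> complex.
           \<phi> holomorphic_on unit_disc \<and> \<phi> ` unit_disc \<subseteq> unit_disc \<and>
           \<not> \<phi> constant_on unit_disc \<and>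
           composition_operator \<phi> \<in> schatten_class p hardy_space hardy_norm \<and>
           (\<forall>q. 0 < q \<and> q < p / 2 \<longrightarrow>
              composition_operator \<phi> \<notin> schatten_class q bergman_space bergman_norm)"
proof -
  interpret spiral_symbol p using assms by unfold_locales
  show ?thesis
    using phi_holomorphic phi_disc phi_nonconstant Cphi_schatten_hardy Cphi_not_schatten_bergman
    by (intro exI[of _ phi]) auto
qed

end
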